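(* Let $n \ge 3$ be odd and let $D \subset \mathbb{R}^n$ be a bounded domain with infinitely smooth boundary. Then $D$ is an algebraically $t$-integrable domain, free of real singularities, if and only if $D$ is an ellipsoid.
   Context: For a bounded domain $D\subset\mathbb{R}^n$, the volume function is $$V_D(\xi,t)=\mathrm{vol}_n\big(D\cap\{x:\langle \xi,x\rangle\le t\}\big),\qquad \xi\in S^{n-1},\ t\in\mathbb{R},$$ considered on its natural domain of definition: those $(\xi,t)$ for which the hyperplane $\{\langle\xi,x\rangle=t\}$ meets $D$ (equivalently, up to endpoints, $h_-(\xi)\le t\le h_+(\xi)$, where $h_-(\xi)=\inf_{x\in D}\langle\xi,x\rangle$ and $h_+(\xi)=\sup_{x\in D}\langle\xi,x\rangle$). $C(S^{n-1})$ is the algebra of continuous (complex-valued) functions on the unit sphere $S^{n-1}$, and $C(S^{n-1})[z,w]$ is the ring of polynomials in two complex variables $z,w$ with coefficients in $C(S^{n-1})$. $D$ is called algebraically $t$-integrable if there is a nonzero $Q\in C(S^{n-1})[z,w]$, i.e. $Q(\xi,t,w)=\sum_{i=0}^N q_i(\xi,t)w^i$ with $q_i(\xi,t)=\sum_{k=0}^{k_i} q_{i,k}(\xi)t^k$, $q_{i,k}\in C(S^{n-1})$, such that $Q(\xi,t,V_D(\xi,t))=0$ for all $(\xi,t)$ in the natural domain of definition of $V_D$. For such $Q$ (of degree $N\ge1$ in $w$, with leading coefficient $q_N$) let $\mathrm{Res}_Q(\xi,t)$ be the resultant, with respect to $w$, of $Q(\xi,t,w)$ and $\partial Q/\partial w(\xi,t,w)$;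 up to a sign it equals $q_N(\xi,t)^{2N-1}\prod_{i<j}(w_i(\xi,t)-w_j(\xi,t))^2$, where the $w_i(\xi,t)$ are the roots in $w$ of $Q(\xi,t,w)=0$. It is a polynomial in $t$ with coefficients in $C(S^{n-1})$: $\mathrm{Res}_Q(\xi,t)=\sum_{j=0}^M r_j(\xi)t^j$, with leading coefficient $r_M$. An algebraically $t$-integrable domain $D$ is called free of real singularities if a nonzero $Q\in C(S^{n-1})[z,w]$, of degree $N\ge1$ in $w$, with $Q(\xi,t,V_D(\xi,t))=0$ for all $(\xi,t)$ in the natural domain of definition of $V_D$, can be chosen such that: (1) $r_M(\xi)\neq0$ for all $\xi\in S^{n-1}$; and (2) $\mathrm{Res}_Q(\xi,t)\ne0$ for all $(\xi,t)\in S^{n-1}\times\mathbb{R}$. An ellipsoid means the (solid) image of the unit ball of $\mathbb{R}^n$ under a non-degenerate affine transformation. *)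

theory Defs
  imports "HOL-Analysis.Analysis" "Subresultants.Resultant_Prelim"
begin

section \<open>The algebra of continuous complex-valued functions on the unit sphere\<close>

text \<open>A continuous function on the sphere is represented by its extension by zero to the
  whole space. The algebra is made a type, so that polynomials over it, their degrees and
  leading coefficients, and resultants are the library's ones.\<close>

typedef (overloaded) ('n::finite) csphere =
  "{f :: real^'n \<Rightarrow> complex.
      continuous_on (sphere 0 1) f \<and> (\<forall>x. x \<notin> sphere 0 1 \<longrightarrow> f x = 0)}"
  morphisms csphere_apply Abs_csphere
  by (rule exI[of _ "\<lambda>_. 0"]) auto

setup_lifting type_definition_csphere

instantiation csphere :: (finite) comm_ring_1
begin

lift_definition zero_csphere :: "'a csphere" is "\<lambda>_. 0" by auto

lift_definition one_csphere :: "'a csphere" is "\<lambda>x. if x \<in> sphere 0 1 then 1 else 0"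
proof -
  have "continuous_on (sphere 0 1) (\<lambda>x :: real^'a. if x \<in> sphere 0 1 then 1 else (0::complex))"
    by (rule continuous_on_eq[OF continuous_on_const[of _ 1]]) simp
  then show ?thesis by auto
qed

lift_definition plus_csphere :: "'a csphere \<Rightarrow> 'a csphere \<Rightarrow> 'a csphere"
  is "\<lambda>f g x. f x + g x" by (auto intro: continuous_on_add)

lift_definition minus_csphere :: "'a csphere \<Rightarrow> 'a csphere \<Rightarrow> 'a csphere"
  is "\<lambda>f g x. f x - g x" by (auto intro: continuous_on_diff)

lift_definition uminus_csphere :: "'a csphere \<Rightarrow> 'a csphere"
  is "\<lambda>f x. - f x" by (auto intro: continuous_on_minus)

lift_definition times_csphere :: "'a csphere \<Rightarrow> 'a csphere \<Rightarrow> 'a csphere"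
  is "\<lambda>f g x. f x * g x" by (auto intro: continuous_on_mult)

instance
proof
  obtain x :: "real^'a" where "norm x = 1" using vector_choose_size[of 1] by auto
  then have "(\<lambda>_. 0) \<noteq> (\<lambda>x :: real^'a. if x \<in> sphere 0 1 then 1 else (0::complex))"
    by (auto simp: fun_eq_iff)
  then show "(0 :: 'a csphere) \<noteq> 1" by transfer
qed (transfer; force simp: fun_eq_iff algebra_simps)+

end


section \<open>Polynomials in two variables\<close>

text \<open>An element of \<open>C(S)[z,w]\<close> is a polynomial in \<open>w\<close> (outer) whose coefficients are
  polynomials in \<open>z\<close> (inner) over \<open>C(S)\<close>.\<close>

definition eval_z :: "('n::finite) csphere poly \<Rightarrow> real^'n \<Rightarrow> complex \<Rightarrow> complex" where
  "eval_z q \<xi> z = poly (map_poly (\<lambda>a. csphere_apply a \<xi>) q) z"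

definition eval_zw ::
  "('n::finite) csphere poly poly \<Rightarrow> real^'n \<Rightarrow> complex \<Rightarrow> complex \<Rightarrow> complex" where
  "eval_zw Q \<xi> z w = poly (map_poly (\<lambda>q. eval_z q \<xi> z) Q) w"

text \<open>The library's \<open>pderiv\<close> requires a coefficient ring without zero divisors, which
  \<open>C(S)[z]\<close> is not.\<close>

definition deriv_w :: "'a::comm_ring_1 poly \<Rightarrow> 'a poly" where
  "deriv_w Q = (\<Sum>i=1..degree Q. monom (of_nat i * coeff Q i) (i - 1))"

lemma coeff_deriv_w: "coeff (deriv_w Q) i = of_nat (Suc i) * coeff Q (Suc i)"
proof -
  have "coeff (deriv_w Q) i =
      (\<Sum>j=1..degree Q. if j = Suc i then of_nat j * coeff Q j else 0)"
    unfolding deriv_w_def coeff_sum coeff_monom by (intro sum.cong) auto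
  also have "\<dots> = of_nat (Suc i) * coeff Q (Suc i)"
    by (subst sum.delta) (auto simp: coeff_eq_0 simp del: of_nat_Suc)
  finally show ?thesis .
qed

definition Res :: "('n::finite) csphere poly poly \<Rightarrow> 'n csphere poly" where
  "Res Q = resultant Q (deriv_w Q)"


section \<open>The volume function and algebraic integrability\<close>

definition vol_fun :: "(real^'n) set \<Rightarrow> real^'n \<Rightarrow> real \<Rightarrow> real" where
  "vol_fun D \<xi> t = measure lebesgue (D \<inter> {x. inner \<xi> x \<le> t})"

definition vol_domain :: "(real^'n) set \<Rightarrow> ((real^'n) \<times> real) set" where
  "vol_domain D = {(\<xi>, t). \<xi> \<in> sphere 0 1 \<and> (\<exists>x\<in>D. inner \<xi> x = t)}"

definition annihilates_vol :: "('n::finite) csphere poly poly \<Rightarrow> (real^'n) set \<Rightarrow> bool" where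
  "annihilates_vol Q D \<longleftrightarrow>
     (\<forall>(\<xi>, t) \<in> vol_domain D. eval_zw Q \<xi> (of_real t) (of_real (vol_fun D \<xi> t)) = 0)"

definition algebraically_t_integrable :: "(real^'n::finite) set \<Rightarrow> bool" where
  "algebraically_t_integrable D \<longleftrightarrow>
     (\<exists>Q :: 'n csphere poly poly. Q \<noteq> 0 \<and> annihilates_vol Q D)"

definition free_of_real_singularities :: "(real^'n::finite) set \<Rightarrow> bool" where
  "free_of_real_singularities D \<longleftrightarrow>
     (\<exists>Q :: 'n csphere poly poly. Q \<noteq> 0 \<and> degree Q \<ge> 1 \<and> annihilates_vol Q D \<and>
        (\<forall>\<xi> \<in> sphere 0 1. csphere_apply (lead_coeff (Res Q)) \<xi> \<noteq> 0) \<and>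
        (\<forall>\<xi> \<in> sphere 0 1. \<forall>t::real. eval_z (Res Q) \<xi> (of_real t) \<noteq> 0))"


section \<open>Domains with smooth boundary and ellipsoids\<close>

text \<open>Intended for open \<open>U\<close>: a function is \<open>C\<^sup>k\<^sup>+\<^sup>1\<close> iff it is differentiable and all its
  directional derivatives are \<open>C\<^sup>k\<close>.\<close>

fun Ck_on :: "nat \<Rightarrow> ('a::euclidean_space \<Rightarrow> real) \<Rightarrow> 'a set \<Rightarrow> bool" where
  "Ck_on 0 f U \<longleftrightarrow> continuous_on U f"
| "Ck_on (Suc k) f U \<longleftrightarrow> (\<forall>x\<in>U. f differentiable (at x)) \<and>
     (\<forall>v. Ck_on k (\<lambda>x. frechet_derivative f (at x) v) U)"

definition Cinfinity_on :: "('a::euclidean_space \<Rightarrow> real) \<Rightarrow> 'a set \<Rightarrow> bool" where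
  "Cinfinity_on f U \<longleftrightarrow> (\<forall>k. Ck_on k f U)"

text \<open>Near each boundary point, \<open>D\<close> is the negativity set of a \<open>C\<^sup>\<infinity>\<close> function without
  critical points. In particular the boundary is locally the zero set of that function, and
  \<open>D\<close> lies locally on one side of it.\<close>

definition smooth_boundary :: "'a::euclidean_space set \<Rightarrow> bool" where
  "smooth_boundary D \<longleftrightarrow>
     (\<forall>p \<in> frontier D. \<exists>U \<rho>. open U \<and> p \<in> U \<and> Cinfinity_on \<rho> U \<and>
        (\<forall>x\<in>U. frechet_derivative \<rho> (at x) \<noteq> (\<lambda>_. 0)) \<and>
        D \<inter> U = {x \<in> U. \<rho> x < 0})"

text \<open>Domains are open, so the solid ellipsoid is the image of the open unit ball.\<close>

definition ellipsoid :: "'a::euclidean_space set \<Rightarrow> bool" where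
  "ellipsoid D \<longleftrightarrow> (\<exists>(f :: 'a \<Rightarrow> 'a) b. linear f \<and> bij f \<and> D = (\<lambda>x. f x + b) ` ball 0 1)"

end

theory Submission
  imports Defs "HOL-Complex_Analysis.Complex_Analysis" "HOL-Computational_Algebra.Fundamental_Theorem_Algebra"
    "HOL-Computational_Algebra.Field_as_Ring"
begin

text \<open>An ellipsoid is an affine image of the ball, and the sections of the ball in odd dimension
  have polynomial volume, so \<open>w - p\<close> annihilates the volume function and has resultant \<open>1\<close>.

  Conversely, without real singularities the roots of \<open>Q\<close> are simple and form a covering, so
  that the volume function \<open>V(y, \<cdot>)\<close> continues to a function of all of \<open>t\<close> of polynomial growth,
  holomorphic near the real line. Its averages against polynomials in \<open>y\<close> over a shell are
  polynomials in \<open>t\<close> near an interior point of \<open>D\<close>, by odd dimension, hence everywhere, with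
  a uniform bound on the degree; by the Weierstrass theorem \<open>V(y, t)\<close> itself is a polynomial in
  \<open>t\<close>.

  Let \<open>a\<close> and \<open>b\<close> be the infimum and the supremum of \<open>y \<bullet> x\<close> over \<open>D\<close>, and \<open>M\<close> a bound for the
  degree. The linear form \<open>p \<mapsto> \<integral>\<^sub>D p\<^sup>(\<^sup>M\<^sup>)(y \<bullet> x) dx\<close> on polynomials depends polynomially on \<open>y\<close> and
  its annihilator is generated by some \<open>(X - a)\<^sup>i (X - b)\<^sup>j\<close>. Hankel determinants show that the
  coefficients of this generator are polynomials along lines of directions \<open>y\<close>. Hence \<open>i = j\<close>,
  \<open>a + b\<close> is linear and \<open>(b - a)\<^sup>2\<close> is a quadratic form in \<open>y\<close>: the support function of \<open>D\<close> is
  that of an ellipsoid \<open>E\<close>. As the boundary of \<open>D\<close> is smooth, \<open>E - D\<close> stays away from the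
  boundary of \<open>E\<close>; both volume functions being polynomials, \<open>E - D\<close> is a null set, hence
  empty.\<close>

text \<open>For a single direction nothing forces the volume function to be polynomial near an
  interior point. Only averages over y are accessible: Fubini turns them into integrals over x of
  half space sections of a fixed shell. Returning from averages to V itself requires one finite
  formula for all test polynomials, namely interpolation at d + 1 fixed nodes, where d is the growth
  order of the roots. This order is uniform because the leading coefficient q_N divides the
  resultant: a positive lower bound for |Res|, valid up to t = infinity by the condition on r_M,
  bounds 1/|q_N| by a polynomial. Monodromy is avoided by continuing along segments that issue from
  a hyperplane meeting D. Lines of directions keep the later algebra in one variable; the exponents
  i and j might then jump with the line parameter, which continuity of the support function
  excludes. The support function knows the convex hull of D only, so holes and dents remain
  possible; the smooth boundary and a comparison of volumes on both sides of E - D deal with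
  them.\<close>

no_notation scalar_prod (infix "\<bullet>" 70)

section \<open>Polynomials: interpolation and growth\<close>

definition lagrange_basis :: "(nat \<Rightarrow> real) \<Rightarrow> nat \<Rightarrow> nat \<Rightarrow> real poly" where
  "lagrange_basis x d j =
     Polynomial.smult (1 / (\<Prod>i\<in>{..d}-{j}. x j - x i)) (\<Prod>i\<in>{..d}-{j}. [:- x i, 1:])"

lemma degree_lagrange_basis: "j \<le> d \<Longrightarrow> degree (lagrange_basis x d j) \<le> d"
proof -
  assume j: "j \<le> d"
  have "degree (\<Prod>i\<in>{..d}-{j}. [:- x i, 1:]) \<le> sum (degree \<circ> (\<lambda>i. [:- x i, 1:])) ({..d}-{j})"
    by (rule degree_prod_sum_le) simp
  also have "\<dots> = d" using j by (simp add: card_Diff_singleton)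
  finally show ?thesis
    unfolding lagrange_basis_def by (meson degree_smult_le le_trans)
qed

text \<open>A polynomial of degree at most d with d + 1 roots is 0. The weights depend on the nodes
  and on t but not on \<open>p\<close>, so the formula survives integration over any parameter of
  \<open>p\<close>; polynomial dependence on t is carried through all later averages in this
  form.\<close>

lemma lagrange_interpolation:
  fixes p :: "'a::real_field poly"
  assumes inj: "inj_on x {..d}" and deg: "degree p \<le> d"
  shows "poly p (of_real t) =
    (\<Sum>j\<le>d. of_real (poly (lagrange_basis x d j) t) * poly p (of_real (x j)))"
proof -
  define l :: "nat \<Rightarrow> 'a poly" where
    "l j = Polynomial.smult (1 / (\<Prod>i\<in>{..d}-{j}. of_real (x j) - of_real (x i)))
             (\<Prod>i\<in>{..d}-{j}. [:- of_real (x i), 1:])" for j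
  have l: "poly (l j) (of_real t) = of_real (poly (lagrange_basis x d j) t)" for j t
    by (simp add: l_def lagrange_basis_def poly_prod)
  have degl: "degree (l j) \<le> d" if "j \<le> d" for j
  proof -
    have "degree (\<Prod>i\<in>{..d}-{j}. [:- of_real (x i) :: 'a, 1:])
        \<le> sum (degree \<circ> (\<lambda>i. [:- of_real (x i) :: 'a, 1:])) ({..d}-{j})"
      by (rule degree_prod_sum_le) simp
    also have "\<dots> = d" using that by (simp add: card_Diff_singleton)
    finally show ?thesis unfolding l_def by (meson degree_smult_le le_trans)
  qed
  have lval: "poly (l j) (of_real (x k)) = (if j = k then 1 else 0)" if "j \<le> d" "k \<le> d" for j k
  proof (cases "j = k")
    case True
    have "(\<Prod>i\<in>{..d}-{k}. of_real (x k) - of_real (x i) :: 'a) \<noteq> 0"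
      using inj that by (auto simp: inj_on_def)
    then show ?thesis using True by (simp add: l_def poly_prod)
  next
    case False
    then have "(\<Prod>i\<in>{..d}-{j}. of_real (x k) - of_real (x i) :: 'a) = 0"
      using that by (intro prod_zero) auto
    then show ?thesis using False by (simp add: l_def poly_prod)
  qed
  define q where "q = p - (\<Sum>j\<le>d. Polynomial.smult (poly p (of_real (x j))) (l j))"
  have "degree q \<le> d" unfolding q_def
    using deg degl by (intro degree_diff_le degree_sum_le) (auto intro: le_trans[OF degree_smult_le])
  have root: "poly q (of_real (x k)) = 0" if "k \<le> d" for k
    using that by (simp add: q_def poly_sum lval if_distrib cong: if_cong)
  have "q = 0"
  proof (rule ccontr)
    assume "q \<noteq> 0"
    have "inj_on (\<lambda>k. of_real (x k) :: 'a) {..d}" using inj by (auto simp: inj_on_def)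
    then have "card ((\<lambda>k. of_real (x k) :: 'a) ` {..d}) = Suc d" by (simp add: card_image)
    moreover have "card ((\<lambda>k. of_real (x k) :: 'a) ` {..d}) \<le> card {z. poly q z = 0}"
      using root \<open>q \<noteq> 0\<close> by (intro card_mono poly_roots_finite) auto
    moreover have "card {z. poly q z = 0} \<le> degree q"
      using \<open>q \<noteq> 0\<close> by (rule card_poly_roots_bound)
    ultimately show False using \<open>degree q \<le> d\<close> by simp
  qed
  then have "p = (\<Sum>j\<le>d. Polynomial.smult (poly p (of_real (x j))) (l j))" by (simp add: q_def)
  then have "poly p (of_real t) = (\<Sum>j\<le>d. poly p (of_real (x j)) * poly (l j) (of_real t))"
    by (metis (no_types, lifting) poly_smult poly_sum sum.cong)
  then show ?thesis by (simp add: l mult.commute)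
qed

lemma poly_norm_bound:
  fixes p :: "'a::real_normed_field poly"
  obtains C where "C \<ge> 0" "\<And>z. norm (poly p z) \<le> C * (1 + norm z) ^ degree p"
proof
  show "0 \<le> (\<Sum>i\<le>degree p. norm (coeff p i))" by (simp add: sum_nonneg)
  fix z
  have "norm (poly p z) \<le> (\<Sum>i\<le>degree p. norm (coeff p i) * norm z ^ i)"
    unfolding poly_altdef by (rule order_trans[OF norm_sum]) (simp add: norm_mult norm_power)
  also have "\<dots> \<le> (\<Sum>i\<le>degree p. norm (coeff p i) * (1 + norm z) ^ degree p)"
  proof (intro sum_mono mult_left_mono)
    fix i assume "i \<in> {..degree p}"
    have "norm z ^ i \<le> (1 + norm z) ^ i" by (intro power_mono) auto
    also have "\<dots> \<le> (1 + norm z) ^ degree p" using \<open>i \<in> _\<close> by (intro power_increasing) auto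
    finally show "norm z ^ i \<le> (1 + norm z) ^ degree p" .
  qed auto
  finally show "norm (poly p z) \<le> (\<Sum>i\<le>degree p. norm (coeff p i)) * (1 + norm z) ^ degree p"
    by (simp add: sum_distrib_right)
qed

text \<open>Split p = r + X^M q, where r collects the coefficients below M. On t \<ge> 1 the growth
  bound keeps q bounded, whereas a nonconstant q tends to infinity.\<close>

lemma degree_le_of_growth:
  fixes p :: "complex poly"
  assumes "\<And>t::real. t \<ge> 1 \<Longrightarrow> cmod (poly p (of_real t)) \<le> C * (1 + t) ^ M"
  shows "degree p \<le> M"
proof (rule ccontr)
  assume "\<not> degree p \<le> M"
  define q where "q = poly_shift M p"
  define r where "r = poly_cutoff M p"
  have p: "p = r + monom 1 M * q"
    by (rule poly_eqI) (auto simp: q_def r_def coeff_poly_shift coeff_poly_cutoff coeff_monom_mult)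
  have "degree r \<le> M" unfolding r_def
    by (rule degree_le) (auto simp: coeff_poly_cutoff)
  obtain C' where C': "C' \<ge> 0" "\<And>z. norm (poly r z) \<le> C' * (1 + norm z) ^ degree r"
    using poly_norm_bound by blast
  have "coeff q (degree p - M) \<noteq> 0" using \<open>\<not> degree p \<le> M\<close>
    by (auto simp: q_def coeff_poly_shift)
  obtain a q' where q': "q = pCons a q'" by (metis pCons_cases)
  have "q' \<noteq> 0" using \<open>coeff q (degree p - M) \<noteq> 0\<close> \<open>\<not> degree p \<le> M\<close> q'
    by (auto simp: coeff_pCons split: nat.splits)
  \<comment> \<open>One more than the bound that (1 + t)^M \<le> (2 t)^M yields for |q(t)|
    below.\<close>
  then obtain R where R: "\<And>z. R \<le> norm z \<Longrightarrow> (\<bar>C\<bar> + C') * 2 ^ M + 1 \<le> norm (poly (pCons a q') z)"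
    using poly_infinity[of q' "(\<bar>C\<bar> + C') * 2 ^ M + 1" a] by blast
  define t where "t = max R 1"
  have t: "t \<ge> 1" "R \<le> norm (of_real t :: complex)" by (auto simp: t_def)
  have "norm (of_real t ^ M * poly q (of_real t)) \<le> norm (poly p (of_real t)) + norm (poly r (of_real t))"
  proof -
    have "of_real t ^ M * poly q (of_real t) = poly p (of_real t) - poly r (of_real t)"
      by (subst p) (simp add: poly_monom)
    then show ?thesis by (metis norm_triangle_ineq4)
  qed
  also have "\<dots> \<le> C * (1 + t) ^ M + C' * (1 + t) ^ M"
  proof (intro add_mono assms t)
    have "norm (poly r (of_real t)) \<le> C' * (1 + t) ^ degree r" using C'(2)[of "of_real t"] t by simp
    also have "\<dots> \<le> C' * (1 + t) ^ M" using t C' \<open>degree r \<le> M\<close>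
      by (intro mult_left_mono power_increasing) auto
    finally show "norm (poly r (of_real t)) \<le> C' * (1 + t) ^ M" .
  qed
  also have "\<dots> \<le> (\<bar>C\<bar> + C') * (1 + t) ^ M"
    using t by (simp add: distrib_right mult_right_mono)
  also have "\<dots> \<le> (\<bar>C\<bar> + C') * (2 * t) ^ M"
    using t C' by (intro mult_left_mono power_mono) auto
  also have "\<dots> = t ^ M * ((\<bar>C\<bar> + C') * 2 ^ M)" by (simp add: power_mult_distrib)
  finally have "t ^ M * norm (poly q (of_real t)) \<le> t ^ M * ((\<bar>C\<bar> + C') * 2 ^ M)"
    using t by (simp add: norm_mult norm_power)
  then have "norm (poly q (of_real t)) \<le> (\<bar>C\<bar> + C') * 2 ^ M" using t by simp
  then show False using R[OF t(2)] q' by simp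
qed

section \<open>Slicing a half ball\<close>

text \<open>The shift s -> s + y \<bullet> e and, after interchanging the integrals, the shift y ->
  y - s e separate the variables, leaving the total weight of \<open>\<phi>\<close> as a
  factor.\<close>

lemma nn_integral_slices:
  fixes e :: "'a::euclidean_space" and f :: "'a \<Rightarrow> ennreal" and \<phi> :: "real \<Rightarrow> ennreal"
  assumes [measurable]: "f \<in> borel_measurable borel" "\<phi> \<in> borel_measurable borel"
    and e: "norm e = 1"
  shows "(\<integral>\<^sup>+y. \<integral>\<^sup>+s. \<phi> (y \<bullet> e) * f (y + (s - y \<bullet> e) *\<^sub>R e) \<partial>lborel \<partial>lborel)
    = (\<integral>\<^sup>+s. \<phi> s \<partial>lborel) * (\<integral>\<^sup>+y. f y \<partial>lborel)"
proof -
  have shift: "(\<integral>\<^sup>+y. h (c + y) \<partial>lborel) = (\<integral>\<^sup>+y. h y \<partial>lborel)"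
    if [measurable]: "h \<in> borel_measurable borel" for h :: "'b::euclidean_space \<Rightarrow> ennreal" and c
    using lborel_distr_plus[of c] nn_integral_distr[of "(+) c" lborel borel h] by simp
  have "(\<integral>\<^sup>+y. \<integral>\<^sup>+s. \<phi> (y \<bullet> e) * f (y + (s - y \<bullet> e) *\<^sub>R e) \<partial>lborel \<partial>lborel)
      = (\<integral>\<^sup>+y. \<integral>\<^sup>+s. \<phi> (y \<bullet> e) * f (y + s *\<^sub>R e) \<partial>lborel \<partial>lborel)"
  proof (rule nn_integral_cong)
    fix y
    show "(\<integral>\<^sup>+s. \<phi> (y \<bullet> e) * f (y + (s - y \<bullet> e) *\<^sub>R e) \<partial>lborel)
        = (\<integral>\<^sup>+s. \<phi> (y \<bullet> e) * f (y + s *\<^sub>R e) \<partial>lborel)"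
      using shift[of "\<lambda>s. \<phi> (y \<bullet> e) * f (y + s *\<^sub>R e)" "- (y \<bullet> e)"] by (simp add: algebra_simps)
  qed
  also have "\<dots> = (\<integral>\<^sup>+s. \<integral>\<^sup>+y. \<phi> (y \<bullet> e) * f (y + s *\<^sub>R e) \<partial>lborel \<partial>lborel)"
    by (rule lborel_pair.Fubini') measurable
  also have "\<dots> = (\<integral>\<^sup>+s. \<integral>\<^sup>+y. \<phi> (y \<bullet> e - s) * f y \<partial>lborel \<partial>lborel)"
  proof (rule nn_integral_cong)
    fix s
    show "(\<integral>\<^sup>+y. \<phi> (y \<bullet> e) * f (y + s *\<^sub>R e) \<partial>lborel) = (\<integral>\<^sup>+y. \<phi> (y \<bullet> e - s) * f y \<partial>lborel)"
      using shift[of "\<lambda>y. \<phi> (y \<bullet> e - s) * f y" "s *\<^sub>R e"] e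
      by (simp add: algebra_simps inner_add_left dot_square_norm)
  qed
  also have "\<dots> = (\<integral>\<^sup>+y. \<integral>\<^sup>+s. \<phi> (y \<bullet> e - s) * f y \<partial>lborel \<partial>lborel)"
    by (rule lborel_pair.Fubini') measurable
  also have "\<dots> = (\<integral>\<^sup>+y. (\<integral>\<^sup>+s. \<phi> s \<partial>lborel) * f y \<partial>lborel)"
  proof (rule nn_integral_cong)
    fix y
    have "(\<integral>\<^sup>+s. \<phi> (y \<bullet> e - s) \<partial>lborel) = (\<integral>\<^sup>+s. \<phi> s \<partial>lborel)"
      using nn_integral_real_affine[of \<phi> "-1" "y \<bullet> e"] by simp
    then show "(\<integral>\<^sup>+s. \<phi> (y \<bullet> e - s) * f y \<partial>lborel) = (\<integral>\<^sup>+s. \<phi> s \<partial>lborel) * f y"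
      by (simp add: nn_integral_multc)
  qed
  also have "\<dots> = (\<integral>\<^sup>+s. \<phi> s \<partial>lborel) * (\<integral>\<^sup>+y. f y \<partial>lborel)"
    by (simp add: nn_integral_cmult)
  finally show ?thesis .
qed

text \<open>The integral of \<open>g\<close> over the hyperplane orthogonal to \<open>e\<close>, written as an integral over
  a slab of width one so that no measure on the hyperplane is needed.\<close>

definition hyper_int :: "'a::euclidean_space \<Rightarrow> ('a \<Rightarrow> real) \<Rightarrow> real" where
  "hyper_int e g = (LINT y|lborel. indicator {-1/2..1/2} (y \<bullet> e) * g (y - (y \<bullet> e) *\<^sub>R e))"

text \<open>\<open>\<phi>\<close> is the indicator of an interval of length one, hence of total
  weight one in \<open>nn_integral_slices\<close>; the positive and negative parts of f are handled
  separately.\<close>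

lemma integral_slices:
  fixes e :: "'a::euclidean_space" and f :: "'a \<Rightarrow> real"
  assumes f[measurable]: "integrable lborel f" and e: "norm e = 1"
  shows "(LINT y|lborel. f y) = (LINT s|lborel. hyper_int e (\<lambda>y. f (y + s *\<^sub>R e)))"
proof -
  have [measurable]: "f \<in> borel_measurable borel" using f by simp
  define \<phi> :: "real \<Rightarrow> real" where "\<phi> = indicator {-1/2..1/2}"
  have [measurable]: "\<phi> \<in> borel_measurable borel" by (simp add: \<phi>_def)
  have \<phi>0: "\<phi> s \<ge> 0" for s by (simp add: \<phi>_def)
  have \<phi>1: "(\<integral>\<^sup>+s. ennreal (\<phi> s) \<partial>lborel) = 1"
    by (simp add: \<phi>_def ennreal_indicator)
  define F where "F = (\<lambda>(y::'a, s). \<phi> (y \<bullet> e) * f (y + (s - y \<bullet> e) *\<^sub>R e))"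
  have [measurable]: "F \<in> borel_measurable (lborel \<Otimes>\<^sub>M lborel)"
    unfolding F_def by measurable
  have nn: "(\<integral>\<^sup>+z. ennreal (\<phi> (fst z \<bullet> e) * h (fst z + (snd z - fst z \<bullet> e) *\<^sub>R e)) \<partial>(lborel \<Otimes>\<^sub>M lborel))
      = (\<integral>\<^sup>+y. ennreal (h y) \<partial>lborel)"
    if [measurable]: "h \<in> borel_measurable borel" for h
  proof -
    have "(\<integral>\<^sup>+z. ennreal (\<phi> (fst z \<bullet> e) * h (fst z + (snd z - fst z \<bullet> e) *\<^sub>R e)) \<partial>(lborel \<Otimes>\<^sub>M lborel))
      = (\<integral>\<^sup>+y. \<integral>\<^sup>+s. ennreal (\<phi> (y \<bullet> e) * h (y + (s - y \<bullet> e) *\<^sub>R e)) \<partial>lborel \<partial>lborel)"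
      by (subst lborel.nn_integral_fst[symmetric]) simp_all
    also have "\<dots> = (\<integral>\<^sup>+y. \<integral>\<^sup>+s. ennreal (\<phi> (y \<bullet> e)) * ennreal (h (y + (s - y \<bullet> e) *\<^sub>R e)) \<partial>lborel \<partial>lborel)"
      by (simp add: ennreal_mult' \<phi>0)
    also have "\<dots> = (\<integral>\<^sup>+y. ennreal (h y) \<partial>lborel)"
      by (subst nn_integral_slices[OF _ _ e, where \<phi> = "\<lambda>x. ennreal (\<phi> x)" and f = "\<lambda>x. ennreal (h x)"])
        (simp_all add: \<phi>1)
    finally show ?thesis .
  qed
  have intF: "integrable (lborel \<Otimes>\<^sub>M lborel) F"
  proof (rule integrableI_bounded)
    have "(\<integral>\<^sup>+z. ennreal (norm (F z)) \<partial>(lborel \<Otimes>\<^sub>M lborel))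
      = (\<integral>\<^sup>+z. ennreal (\<phi> (fst z \<bullet> e) * norm (f (fst z + (snd z - fst z \<bullet> e) *\<^sub>R e))) \<partial>(lborel \<Otimes>\<^sub>M lborel))"
      by (simp add: F_def case_prod_beta abs_mult \<phi>0)
    also have "\<dots> = (\<integral>\<^sup>+y. ennreal (norm (f y)) \<partial>lborel)"
      by (rule nn) simp
    also have "\<dots> < \<infinity>" using f by (simp add: integrable_iff_bounded)
    finally show "(\<integral>\<^sup>+z. ennreal (norm (F z)) \<partial>(lborel \<Otimes>\<^sub>M lborel)) < \<infinity>" .
  qed simp
  have "integral\<^sup>L (lborel \<Otimes>\<^sub>M lborel) F = (LINT y|lborel. f y)"
    using nn[of f] nn[of "\<lambda>y. - f y"]
    by (simp add: real_lebesgue_integral_def[OF intF] real_lebesgue_integral_def[OF f])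
      (simp add: F_def case_prod_beta)
  moreover have "integral\<^sup>L (lborel \<Otimes>\<^sub>M lborel) F = (LINT s|lborel. LINT y|lborel. F (y, s))"
    using lborel_pair.integral_snd[of "\<lambda>y s. F (y, s)"] intF by simp
  moreover have "(LINT y|lborel. F (y, s)) = hyper_int e (\<lambda>y. f (y + s *\<^sub>R e))" for s
    by (simp add: F_def hyper_int_def \<phi>_def algebra_simps)
  ultimately show ?thesis by simp
qed

lemma integral_lborel_scale:
  fixes f :: "'a::euclidean_space \<Rightarrow> real"
  assumes [measurable]: "f \<in> borel_measurable borel" and c: "c \<noteq> 0"
  shows "(LINT y|lborel. f y) = \<bar>c\<bar> ^ DIM('a) * (LINT y|lborel. f (c *\<^sub>R y))"
  by (subst lborel_affine[OF c, of 0]) (simp add: integral_density integral_distr)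

text \<open>Homogeneity makes the integral of Q over a slice of radius k a constant times a power of
  k, and an odd degree makes it vanish. The coefficients of the powers of
  \<open>y \<bullet> e\<close> in a polynomial are sums of such functions.\<close>

definition cyl_homogeneous :: "'a::euclidean_space \<Rightarrow> nat \<Rightarrow> ('a \<Rightarrow> real) \<Rightarrow> bool" where
  "cyl_homogeneous e b Q \<longleftrightarrow> continuous_on UNIV Q \<and> (\<forall>y s. Q (y + s *\<^sub>R e) = Q y) \<and>
     (\<forall>c y. Q (c *\<^sub>R y) = c ^ b * Q y)"

lemma cyl_homogeneousD:
  assumes "cyl_homogeneous e b Q"
  shows "continuous_on UNIV Q" "Q (y + s *\<^sub>R e) = Q y" "Q (y - s *\<^sub>R e) = Q y"
    "Q (s *\<^sub>R e + y) = Q y" "Q (c *\<^sub>R y) = c ^ b * Q y" "Q \<in> borel_measurable borel"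
    "Q (- y) = (-1) ^ b * Q y"
proof -
  show *: "continuous_on UNIV Q" "\<And>s. Q (y + s *\<^sub>R e) = Q y" "\<And>c. Q (c *\<^sub>R y) = c ^ b * Q y"
    using assms by (auto simp: cyl_homogeneous_def)
  show "Q (y - s *\<^sub>R e) = Q y" using *(2)[of "- s"] by simp
  show "Q (s *\<^sub>R e + y) = Q y" using *(2)[of s] by (simp add: add.commute)
  show "Q \<in> borel_measurable borel" by (intro borel_measurable_continuous_onI *)
  show "Q (- y) = (-1) ^ b * Q y" using *(3)[of "-1"] by simp
qed

lemma bounded_measurable_integrable:
  fixes f :: "'a::euclidean_space \<Rightarrow> real"
  assumes "f \<in> borel_measurable borel" "\<And>y. y \<notin> cball 0 r \<Longrightarrow> f y = 0"
    "\<And>y. y \<in> cball 0 r \<Longrightarrow> \<bar>f y\<bar> \<le> B"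
  shows "integrable lborel f"
proof (rule Bochner_Integration.integrable_bound)
  show "integrable lborel (\<lambda>y::'a. B * indicator (cball 0 r) y)"
    by (intro integrable_mult_right integrable_real_indicator) (auto simp: emeasure_bounded_finite[simplified])
  show "AE y in lborel. norm (f y) \<le> norm (B * indicator (cball 0 r) y)"
  proof (rule AE_I2)
    fix y
    show "norm (f y) \<le> norm (B * indicator (cball 0 r) y)"
      using assms(2,3)[of y] by (cases "y \<in> cball 0 r") (auto simp: indicator_def)
  qed
qed (use assms in simp)

lemma continuous_bound_cball:
  fixes Q :: "'a::euclidean_space \<Rightarrow> real"
  assumes "continuous_on UNIV Q"
  obtains B where "\<And>y. y \<in> cball 0 r \<Longrightarrow> \<bar>Q y\<bar> \<le> B"
proof -
  have "compact (Q ` cball 0 r)"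
    by (intro compact_continuous_image continuous_on_subset[OF assms]) auto
  then have "bounded (Q ` cball 0 r)" by (rule compact_imp_bounded)
  then obtain B where "\<forall>x\<in>cball 0 r. \<bar>Q x\<bar> \<le> B" by (auto simp: bounded_iff)
  then show ?thesis using that[of B] by blast
qed

text \<open>Scaling in n - 1 dimensions is derived from scaling in n dimensions: the integral over a
  cylinder of radius and height k is computed once by slices, which gives the factor k, and once by
  the dilation y -> k y, which gives k^(n + b).\<close>

lemma hyper_int_scale:
  fixes e :: "'a::euclidean_space"
  assumes e: "norm e = 1" and Q: "cyl_homogeneous e b Q" and k: "k > 0"
  shows "hyper_int e (\<lambda>y. indicator (ball 0 k) y * Q y)
    = k ^ (b + DIM('a) - 1) * hyper_int e (\<lambda>y. indicator (ball 0 1) y * Q y)"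
proof -
  have [measurable]: "Q \<in> borel_measurable borel" by (rule cyl_homogeneousD(6)[OF Q])
  note Qs[simp] = cyl_homogeneousD(2-5)[OF Q]
  have [measurable]: "ball 0 k \<in> sets (borel :: 'a measure)" for k by simp
  define G where "G k y = indicator (ball 0 k) y * Q y" for k y
  have [measurable]: "G k \<in> borel_measurable borel" for k unfolding G_def by measurable
  \<comment> \<open>\<open>hyper_int\<close> always uses a slab of width one, which a dilation would
    change; here the slab has width k to match the radius.\<close>
  define f where "f y = indicator {-k/2..k/2} (y \<bullet> e) * G k (y - (y \<bullet> e) *\<^sub>R e)" for y
  have [measurable]: "f \<in> borel_measurable borel" unfolding f_def by measurable
  have ee: "e \<bullet> e = 1" using e by (simp add: dot_square_norm)
  obtain B where B: "\<And>y. y \<in> cball 0 k \<Longrightarrow> \<bar>Q y\<bar> \<le> B"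
    using continuous_bound_cball[OF cyl_homogeneousD(1)[OF Q]] by blast
  have "B \<ge> 0" using B[of 0] k by auto
  have int: "integrable lborel f"
  proof (rule bounded_measurable_integrable[of _ "2 * k" B])
    fix y :: 'a
    have y: "norm y \<le> norm (y - (y \<bullet> e) *\<^sub>R e) + \<bar>y \<bullet> e\<bar>"
      using norm_triangle_ineq[of "y - (y \<bullet> e) *\<^sub>R e" "(y \<bullet> e) *\<^sub>R e"] e by simp
    { assume "y \<notin> cball 0 (2 * k)"
      then show "f y = 0" using y k by (auto simp: f_def G_def indicator_def) }
    show "\<bar>f y\<bar> \<le> B" using B[of "y - (y \<bullet> e) *\<^sub>R e"] \<open>B \<ge> 0\<close>
      by (auto simp: f_def G_def indicator_def)
  qed simp
  have "hyper_int e (\<lambda>y. f (y + s *\<^sub>R e)) = indicator {-k/2..k/2} s * hyper_int e (G k)" for s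
  proof -
    have "f (y - (y \<bullet> e) *\<^sub>R e + s *\<^sub>R e) = indicator {-k/2..k/2} s * G k (y - (y \<bullet> e) *\<^sub>R e)" for y
      by (simp add: f_def inner_add_left inner_diff_left ee)
    then show ?thesis by (simp add: hyper_int_def mult.left_commute)
  qed
  then have "(LINT y|lborel. f y) = k * hyper_int e (G k)"
    using integral_slices[OF int e] k by simp
  also have "(LINT y|lborel. f y) = k ^ DIM('a) * (LINT y|lborel. f (k *\<^sub>R y))"
    using integral_lborel_scale[of f k] k by simp
  also have "(LINT y|lborel. f (k *\<^sub>R y)) = k ^ b * hyper_int e (G 1)"
  proof -
    have "f (k *\<^sub>R y) = k ^ b * (indicator {-1/2..1/2} (y \<bullet> e) * G 1 (y - (y \<bullet> e) *\<^sub>R e))" for y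
    proof -
      have "k *\<^sub>R y - (k * (y \<bullet> e)) *\<^sub>R e = k *\<^sub>R (y - (y \<bullet> e) *\<^sub>R e)" by (simp add: algebra_simps)
      then have "k *\<^sub>R y - (k *\<^sub>R y \<bullet> e) *\<^sub>R e = k *\<^sub>R (y - (y \<bullet> e) *\<^sub>R e)" by simp
      moreover have "k *\<^sub>R z \<in> ball 0 k \<longleftrightarrow> z \<in> ball 0 1" for z :: 'a using k by simp
      moreover have "k *\<^sub>R y \<bullet> e \<in> {-k/2..k/2} \<longleftrightarrow> y \<bullet> e \<in> {-1/2..1/2}"
        using k mult_le_cancel_left_pos[of k "-1/2" "y \<bullet> e"] mult_le_cancel_left_pos[of k "y \<bullet> e" "1/2"]
        by auto
      ultimately show ?thesis
        unfolding f_def G_def indicator_def by (simp del: mem_ball)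
    qed
    then show ?thesis by (simp add: hyper_int_def)
  qed
  finally have "k * (k ^ (b + DIM('a) - 1) * hyper_int e (G 1)) = k * hyper_int e (G k)"
    using DIM_positive[where 'a='a] by (cases "DIM('a)") (auto simp: power_add algebra_simps)
  then have "k ^ (b + DIM('a) - 1) * hyper_int e (G 1) = hyper_int e (G k)"
    using k by (metis less_irrefl mult_left_cancel)
  then show ?thesis by (simp add: G_def[abs_def])
qed

text \<open>The reflection y -> -y preserves the slab and the ball and changes the sign of
  Q.\<close>

lemma hyper_int_odd:
  fixes e :: "'a::euclidean_space"
  assumes e: "norm e = 1" and Q: "cyl_homogeneous e b Q" and "odd b"
  shows "hyper_int e (\<lambda>y. indicator (ball 0 k) y * Q y) = 0"
proof -
  have [measurable]: "Q \<in> borel_measurable borel" by (rule cyl_homogeneousD(6)[OF Q])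
  have [measurable]: "ball 0 k \<in> sets (borel :: 'a measure)" by simp
  note Qs[simp] = cyl_homogeneousD(2-5,7)[OF Q]
  let ?g = "\<lambda>y. indicator {-1/2..1/2} (y \<bullet> e) * (indicator (ball 0 k) (y - (y \<bullet> e) *\<^sub>R e) * Q (y - (y \<bullet> e) *\<^sub>R e)) :: real"
  have "(LINT y|lborel. ?g y) = (LINT y|lborel. ?g (- y))"
    by (subst integral_lborel_scale[of ?g "-1"]) simp_all
  also have "\<dots> = (LINT y|lborel. - ?g y)"
  proof (rule Bochner_Integration.integral_cong)
    fix y
    have "norm (- y + (y \<bullet> e) *\<^sub>R e) = norm (y - (y \<bullet> e) *\<^sub>R e)"
      by (metis minus_diff_eq norm_minus_cancel uminus_add_conv_diff)
    moreover have "Q ((y \<bullet> e) *\<^sub>R e - y) = - Q y"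
      using Qs(3)[of "y \<bullet> e" "- y"] \<open>odd b\<close> by simp
    ultimately show "?g (- y) = - ?g y" by (auto simp: indicator_def)
  qed simp
  finally show ?thesis unfolding hyper_int_def by simp
qed

definition antideriv :: "real poly \<Rightarrow> real poly" where
  "antideriv p = (\<Sum>i\<le>degree p. monom (coeff p i / real (Suc i)) (Suc i))"

lemma pderiv_antideriv: "pderiv (antideriv p) = p"
proof -
  have "pderiv (antideriv p) = (\<Sum>i\<le>degree p. monom (coeff p i) i)"
    by (simp add: antideriv_def pderiv_sum pderiv_monom del: of_nat_Suc)
  then show ?thesis by (simp add: poly_as_sum_of_monoms)
qed

lemma degree_antideriv: "degree (antideriv p) \<le> Suc (degree p)"
  unfolding antideriv_def by (intro degree_sum_le) (auto intro: le_trans[OF degree_monom_le])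

lemma integral_poly_interval:
  assumes "a \<le> b"
  shows "(LINT s|lborel. indicator {a..b} s * poly p s) = poly (antideriv p) b - poly (antideriv p) a"
proof -
  have "(LINT s|lborel. indicator {a..b} s *\<^sub>R poly p s) = poly (antideriv p) b - poly (antideriv p) a"
    using assms
  proof (rule integral_FTC_Icc)
    fix x
    have "(poly (antideriv p) has_real_derivative poly p x) (at x within {a..b})"
      using poly_DERIV[of "antideriv p" x] by (simp add: pderiv_antideriv has_field_derivative_at_within)
    then show "(poly (antideriv p) has_vector_derivative poly p x) (at x within {a..b})"
      by (simp add: has_real_derivative_iff_has_vector_derivative)
  qed (intro continuous_intros)
  then show ?thesis by simp
qed

text \<open>In odd dimension \<open>b + DIM('a) - 1\<close> is even whenever \<open>b\<close> is, so the slices of the ball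
  contribute an integral power of \<open>R\<^sup>2 - s\<^sup>2\<close>; for odd \<open>b\<close> they contribute nothing.\<close>

definition half_ball_poly :: "nat \<Rightarrow> nat \<Rightarrow> real \<Rightarrow> real poly" where
  "half_ball_poly a m R = antideriv (monom 1 a * [:R\<^sup>2, 0, -1:] ^ m)"

lemma degree_half_ball_poly: "degree (half_ball_poly a m R) \<le> a + 2 * m + 1"
proof -
  have "degree (monom 1 a * [:R\<^sup>2, 0, -1:] ^ m) \<le> a + 2 * m"
    using degree_power_le[of "[:R\<^sup>2, 0, -1:]" m] degree_monom_le[of "1::real" a]
    by (intro order_trans[OF degree_mult_le] add_mono) auto
  then show ?thesis unfolding half_ball_poly_def using degree_antideriv[of "monom 1 a * [:R\<^sup>2, 0, -1:] ^ m"] by linarith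
qed

lemma less_iff_power2_less: "0 \<le> a \<Longrightarrow> 0 \<le> b \<Longrightarrow> a < b \<longleftrightarrow> a\<^sup>2 < (b::real)\<^sup>2"
  by (meson not_le power2_le_imp_le power_mono)

text \<open>The slice of the ball at height s is a disc of radius sqrt (R^2 - s^2), so
  \<open>hyper_int_scale\<close> produces the power b + n - 1 of this root, a polynomial in s when
  the exponent is even. When it is odd, so is b, and \<open>?c\<close> is 0; the rounding in
  \<open>div 2\<close> then does no harm.\<close>

lemma half_ball_integral:
  fixes e :: "'a::euclidean_space"
  assumes e: "norm e = 1" and Q: "cyl_homogeneous e b Q" and R: "R > 0"
    and odd: "odd DIM('a)" and \<tau>: "\<bar>\<tau>\<bar> \<le> R"
  shows "(LINT y|lborel. indicator {y\<in>ball 0 R. y \<bullet> e \<le> \<tau>} y * ((y \<bullet> e) ^ a * Q y)) =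
    hyper_int e (\<lambda>y. indicator (ball 0 1) y * Q y) *
      (poly (half_ball_poly a ((b + DIM('a) - 1) div 2) R) \<tau>
       - poly (half_ball_poly a ((b + DIM('a) - 1) div 2) R) (- R))" (is "_ = ?c * (poly ?h \<tau> - _)")
proof -
  have [measurable]: "Q \<in> borel_measurable borel" by (rule cyl_homogeneousD(6)[OF Q])
  note Qs[simp] = cyl_homogeneousD(2-5)[OF Q]
  let ?S = "{y\<in>ball 0 R. y \<bullet> e \<le> \<tau>}" and ?m = "(b + DIM('a) - 1) div 2"
  have ee: "e \<bullet> e = 1" using e by (simp add: dot_square_norm)
  have "?S = ball 0 R \<inter> {y. y \<bullet> e \<le> \<tau>}" by auto
  then have [measurable]: "?S \<in> sets borel" by simp
  have [measurable]: "poly p \<in> borel_measurable borel" for p :: "real poly"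
    by (intro borel_measurable_continuous_onI continuous_intros)
  define f where "f y = indicator ?S y * ((y \<bullet> e) ^ a * Q y)" for y
  have [measurable]: "f \<in> borel_measurable borel" unfolding f_def by measurable
  have "continuous_on UNIV (\<lambda>y. (y \<bullet> e) ^ a * Q y)"
    by (intro continuous_intros cyl_homogeneousD(1)[OF Q])
  then obtain B where B: "\<And>y. y \<in> cball 0 R \<Longrightarrow> \<bar>(y \<bullet> e) ^ a * Q y\<bar> \<le> B"
    using continuous_bound_cball by blast
  have "B \<ge> 0" using B[of 0] R by auto
  have "integrable lborel f"
    by (rule bounded_measurable_integrable[of _ R B]) (use B \<open>B \<ge> 0\<close> in \<open>auto simp: f_def indicator_def\<close>)
  then have "(LINT y|lborel. f y) = (LINT s|lborel. hyper_int e (\<lambda>y. f (y + s *\<^sub>R e)))"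
    by (rule integral_slices) (rule e)
  also have "\<dots> = (LINT s|lborel. ?c * (indicator {-R..\<tau>} s * poly (monom 1 a * [:R\<^sup>2, 0, -1:] ^ ?m) s))"
  proof (rule integral_cong_AE)
    show "(\<lambda>s. hyper_int e (\<lambda>y. f (y + s *\<^sub>R e))) \<in> borel_measurable lborel"
      unfolding hyper_int_def by measurable
    \<comment> \<open>At these two heights the slice of the open ball is empty, while the polynomial
      with exponent 0 need not vanish.\<close>
    have "AE s in lborel. s \<noteq> R" "AE s in lborel. s \<noteq> - R"
      by (rule AE_lborel_singleton)+
    then show "AE s in lborel. hyper_int e (\<lambda>y. f (y + s *\<^sub>R e)) =
        ?c * (indicator {-R..\<tau>} s * poly (monom 1 a * [:R\<^sup>2, 0, -1:] ^ ?m) s)"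
    proof eventually_elim
      case (elim s)
      have n2: "(norm (y - (y \<bullet> e) *\<^sub>R e + s *\<^sub>R e))\<^sup>2 = (norm (y - (y \<bullet> e) *\<^sub>R e))\<^sup>2 + s\<^sup>2" for y
        unfolding power2_norm_eq_inner
        by (simp add: inner_add_left inner_add_right inner_diff_left inner_diff_right ee
            inner_commute algebra_simps power2_eq_square)
      have fy: "f (y - (y \<bullet> e) *\<^sub>R e + s *\<^sub>R e) =
          (if s \<le> \<tau> \<and> (norm (y - (y \<bullet> e) *\<^sub>R e))\<^sup>2 + s\<^sup>2 < R\<^sup>2 then s ^ a * Q (y - (y \<bullet> e) *\<^sub>R e) else 0)" for y
      proof -
        have "(y - (y \<bullet> e) *\<^sub>R e + s *\<^sub>R e) \<bullet> e = s"
          by (simp add: inner_add_left inner_diff_left ee)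
        moreover have "norm (y - (y \<bullet> e) *\<^sub>R e + s *\<^sub>R e) < R \<longleftrightarrow>
            (norm (y - (y \<bullet> e) *\<^sub>R e + s *\<^sub>R e))\<^sup>2 < R\<^sup>2"
          using R by (intro less_iff_power2_less) auto
        ultimately show ?thesis unfolding f_def by (auto simp: indicator_def n2)
      qed
      show ?case
      proof (cases "\<bar>s\<bar> < R")
        case True
        define k where "k = sqrt (R\<^sup>2 - s\<^sup>2)"
        have "s\<^sup>2 < R\<^sup>2" using True R less_iff_power2_less[of "\<bar>s\<bar>" R] by simp
        then have k: "k > 0" "k\<^sup>2 = R\<^sup>2 - s\<^sup>2" by (auto simp: k_def)
        have "(norm z)\<^sup>2 + s\<^sup>2 < R\<^sup>2 \<longleftrightarrow> z \<in> ball 0 k" for z :: 'a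
        proof -
          have "(norm z)\<^sup>2 + s\<^sup>2 < R\<^sup>2 \<longleftrightarrow> (norm z)\<^sup>2 < k\<^sup>2" using k by auto
          also have "\<dots> \<longleftrightarrow> norm z < k" using k less_iff_power2_less[of "norm z" k] by simp
          finally show ?thesis by simp
        qed
        then have "hyper_int e (\<lambda>y. f (y + s *\<^sub>R e)) =
            (if s \<le> \<tau> then s ^ a else 0) * hyper_int e (\<lambda>y. indicator (ball 0 k) y * Q y)"
          unfolding hyper_int_def fy
          by (subst integral_mult_right_zero[symmetric], intro Bochner_Integration.integral_cong)
            (simp_all add: indicator_def)
        also have "\<dots> = (if s \<le> \<tau> then s ^ a else 0) * (k ^ (b + DIM('a) - 1) * ?c)"
          by (simp add: hyper_int_scale[OF e Q k(1)])
        also have "\<dots> = ?c * (indicator {-R..\<tau>} s * poly (monom 1 a * [:R\<^sup>2, 0, -1:] ^ ?m) s)"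
        proof (cases "even b")
          case True
          then have "b + DIM('a) - 1 = 2 * ?m" using odd by auto
          then have "k ^ (b + DIM('a) - 1) = (R\<^sup>2 - s\<^sup>2) ^ ?m" by (metis k(2) power_mult)
          moreover have "- R \<le> s" using \<open>\<bar>s\<bar> < R\<close> by linarith
          ultimately show ?thesis
            by (simp add: indicator_def poly_monom power2_eq_square)
        qed (simp add: hyper_int_odd[OF e Q])
        finally show ?thesis .
      next
        case False
        then have "\<bar>s\<bar> > R" using elim by linarith
        then have "s\<^sup>2 > R\<^sup>2" using R less_iff_power2_less[of R "\<bar>s\<bar>"] by simp
        then have "\<not> (norm z)\<^sup>2 + s\<^sup>2 < R\<^sup>2" for z :: 'a using zero_le_power2[of "norm z"] by linarith
        moreover have "s \<notin> {-R..\<tau>}" using \<open>\<bar>s\<bar> > R\<close> \<tau> by auto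
        ultimately show ?thesis unfolding hyper_int_def fy by simp
      qed
    qed
  qed measurable
  also have "\<dots> = ?c * (poly ?h \<tau> - poly ?h (- R))"
    using integral_poly_interval[of "- R" \<tau>] \<tau>
    by (simp add: half_ball_poly_def del: poly_mult poly_power poly_pCons)
  finally show ?thesis unfolding f_def .
qed

text \<open>Polynomials expanded along the axis e, with d as a bound for the total degree. The
  inductive form lets integrals be treated summand by summand.\<close>

inductive cyl_span :: "'a::euclidean_space \<Rightarrow> nat \<Rightarrow> ('a \<Rightarrow> real) \<Rightarrow> bool" for e d where
  base: "cyl_homogeneous e b Q \<Longrightarrow> a + b \<le> d \<Longrightarrow> cyl_span e d (\<lambda>y. (y \<bullet> e) ^ a * Q y)"
| add: "cyl_span e d f \<Longrightarrow> cyl_span e d g \<Longrightarrow> cyl_span e d (\<lambda>y. f y + g y)"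

lemma cyl_span_mono: "cyl_span e d f \<Longrightarrow> d \<le> d' \<Longrightarrow> cyl_span e d' f"
  by (induction rule: cyl_span.induct) (auto intro: cyl_span.intros)

lemma cyl_span_continuous: "cyl_span e d f \<Longrightarrow> continuous_on UNIV f"
proof (induction rule: cyl_span.induct)
  case (base b Q a)
  show ?case by (intro continuous_intros cyl_homogeneousD(1)[OF base(1)])
qed (intro continuous_intros)

lemma cyl_homogeneous_mult:
  "cyl_homogeneous e b Q \<Longrightarrow> cyl_homogeneous e b' Q' \<Longrightarrow> cyl_homogeneous e (b + b') (\<lambda>y. Q y * Q' y)"
  unfolding cyl_homogeneous_def by (auto intro!: continuous_intros simp: power_add)

lemma cyl_span_mult_base:
  assumes "cyl_span e d f" "cyl_homogeneous e b Q" "a + b \<le> d'"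
  shows "cyl_span e (d + d') (\<lambda>y. f y * ((y \<bullet> e) ^ a * Q y))"
  using assms(1)
proof (induction rule: cyl_span.induct)
  case (base b1 Q1 a1)
  have "cyl_span e (d + d') (\<lambda>y. (y \<bullet> e) ^ (a1 + a) * (Q1 y * Q y))"
    using base assms by (intro cyl_span.base[of _ "b1 + b"] cyl_homogeneous_mult) auto
  then show ?case by (simp add: power_add mult.assoc mult.left_commute)
next
  case (add f g)
  then show ?case by (simp add: distrib_right cyl_span.add)
qed

lemma cyl_span_mult:
  assumes f: "cyl_span e d f" and g: "cyl_span e d' g"
  shows "cyl_span e (d + d') (\<lambda>y. f y * g y)"
  using g
proof (induction rule: cyl_span.induct)
  case (base b Q a)
  then show ?case by (rule cyl_span_mult_base[OF f])
next
  case (add g1 g2)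
  then show ?case by (simp add: distrib_left cyl_span.add)
qed

text \<open>A linear form f splits into f e times \<open>y \<bullet> e\<close> and its value on the
  component of y orthogonal to e; closure under sums and products does the rest. The bound d is
  chosen before e, hence uniform in the direction.\<close>

lemma real_polynomial_function_cyl_span:
  fixes P :: "'a::euclidean_space \<Rightarrow> real"
  assumes "real_polynomial_function P"
  shows "\<exists>d. \<forall>e. norm e = 1 \<longrightarrow> cyl_span e d P"
  using assms
proof (induction rule: real_polynomial_function.induct)
  case (linear f)
  interpret f: bounded_linear f by fact
  have "cyl_span e 1 f" if e: "norm e = 1" for e
  proof -
    have ee: "e \<bullet> e = 1" using e by (simp add: dot_square_norm)
    have cont: "continuous_on UNIV (\<lambda>y. f (y - (y \<bullet> e) *\<^sub>R e))"
      by (intro f.continuous_on continuous_intros)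
    have 1: "cyl_homogeneous e 0 (\<lambda>y. f e)"
      by (auto simp: cyl_homogeneous_def)
    have "f (y + s *\<^sub>R e - ((y + s *\<^sub>R e) \<bullet> e) *\<^sub>R e) = f (y - (y \<bullet> e) *\<^sub>R e)" for y s
      by (simp add: algebra_simps ee inner_add_left)
    moreover have "f (c *\<^sub>R y - (c * (y \<bullet> e)) *\<^sub>R e) = c * f (y - (y \<bullet> e) *\<^sub>R e)" for y c
      using f.scaleR[of c "y - (y \<bullet> e) *\<^sub>R e"] by (simp add: scaleR_right_diff_distrib)
    ultimately have 2: "cyl_homogeneous e 1 (\<lambda>y. f (y - (y \<bullet> e) *\<^sub>R e))"
      using cont by (auto simp: cyl_homogeneous_def)
    have "cyl_span e 1 (\<lambda>y. (y \<bullet> e) ^ 1 * f e + (y \<bullet> e) ^ 0 * f (y - (y \<bullet> e) *\<^sub>R e))"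
      by (intro cyl_span.add cyl_span.base[OF 1] cyl_span.base[OF 2]) auto
    moreover have "(y \<bullet> e) ^ 1 * f e + (y \<bullet> e) ^ 0 * f (y - (y \<bullet> e) *\<^sub>R e) = f y" for y
      by (simp add: f.diff f.scaleR)
    ultimately show ?thesis by simp
  qed
  then show ?case by blast
next
  case (const c)
  have "cyl_homogeneous e 0 (\<lambda>y. c)" for e :: 'a by (auto simp: cyl_homogeneous_def)
  from cyl_span.base[OF this, of 0 0] show ?case by auto
next
  case (add f g)
  then obtain d1 d2 where "\<forall>e. norm e = 1 \<longrightarrow> cyl_span e d1 f" "\<forall>e. norm e = 1 \<longrightarrow> cyl_span e d2 g"
    by blast
  then have "\<forall>e. norm e = 1 \<longrightarrow> cyl_span e (max d1 d2) (\<lambda>x. f x + g x)"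
    by (auto intro!: cyl_span.add intro: cyl_span_mono)
  then show ?case by blast
next
  case (mult f g)
  then obtain d1 d2 where "\<forall>e. norm e = 1 \<longrightarrow> cyl_span e d1 f" "\<forall>e. norm e = 1 \<longrightarrow> cyl_span e d2 g"
    by blast
  then have "\<forall>e. norm e = 1 \<longrightarrow> cyl_span e (d1 + d2) (\<lambda>x. f x * g x)"
    by (simp add: cyl_span_mult)
  then show ?case by blast
qed

lemma integrable_indicator_mult_continuous:
  fixes f :: "'a::euclidean_space \<Rightarrow> real"
  assumes f: "continuous_on UNIV f" and S: "S \<in> sets borel" "S \<subseteq> cball 0 r"
  shows "integrable lborel (\<lambda>y. indicator S y * f y)"
proof -
  obtain B where B: "\<And>y. y \<in> cball 0 r \<Longrightarrow> \<bar>f y\<bar> \<le> B"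
    using continuous_bound_cball[OF f] by blast
  have "f \<in> borel_measurable borel" using f by (rule borel_measurable_continuous_onI)
  with S(1) have "(\<lambda>y. indicator S y * f y) \<in> borel_measurable borel" by measurable
  then show ?thesis
    by (rule bounded_measurable_integrable[of _ r "max B 0"])
      (use B S(2) in \<open>fastforce simp: indicator_def\<close>)+
qed

lemma half_ball_measurable:
  fixes e :: "'a::euclidean_space"
  shows "{y\<in>ball 0 R. y \<bullet> e \<le> \<tau>} \<in> sets borel"
proof -
  have "{y\<in>ball 0 R. y \<bullet> e \<le> \<tau>} = ball 0 R \<inter> {y. y \<bullet> e \<le> \<tau>}" by auto
  then show ?thesis by simp
qed

lemma half_ball_integral_poly:
  fixes e :: "'a::euclidean_space"
  assumes P: "cyl_span e d P" and e: "norm e = 1" and R: "R > 0" and odd: "odd DIM('a)"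
  shows "\<exists>q. degree q \<le> d + DIM('a) \<and>
    (\<forall>\<tau>. \<bar>\<tau>\<bar> \<le> R \<longrightarrow> (LINT y|lborel. indicator {y\<in>ball 0 R. y \<bullet> e \<le> \<tau>} y * P y) = poly q \<tau>)"
  using P
proof (induction rule: cyl_span.induct)
  case (base b Q a)
  let ?c = "hyper_int e (\<lambda>y. indicator (ball 0 1) y * Q y)"
  let ?h = "half_ball_poly a ((b + DIM('a) - 1) div 2) R"
  let ?q = "Polynomial.smult ?c (?h - [:poly ?h (- R):])"
  have "DIM('a) \<ge> 1" using DIM_positive[where 'a='a] by linarith
  then have "a + 2 * ((b + DIM('a) - 1) div 2) + 1 \<le> d + DIM('a)" using base by linarith
  then have "degree ?q \<le> d + DIM('a)"
    using degree_half_ball_poly[of a "(b + DIM('a) - 1) div 2" R]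
    by (intro le_trans[OF degree_smult_le] degree_diff_le) auto
  then show ?case
    using half_ball_integral[OF e base(1) R odd, where a = a]
    by (intro exI[of _ ?q]) simp
next
  case (add f g)
  let ?I = "\<lambda>h \<tau>. LINT y|lborel. indicator {y\<in>ball 0 R. y \<bullet> e \<le> \<tau>} y * h y"
  from add.IH obtain p q where pq: "degree p \<le> d + DIM('a)" "degree q \<le> d + DIM('a)"
    and p: "\<forall>\<tau>. \<bar>\<tau>\<bar> \<le> R \<longrightarrow> ?I f \<tau> = poly p \<tau>" and q: "\<forall>\<tau>. \<bar>\<tau>\<bar> \<le> R \<longrightarrow> ?I g \<tau> = poly q \<tau>"
    by (elim exE conjE)
  have int: "integrable lborel (\<lambda>y. indicator {y\<in>ball 0 R. y \<bullet> e \<le> \<tau>} y * h y)"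
    if "cyl_span e d h" for h \<tau>
    by (rule integrable_indicator_mult_continuous[OF cyl_span_continuous[OF that] half_ball_measurable, where r = R])
      auto
  have "?I (\<lambda>y. f y + g y) \<tau> = poly (p + q) \<tau>" if "\<bar>\<tau>\<bar> \<le> R" for \<tau>
    using Bochner_Integration.integral_add[OF int[OF add(1)] int[OF add(2)], of \<tau> \<tau>] p q that
    by (simp add: distrib_left)
  moreover have "degree (p + q) \<le> d + DIM('a)" using pq by (rule degree_add_le)
  ultimately show ?case by (intro exI[of _ "p + q"]) simp
qed

text \<open>A single q serves all directions: the factor \<open>hyper_int e\<close> of the half ball
  formula is expressed by the volume v of the whole ball, which is the case \<tau> = R and does not
  depend on e.\<close>

lemma ball_section_poly:
  fixes R :: real
  assumes odd: "odd DIM('a::euclidean_space)" and R: "R > 0"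
  shows "\<exists>q. degree q \<le> DIM('a) \<and> (\<forall>e::'a::euclidean_space. \<forall>\<tau>. norm e = 1 \<longrightarrow> \<bar>\<tau>\<bar> \<le> R \<longrightarrow>
    measure lborel {y\<in>ball 0 R. y \<bullet> e \<le> \<tau>} = poly q \<tau>)"
proof -
  define m where "m = (DIM('a) - 1) div 2"
  define h where "h = half_ball_poly 0 m R"
  have one: "cyl_homogeneous e 0 (\<lambda>y::'a. 1)" for e by (auto simp: cyl_homogeneous_def)
  have fin: "emeasure lborel {y\<in>ball 0 R. y \<bullet> e \<le> \<tau>} \<noteq> \<infinity>" for e :: 'a and \<tau>
    by (rule emeasure_bounded_finite[THEN less_imp_neq]) (rule bounded_subset[OF bounded_ball[of 0 R]], auto)
  have I: "measure lborel {y\<in>ball 0 R. y \<bullet> e \<le> \<tau>} =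
      hyper_int e (indicator (ball 0 1)) * (poly h \<tau> - poly h (- R))"
    if "norm e = 1" "\<bar>\<tau>\<bar> \<le> R" for e :: 'a and \<tau>
    using half_ball_integral[OF that(1) one R odd that(2), of 0] half_ball_measurable[of R e \<tau>]
    by (simp add: m_def h_def)
  define v where "v = measure lborel (ball (0::'a) R)"
  have "v > 0" unfolding v_def using R by (simp add: content_ball_pos)
  have full: "v = hyper_int e (indicator (ball 0 1)) * (poly h R - poly h (- R))" if "norm e = 1" for e :: 'a
  proof -
    have "y \<bullet> e \<le> R" if "y \<in> ball 0 R" for y
      using Cauchy_Schwarz_ineq2[of y e] that \<open>norm e = 1\<close> by auto
    then have "{y\<in>ball 0 R. y \<bullet> e \<le> R} = ball 0 R" by auto
    then show ?thesis using I[OF that, of R] R by (simp add: v_def)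
  qed
  let ?q = "Polynomial.smult (v / (poly h R - poly h (- R))) (h - [:poly h (- R):])"
  have "1 \<le> DIM('a)" using DIM_positive[where 'a='a] by linarith
  then have "2 * m + 1 \<le> DIM('a)" unfolding m_def by linarith
  then have "degree ?q \<le> DIM('a)"
    using degree_half_ball_poly[of 0 m R] unfolding h_def
    by (intro le_trans[OF degree_smult_le] degree_diff_le) auto
  moreover have "measure lborel {y\<in>ball 0 R. y \<bullet> e \<le> \<tau>} = poly ?q \<tau>"
    if "norm e = 1" "\<bar>\<tau>\<bar> \<le> R" for e :: 'a and \<tau>
  proof -
    have "poly h R - poly h (- R) \<noteq> 0" using full[OF that(1)] \<open>v > 0\<close> by auto
    then have "hyper_int e (indicator (ball 0 1)) = v / (poly h R - poly h (- R))"
      using full[OF that(1)] by (simp add: field_simps)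
    then show ?thesis using I[OF that] by simp
  qed
  ultimately show ?thesis by blast
qed

lemma ball_section_poly':
  assumes odd: "odd DIM('a::euclidean_space)" and R: "R > 0"
  obtains q where "degree q \<le> DIM('a)"
    "\<And>(y::'a::euclidean_space) t. y \<noteq> 0 \<Longrightarrow> \<bar>t\<bar> \<le> R * norm y \<Longrightarrow>
      measure lborel {x\<in>ball 0 R. y \<bullet> x \<le> t} = poly q (t / norm y)"
proof -
  obtain q where q: "degree q \<le> DIM('a)" "\<And>e \<tau>. norm (e::'a) = 1 \<Longrightarrow> \<bar>\<tau>\<bar> \<le> R \<Longrightarrow>
    measure lborel {y\<in>ball 0 R. y \<bullet> e \<le> \<tau>} = poly q \<tau>"
    using ball_section_poly[OF assms] by blast
  have "measure lborel {x\<in>ball 0 R. y \<bullet> x \<le> t} = poly q (t / norm y)"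
    if "y \<noteq> 0" "\<bar>t\<bar> \<le> R * norm y" for y :: 'a and t
  proof -
    have "y \<bullet> x \<le> t \<longleftrightarrow> x \<bullet> (y /\<^sub>R norm y) \<le> t / norm y" for x
      using that by (simp add: field_simps inner_commute)
    then have "{x\<in>ball 0 R. y \<bullet> x \<le> t} = {x\<in>ball 0 R. x \<bullet> (y /\<^sub>R norm y) \<le> t / norm y}" by blast
    moreover have "\<bar>t / norm y\<bar> \<le> R" using that by (simp add: field_simps)
    ultimately show ?thesis using q(2)[of "y /\<^sub>R norm y" "t / norm y"] that by simp
  qed
  with q(1) show ?thesis using that by blast
qed

text \<open>A difference of two concentric balls, so half space sections are differences of half
  ball integrals; the point 0, which has no direction, is kept at a distance.\<close>

definition shell :: "'a::real_normed_vector set" where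
  "shell = ball 0 1 - ball 0 (1/2)"

text \<open>Here x is the normal of the cutting hyperplane and y the variable. The condition |t|
  \<le> |x|/2 places the height t/|x| within both radii 1 and 1/2, so both half ball formulas apply
  and can be subtracted.\<close>

lemma shell_integral_poly:
  fixes P :: "'a::euclidean_space \<Rightarrow> real"
  assumes odd: "odd DIM('a)" and P: "\<And>e::'a. norm e = 1 \<Longrightarrow> cyl_span e d P"
    and x: "x \<noteq> 0"
  shows "\<exists>q. degree q \<le> d + DIM('a) \<and> (\<forall>t. \<bar>t\<bar> \<le> norm x / 2 \<longrightarrow>
    (LINT y|lborel. indicator shell y * (indicator {y. y \<bullet> x \<le> t} y * P y)) = poly q t)"
proof -
  define e where "e = x /\<^sub>R norm x"
  have e: "norm e = 1" using x by (simp add: e_def)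
  let ?I = "\<lambda>R \<tau>. LINT y|lborel. indicator {y\<in>ball 0 R. y \<bullet> e \<le> \<tau>} y * P y"
  obtain q1 where q1: "degree q1 \<le> d + DIM('a)" "\<And>\<tau>. \<bar>\<tau>\<bar> \<le> 1 \<Longrightarrow> ?I 1 \<tau> = poly q1 \<tau>"
    using half_ball_integral_poly[OF P[OF e] e _ odd, of 1] by auto
  obtain q2 where q2: "degree q2 \<le> d + DIM('a)" "\<And>\<tau>. \<bar>\<tau>\<bar> \<le> 1/2 \<Longrightarrow> ?I (1/2) \<tau> = poly q2 \<tau>"
    using half_ball_integral_poly[OF P[OF e] e _ odd, of "1/2"] by auto
  let ?q = "pcompose (q1 - q2) [:0, 1 / norm x:]"
  have "degree ?q \<le> d + DIM('a)"
    using degree_pcompose_le[of "q1 - q2" "[:0, 1 / norm x:]"] degree_diff_le[OF q1(1) q2(1)] x by simp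
  moreover have "(LINT y|lborel. indicator shell y * (indicator {y. y \<bullet> x \<le> t} y * P y)) = poly ?q t"
    if t: "\<bar>t\<bar> \<le> norm x / 2" for t
  proof -
    let ?\<tau> = "t / norm x"
    have int: "integrable lborel (\<lambda>y. indicator {y\<in>ball 0 R. y \<bullet> e \<le> ?\<tau>} y * P y)" for R
      by (rule integrable_indicator_mult_continuous[OF cyl_span_continuous[OF P[OF e]] half_ball_measurable, where r = R])
        auto
    have yx: "y \<bullet> x \<le> t \<longleftrightarrow> y \<bullet> e \<le> ?\<tau>" for y
      using x by (simp add: e_def field_simps)
    have "ball 0 (1/2) \<subseteq> ball (0::'a) 1" by auto
    then have "(LINT y|lborel. indicator shell y * (indicator {y. y \<bullet> x \<le> t} y * P y)) =
        (LINT y|lborel. indicator {y\<in>ball 0 1. y \<bullet> e \<le> ?\<tau>} y * P y - indicator {y\<in>ball 0 (1/2). y \<bullet> e \<le> ?\<tau>} y * P y)"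
      by (intro Bochner_Integration.integral_cong) (auto simp: shell_def indicator_def yx)
    also have "\<dots> = ?I 1 ?\<tau> - ?I (1/2) ?\<tau>" by (rule Bochner_Integration.integral_diff[OF int int])
    also have "\<dots> = poly ?q t"
    proof -
      have *: "\<bar>?\<tau>\<bar> \<le> 1/2" using t x by (simp add: field_simps)
      then have **: "\<bar>?\<tau>\<bar> \<le> 1" by linarith
      show ?thesis using q1(2)[OF **] q2(2)[OF *] by (simp add: poly_pcompose)
    qed
    finally show ?thesis .
  qed
  ultimately show ?thesis by blast
qed

section \<open>Volumes of half space sections and their averages over the shell\<close>

definition cut_vol :: "'a::euclidean_space set \<Rightarrow> 'a \<Rightarrow> real \<Rightarrow> real" where
  "cut_vol A y t = measure lborel {x\<in>A. y \<bullet> x \<le> t}"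

text \<open>Both sides integrate P(y) times the indicator of y \<bullet> x \<le> t over the product
  of the shell and A. The unknown sections of A are thereby traded for sections of the shell, which
  are computable.\<close>

lemma shell_cut_vol_Fubini:
  fixes P :: "'a::euclidean_space \<Rightarrow> real"
  assumes P: "continuous_on UNIV P" and A[measurable]: "A \<in> sets borel" and bA: "bounded A"
  defines "K \<equiv> \<lambda>x t. LINT y|lborel. indicator shell y * (indicator {y. y \<bullet> x \<le> t} y * P y)"
  shows "integrable lborel (\<lambda>y. indicator shell y * (P y * cut_vol A y t))"
    and "integrable lborel (\<lambda>x. indicator A x * K x t)"
    and "(LINT y|lborel. indicator shell y * (P y * cut_vol A y t)) = (LINT x|lborel. indicator A x * K x t)"
proof -
  have [measurable]: "P \<in> borel_measurable borel" using P by (rule borel_measurable_continuous_onI)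
  have [measurable]: "shell \<in> sets (borel :: 'a measure)" by (simp add: shell_def)
  define F where "F = (\<lambda>(y::'a, x::'a). indicator shell y * P y * (indicator A x * (if y \<bullet> x \<le> t then 1 else 0)) :: real)"
  have F[measurable]: "F \<in> borel_measurable (borel \<Otimes>\<^sub>M borel)" unfolding F_def by measurable
  obtain r where r: "A \<subseteq> cball 0 r" using bounded_subset_ballD[OF bA, of 0] by (meson ball_subset_cball order_trans)
  obtain B where B: "\<And>y. y \<in> cball 0 1 \<Longrightarrow> \<bar>P y\<bar> \<le> B" using continuous_bound_cball[OF P] by blast
  have "B \<ge> 0" using B[of 0] by auto
  have "integrable lborel F"
  proof (rule bounded_measurable_integrable[of _ "1 + \<bar>r\<bar>" B])
    show "F \<in> borel_measurable borel" using F by (simp add: borel_prod)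
    show "F z = 0" if "z \<notin> cball 0 (1 + \<bar>r\<bar>)" for z
    proof (rule ccontr)
      assume "F z \<noteq> 0"
      then have "norm (fst z) \<le> 1" "norm (snd z) \<le> \<bar>r\<bar>"
        using r by (auto simp: F_def case_prod_beta shell_def indicator_def split: if_splits)
      then have "norm z \<le> 1 + \<bar>r\<bar>" using norm_Pair_le[of "fst z" "snd z"] by simp
      then show False using that by simp
    qed
    show "\<bar>F z\<bar> \<le> B" for z
      using B[of "fst z"] \<open>B \<ge> 0\<close> by (auto simp: F_def case_prod_beta shell_def indicator_def)
  qed
  then have int: "integrable (lborel \<Otimes>\<^sub>M lborel) (\<lambda>(y, x). F (y, x))" by (simp add: lborel_prod)
  have inner1: "(LINT x|lborel. F (y, x)) = indicator shell y * (P y * cut_vol A y t)" for y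
  proof -
    have "{x \<in> A. y \<bullet> x \<le> t} = A \<inter> {x. y \<bullet> x \<le> t}" by auto
    then have m: "{x \<in> A. y \<bullet> x \<le> t} \<in> sets borel" by simp
    have "(LINT x|lborel. F (y, x)) = (LINT x|lborel. indicator shell y * P y * indicator {x\<in>A. y \<bullet> x \<le> t} x)"
      by (intro Bochner_Integration.integral_cong) (auto simp: F_def indicator_def)
    also have "\<dots> = indicator shell y * P y * cut_vol A y t"
      using m by (simp add: cut_vol_def)
    finally show ?thesis by simp
  qed
  have inner2: "(LINT y|lborel. F (y, x)) = indicator A x * K x t" for x
  proof -
    have "(LINT y|lborel. F (y, x)) = (LINT y|lborel. indicator A x * (indicator shell y * (indicator {y. y \<bullet> x \<le> t} y * P y)))"
      by (intro Bochner_Integration.integral_cong) (auto simp: F_def indicator_def)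
    then show ?thesis by (simp add: K_def)
  qed
  show "integrable lborel (\<lambda>y. indicator shell y * (P y * cut_vol A y t))"
    using lborel_pair.integrable_fst[OF int] by (simp add: inner1)
  show "integrable lborel (\<lambda>x. indicator A x * K x t)"
    using lborel_pair.integrable_snd[OF int] by (simp add: inner2)
  show "(LINT y|lborel. indicator shell y * (P y * cut_vol A y t)) = (LINT x|lborel. indicator A x * K x t)"
    using lborel_pair.integral_fst[OF int] lborel_pair.integral_snd[OF int] by (simp add: inner1 inner2)
qed

lemma cut_vol_split:
  fixes A B :: "'a::euclidean_space set"
  assumes "A \<in> sets borel" "B \<in> sets borel" "bounded A" "bounded B" "A \<inter> B = {}"
  shows "cut_vol (A \<union> B) y t = cut_vol A y t + cut_vol B y t"
proof -
  have m: "{x \<in> C. y \<bullet> x \<le> t} \<in> sets borel" if "C \<in> sets borel" for C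
  proof -
    have "{x \<in> C. y \<bullet> x \<le> t} = C \<inter> {x. y \<bullet> x \<le> t}" by auto
    then show ?thesis using that by simp
  qed
  have f: "emeasure lborel {x \<in> C. y \<bullet> x \<le> t} \<noteq> \<infinity>" if "bounded C" for C
    by (rule emeasure_bounded_finite[THEN less_imp_neq]) (rule bounded_subset[OF that], auto)
  have "{x \<in> A \<union> B. y \<bullet> x \<le> t} = {x \<in> A. y \<bullet> x \<le> t} \<union> {x \<in> B. y \<bullet> x \<le> t}" by auto
  then show ?thesis unfolding cut_vol_def
    using measure_Union[of lborel "{x \<in> A. y \<bullet> x \<le> t}" "{x \<in> B. y \<bullet> x \<le> t}"] assms m f by auto
qed

text \<open>Near \<open>t = 0\<close> the shell averages of the cut-off volumes are polynomials in \<open>t\<close>: the ball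
  around \<open>0\<close> contributes a polynomial, and so does every point outside of it, since it sees
  the half space \<open>{y. y \<bullet> x \<le> t}\<close> cut both spheres bounding the shell. Interpolation makes the
  polynomial dependence survive the integration over \<open>x\<close>.\<close>

lemma shell_moment_poly:
  fixes P :: "'a::euclidean_space \<Rightarrow> real"
  assumes odd: "odd DIM('a)" and P: "real_polynomial_function P"
    and D: "D \<in> sets borel" "bounded D" and r: "r > 0" "ball 0 r \<subseteq> D"
  obtains q :: "real poly" where "\<And>t. \<bar>t\<bar> < r / 2 \<Longrightarrow>
    (LINT y|lborel. indicator shell y * (P y * cut_vol D y t)) = poly q t"
proof -
  obtain d where d: "\<And>e::'a. norm e = 1 \<Longrightarrow> cyl_span e d P"
    using real_polynomial_function_cyl_span[OF P] by blast
  obtain e :: 'a where e: "norm e = 1" using vector_choose_size[of 1] by auto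
  have contP: "continuous_on UNIV P" by (rule cyl_span_continuous[OF d[OF e]])
  \<comment> \<open>The ball around 0 contributes degree at most n, every point outside of it degree
    at most d + n; N bounds both.\<close>
  define N where "N = d + DIM('a)"
  \<comment> \<open>N + 1 nodes in [0, r/2), inside the range in which both contributions are
    polynomials.\<close>
  define x where "x j = r / 2 * (real j / real (Suc N))" for j
  have inj: "inj_on x {..N}" using r by (auto simp: inj_on_def x_def)
  have x: "\<bar>x j\<bar> \<le> r / 2" if "j \<le> N" for j
  proof -
    have "r / 2 * (real j / real (Suc N)) \<le> r / 2 * 1"
      using that r by (intro mult_left_mono) auto
    then show ?thesis using r by (simp add: x_def abs_mult)
  qed
  let ?L = "\<lambda>j. poly (lagrange_basis x N j)"
  have interp: "f t = (\<Sum>j\<le>N. ?L j t * f (x j))"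
    if "degree q \<le> N" "\<And>t. \<bar>t\<bar> \<le> r / 2 \<Longrightarrow> f t = poly q t" "\<bar>t\<bar> \<le> r / 2" for f q t
    using lagrange_interpolation[OF inj that(1), of t] that x by simp
  let ?G = "\<lambda>A t. LINT y|lborel. indicator shell y * (P y * cut_vol A y t)"
  let ?A = "D - ball 0 r"
  have A: "?A \<in> sets borel" "bounded ?A" using D by auto
  have DA: "D = ball 0 r \<union> ?A" using r by auto
  note FB = shell_cut_vol_Fubini[OF contP _ bounded_ball, of 0 r]
  note FA = shell_cut_vol_Fubini[OF contP A]
  have "cut_vol D y t = cut_vol (ball 0 r) y t + cut_vol ?A y t" for y t
    using cut_vol_split[of "ball 0 r" ?A y t] A DA by auto
  then have GD: "?G D t = ?G (ball 0 r) t + ?G ?A t" for t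
    using Bochner_Integration.integral_add[OF FB(1) FA(1), of t t] by (simp add: algebra_simps)
  have GB: "?G (ball 0 r) t = (\<Sum>j\<le>N. ?L j t * ?G (ball 0 r) (x j))" if t: "\<bar>t\<bar> \<le> r / 2" for t
  proof -
    obtain q where q: "degree q \<le> DIM('a)" "\<And>(y::'a) t. y \<noteq> 0 \<Longrightarrow> \<bar>t\<bar> \<le> r * norm y \<Longrightarrow>
        measure lborel {x\<in>ball 0 r. y \<bullet> x \<le> t} = poly q (t / norm y)"
      using ball_section_poly'[OF odd r(1)] by blast
    have "cut_vol (ball 0 r) y t = (\<Sum>j\<le>N. ?L j t * cut_vol (ball 0 r) y (x j))"
      if y: "y \<in> shell" for y :: 'a
    proof (rule interp[OF _ _ t])
      have n: "norm y \<ge> 1/2" using y by (auto simp: shell_def)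
      show "degree (pcompose q [:0, 1 / norm y:]) \<le> N"
        using degree_pcompose_le[of q "[:0, 1 / norm y:]"] q(1) n by (simp add: N_def)
      show "cut_vol (ball 0 r) y t = poly (pcompose q [:0, 1 / norm y:]) t" if "\<bar>t\<bar> \<le> r / 2" for t
      proof -
        have "r / 2 \<le> r * norm y" using n r by (simp add: field_simps)
        then have "\<bar>t\<bar> \<le> r * norm y" using that by linarith
        moreover have "y \<noteq> 0" using n by auto
        ultimately show ?thesis using q(2)[of y t] by (simp add: cut_vol_def poly_pcompose)
      qed
    qed
    then have "indicator shell y * (P y * cut_vol (ball 0 r) y t) =
        (\<Sum>j\<le>N. ?L j t * (indicator shell y * (P y * cut_vol (ball 0 r) y (x j))))" for y
      by (cases "y \<in> shell") (simp_all add: sum_distrib_left mult_ac)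
    then have "?G (ball 0 r) t = (LINT y|lborel. (\<Sum>j\<le>N. ?L j t * (indicator shell y * (P y * cut_vol (ball 0 r) y (x j)))))"
      by presburger
    also have "\<dots> = (\<Sum>j\<le>N. ?L j t * ?G (ball 0 r) (x j))"
      using FB(1) by (subst Bochner_Integration.integral_sum) auto
    finally show ?thesis .
  qed
  have GA: "?G ?A t = (\<Sum>j\<le>N. ?L j t * ?G ?A (x j))" if t: "\<bar>t\<bar> \<le> r / 2" for t
  proof -
    let ?K = "\<lambda>x t. LINT y|lborel. indicator shell y * (indicator {y. y \<bullet> x \<le> t} y * P y)"
    have "?K z t = (\<Sum>j\<le>N. ?L j t * ?K z (x j))" if z: "z \<in> ?A" for z
    proof -
      have n: "norm z \<ge> r" "z \<noteq> 0" using z r by auto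
      obtain q where "degree q \<le> N" "\<And>t. \<bar>t\<bar> \<le> norm z / 2 \<Longrightarrow> ?K z t = poly q t"
        using shell_integral_poly[OF odd d n(2)] unfolding N_def by blast
      then show ?thesis using n t by (intro interp[of q]) auto
    qed
    then have "indicator ?A z * ?K z t = (\<Sum>j\<le>N. ?L j t * (indicator ?A z * ?K z (x j)))" for z
      by (cases "z \<in> ?A") simp_all
    then have "(LINT z|lborel. indicator ?A z * ?K z t) =
        (LINT z|lborel. (\<Sum>j\<le>N. ?L j t * (indicator ?A z * ?K z (x j))))" by presburger
    also have "\<dots> = (\<Sum>j\<le>N. ?L j t * (LINT z|lborel. indicator ?A z * ?K z (x j)))"
      using FA(2) by (subst Bochner_Integration.integral_sum) auto
    finally show ?thesis using FA(3) by simp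
  qed
  define q where "q = (\<Sum>j\<le>N. Polynomial.smult (?G D (x j)) (lagrange_basis x N j))"
  have "?G D t = poly q t" if "\<bar>t\<bar> < r / 2" for t
  proof -
    have "\<bar>t\<bar> \<le> r / 2" using that by simp
    then have "?G D t = (\<Sum>j\<le>N. ?L j t * ?G (ball 0 r) (x j)) + (\<Sum>j\<le>N. ?L j t * ?G ?A (x j))"
      using GD GB GA by presburger
    also have "\<dots> = (\<Sum>j\<le>N. ?L j t * ?G D (x j))"
      unfolding GD by (simp add: sum.distrib[symmetric] distrib_left)
    finally show ?thesis by (simp add: q_def poly_sum mult.commute)
  qed
  then show ?thesis using that by blast
qed

section \<open>Continuity of the section volume, and the weight on the shell\<close>

lemma hyperplane_AE:
  fixes y :: "'a::euclidean_space"
  assumes "y \<noteq> 0"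
  shows "AE x in lborel. y \<bullet> x \<noteq> t"
proof -
  have "negligible {x. y \<bullet> x = t}" using negligible_hyperplane[of y t] assms by blast
  then have "{x. y \<bullet> x = t} \<in> null_sets lebesgue" by (simp add: negligible_iff_null_sets)
  moreover have "{x. y \<bullet> x = t} \<in> sets lborel" by (simp add: closed_hyperplane)
  ultimately have "{x. y \<bullet> x = t} \<in> null_sets lborel"
    by (simp add: null_sets_completion_iff)
  then show ?thesis using AE_not_in by force
qed

lemma cut_vol_integral:
  assumes "D \<in> sets borel"
  shows "cut_vol D y t = (LINT x|lborel. indicator D x * (if y \<bullet> x \<le> t then 1 else 0))"
proof -
  have "{x\<in>D. y \<bullet> x \<le> t} = D \<inter> {x. y \<bullet> x \<le> t}" by auto
  then have "{x\<in>D. y \<bullet> x \<le> t} \<in> sets borel" using assms by simp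
  moreover have "indicator D x * (if y \<bullet> x \<le> t then 1 else 0) = (indicator {x\<in>D. y \<bullet> x \<le> t} x :: real)" for x
    by (auto simp: indicator_def)
  ultimately show ?thesis by (simp add: cut_vol_def)
qed

text \<open>Dominated convergence: off the null set \<open>fst a \<bullet> x = snd a\<close> the
  condition defining the section is stable under small changes of y and t. At y = 0 and t = 0 this
  set would be the whole space.\<close>

lemma cut_vol_continuous:
  fixes D :: "'a::euclidean_space set"
  assumes D[measurable]: "D \<in> sets borel" and b: "bounded D"
  shows "continuous_on ((- {0}) \<times> UNIV) (\<lambda>z. cut_vol D (fst z) (snd z))"
proof (subst continuous_on_sequentially, intro allI impI ballI)
  fix z :: "nat \<Rightarrow> 'a \<times> real" and a
  assume "a \<in> (- {0}) \<times> UNIV" "(\<forall>n. z n \<in> (- {0}) \<times> UNIV) \<and> z \<longlonglongrightarrow> a"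
  then have a: "fst a \<noteq> 0" and z: "z \<longlonglongrightarrow> a" by auto
  let ?f = "\<lambda>z x. indicator D x * (if fst z \<bullet> x \<le> snd z then 1 else 0) :: real"
  have "(\<lambda>n. LINT x|lborel. ?f (z n) x) \<longlonglongrightarrow> (LINT x|lborel. ?f a x)"
  proof (rule integral_dominated_convergence)
    have "emeasure lborel D < \<infinity>" using b by (rule emeasure_bounded_finite)
    then show "integrable lborel (indicator D :: 'a \<Rightarrow> real)" using D by simp
    show "AE x in lborel. (\<lambda>n. ?f (z n) x) \<longlonglongrightarrow> ?f a x"
      using hyperplane_AE[OF a, of "snd a"]
    proof eventually_elim
      case (elim x)
      have l: "(\<lambda>n. fst (z n) \<bullet> x - snd (z n)) \<longlonglongrightarrow> fst a \<bullet> x - snd a"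
        by (intro tendsto_intros z)
      have "eventually (\<lambda>n. (fst (z n) \<bullet> x \<le> snd (z n)) = (fst a \<bullet> x \<le> snd a)) sequentially"
      proof (cases "fst a \<bullet> x < snd a")
        case True
        with order_tendstoD(2)[OF l, of 0] show ?thesis by (auto elim!: eventually_mono)
      next
        case False
        with elim have "fst a \<bullet> x - snd a > 0" by auto
        from order_tendstoD(1)[OF l this] show ?thesis using \<open>fst a \<bullet> x - snd a > 0\<close>
          by (auto elim!: eventually_mono)
      qed
      then have "eventually (\<lambda>n. ?f (z n) x = ?f a x) sequentially"
        by (auto elim!: eventually_mono)
      then show ?case by (rule tendsto_eventually)
    qed
  qed (auto simp: indicator_def)
  then show "((\<lambda>z. cut_vol D (fst z) (snd z)) \<circ> z) \<longlonglongrightarrow> cut_vol D (fst a) (snd a)"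
    by (simp add: o_def cut_vol_integral D)
qed

text \<open>The factor \<open>(|y|\<^sup>2 - 1/4) (1 - |y|\<^sup>2)\<close> makes the indicator function of the shell continuous
  and is itself a polynomial.\<close>

definition shell_poly :: "'a::euclidean_space \<Rightarrow> real" where
  "shell_poly y = (y \<bullet> y - 1/4) * (1 - y \<bullet> y)"

definition shell_weight :: "'a::euclidean_space \<Rightarrow> real" where
  "shell_weight y = max 0 (shell_poly y)"

lemma real_polynomial_function_shell_poly: "real_polynomial_function (shell_poly :: 'a::euclidean_space \<Rightarrow> real)"
proof -
  have "real_polynomial_function (\<lambda>y::'a. y \<bullet> y)"
  proof -
    have "real_polynomial_function (\<lambda>y::'a. \<Sum>b\<in>Basis. (y \<bullet> b) * (y \<bullet> b))"
      by (intro real_polynomial_function_sum real_polynomial_function.intros(4)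
          real_polynomial_function.intros(1) bounded_linear_inner_left) auto
    then show ?thesis by (simp add: euclidean_inner[symmetric])
  qed
  then show ?thesis unfolding shell_poly_def
    by (intro real_polynomial_function.intros(4) real_polynomial_function_diff real_polynomial_function.intros(2))
qed

lemma shell_poly_norm: "shell_poly y = (norm y - 1/2) * (norm y + 1/2) * (1 - norm y) * (1 + norm y)"
  by (simp add: shell_poly_def dot_square_norm power2_eq_square algebra_simps add_divide_distrib diff_divide_distrib)

lemma shell_weight_eq: "indicator shell y * shell_poly y = shell_weight y"
proof -
  have "shell_poly y \<ge> 0" if "1/2 \<le> norm y" "norm y < 1"
    using that unfolding shell_poly_norm by (intro mult_nonneg_nonneg) auto
  moreover have "shell_poly y \<le> 0" if "norm y < 1/2"
    using that unfolding shell_poly_norm by (intro mult_nonpos_nonneg mult_nonneg_nonneg) auto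
  moreover have "shell_poly y \<le> 0" if "norm y \<ge> 1"
    using that unfolding shell_poly_norm by (intro mult_nonpos_nonneg mult_nonneg_nonpos mult_nonneg_nonneg) auto
  ultimately show ?thesis
    by (cases "y \<in> shell"; cases "norm y < 1") (auto simp: shell_weight_def shell_def max_def not_less)
qed

lemma shell_weight_pos: "1/2 < norm y \<Longrightarrow> norm y < 1 \<Longrightarrow> shell_weight y > 0"
  unfolding shell_weight_def shell_poly_norm by (simp add: less_max_iff_disj)

lemma shell_weight_zero: "norm y \<le> 1/2 \<or> 1 \<le> norm y \<Longrightarrow> shell_weight y = 0"
proof -
  assume "norm y \<le> 1/2 \<or> 1 \<le> norm y"
  then have "y \<notin> shell \<or> shell_poly y = 0"
    by (auto simp: shell_def shell_poly_norm)
  then show ?thesis using shell_weight_eq[of y] by auto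
qed

lemma shell_weight_nonneg: "shell_weight y \<ge> 0"
  by (simp add: shell_weight_def)

lemma continuous_on_shell_weight[continuous_intros]: "continuous_on S shell_weight"
  unfolding shell_weight_def shell_poly_def by (intro continuous_intros)

text \<open>A function of the direction of y need not have a limit at 0; since the weight vanishes
  on the ball of radius 1/2, the two open pieces agree on their overlap.\<close>

lemma continuous_on_weighted:
  fixes G :: "'b::metric_space \<times> 'a::euclidean_space \<Rightarrow> 'c::real_normed_vector"
  assumes "continuous_on (U \<times> (- {0})) G"
  shows "continuous_on (U \<times> UNIV) (\<lambda>z. shell_weight (snd z) *\<^sub>R G z)"
proof -
  let ?f = "\<lambda>z. shell_weight (snd z) *\<^sub>R G z"
  have "continuous_on (U \<times> (- {0})) ?f"
    by (intro continuous_intros assms continuous_on_compose2[OF continuous_on_shell_weight]) auto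
  moreover have "continuous_on (U \<times> ball 0 (1/2)) ?f"
    by (rule continuous_on_eq[OF continuous_on_const[of _ 0]]) (auto simp: shell_weight_zero)
  moreover have eq: "U \<times> UNIV = U \<times> (- {0}) \<union> U \<times> ball (0::'a) (1/2)" by auto
  moreover have "openin (top_of_set (U \<times> UNIV)) (U \<times> V)" if "open V" for V :: "'a set"
    using that by (intro openin_Times) auto
  then have "openin (top_of_set (U \<times> UNIV)) (U \<times> (- {0::'a}))"
    "openin (top_of_set (U \<times> UNIV)) (U \<times> ball (0::'a) (1/2))" by auto
  ultimately show ?thesis
    using continuous_on_Un_local_open[of "U \<times> (- {0})" "U \<times> ball (0::'a) (1/2)" ?f]
    unfolding eq[symmetric] by blast
qed

lemma continuous_on_weighted1:
  fixes g :: "'a::euclidean_space \<Rightarrow> 'c::real_normed_vector"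
  assumes "continuous_on (- {0}) g"
  shows "continuous_on UNIV (\<lambda>y. shell_weight y *\<^sub>R g y)"
proof -
  have "continuous_on ({0::real} \<times> UNIV) (\<lambda>z. shell_weight (snd z) *\<^sub>R g (snd z))"
    by (rule continuous_on_weighted) (auto intro!: continuous_on_compose2[OF assms] continuous_intros)
  then show ?thesis
    using continuous_on_compose2[of "{0::real} \<times> UNIV" "\<lambda>z. shell_weight (snd z) *\<^sub>R g (snd z)" UNIV "\<lambda>y. (0::real, y)"]
    by (auto simp: continuous_on_Pair)
qed

lemma weighted_integrable:
  fixes g :: "'a::euclidean_space \<Rightarrow> real"
  assumes "continuous_on (- {0}) g"
  shows "integrable lborel (\<lambda>y. shell_weight y * g y)"
proof -
  have "integrable lborel (\<lambda>y. indicator (cball 0 1) y * (shell_weight y * g y))"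
    by (rule integrable_indicator_mult_continuous[where r = 1])
      (use continuous_on_weighted1[OF assms] in auto)
  moreover have "indicator (cball 0 1) y * (shell_weight y * g y) = shell_weight y * g y" for y
    by (auto simp: indicator_def shell_weight_zero)
  ultimately show ?thesis by simp
qed

text \<open>Replacing one factor g by a polynomial within e of it on the closed shell bounds the
  weighted integral of g^2 by e C. Hence this integral is 0, and continuity gives g = 0 where the
  weight is positive.\<close>

lemma weighted_orthogonal_zero:
  fixes g :: "'a::euclidean_space \<Rightarrow> real"
  assumes g: "continuous_on (- {0}) g"
    and orth: "\<And>P. real_polynomial_function P \<Longrightarrow> (LINT y|lborel. shell_weight y * (P y * g y)) = 0"
    and y: "1/2 < norm y" "norm y < 1"
  shows "g y = 0"
proof -
  let ?S = "cball 0 1 - ball 0 (1/2) :: 'a set"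
  have S: "compact ?S" by (intro compact_diff) auto
  have gS: "continuous_on ?S g" by (rule continuous_on_subset[OF g]) auto
  have gc: "continuous_on (- {0}) (\<lambda>y. \<bar>g y\<bar>)" "continuous_on (- {0}) (\<lambda>y. g y * g y)"
    using g by (auto intro!: continuous_intros)
  define C where "C = (LINT y|lborel. shell_weight y * \<bar>g y\<bar>)"
  have "C \<ge> 0" unfolding C_def
    by (intro integral_nonneg_AE) (auto simp: shell_weight_nonneg)
  let ?I = "LINT y|lborel. shell_weight y * (g y * g y)"
  have le: "?I \<le> e * C" if "e > 0" for e
  proof -
    obtain P where P: "real_polynomial_function P" "\<And>x. x \<in> ?S \<Longrightarrow> \<bar>g x - P x\<bar> < e"
      using Stone_Weierstrass_real_polynomial_function[OF S gS \<open>e > 0\<close>] by blast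
    have cP: "continuous_on UNIV P"
      using P(1) by (simp add: continuous_at_imp_continuous_on continuous_real_polymonial_function)
    have cPg: "continuous_on (- {0}) (\<lambda>y. P y * g y)"
      by (intro continuous_intros g continuous_on_subset[OF cP]) auto
    have "?I = ?I - (LINT y|lborel. shell_weight y * (P y * g y))" using orth[OF P(1)] by simp
    also have "\<dots> = (LINT y|lborel. shell_weight y * (g y * g y) - shell_weight y * (P y * g y))"
      by (rule Bochner_Integration.integral_diff[symmetric])
        (intro weighted_integrable gc cPg)+
    also have "\<dots> \<le> (LINT y|lborel. e * (shell_weight y * \<bar>g y\<bar>))"
    proof (rule integral_mono)
      show "integrable lborel (\<lambda>y. shell_weight y * (g y * g y) - shell_weight y * (P y * g y))"
        by (intro Bochner_Integration.integrable_diff weighted_integrable gc cPg)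
      show "integrable lborel (\<lambda>y. e * (shell_weight y * \<bar>g y\<bar>))"
        by (intro integrable_mult_right weighted_integrable gc)
      fix z
      show "shell_weight z * (g z * g z) - shell_weight z * (P z * g z) \<le> e * (shell_weight z * \<bar>g z\<bar>)"
      proof (cases "z \<in> ?S")
        case True
        have "(g z - P z) * g z \<le> \<bar>g z - P z\<bar> * \<bar>g z\<bar>" by (metis abs_ge_self abs_mult)
        also have "\<dots> \<le> e * \<bar>g z\<bar>" using P(2)[OF True] by (intro mult_right_mono) auto
        finally have "shell_weight z * ((g z - P z) * g z) \<le> shell_weight z * (e * \<bar>g z\<bar>)"
          by (intro mult_left_mono shell_weight_nonneg)
        then show ?thesis by (simp add: algebra_simps)
      next
        case False
        then show ?thesis by (auto simp: shell_weight_zero)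
      qed
    qed
    also have "\<dots> = e * C" by (simp add: C_def)
    finally show ?thesis .
  qed
  have "?I \<le> 0"
  proof (rule ccontr)
    assume "\<not> ?I \<le> 0"
    then have "?I > 0" by simp
    \<comment> \<open>With this choice of e, a positive \<open>?I\<close> would satisfy
      \<open>?I \<le> ?I / 2\<close>.\<close>
    moreover have "?I \<le> ?I / (2 * (C + 1)) * C" using \<open>?I > 0\<close> \<open>C \<ge> 0\<close> by (intro le) auto
    moreover have "?I / (2 * (C + 1)) * C \<le> ?I / 2"
    proof -
      have "?I / (2 * (C + 1)) * C = ?I / 2 * (C / (C + 1))" using \<open>C \<ge> 0\<close> by (simp add: field_simps)
      also have "\<dots> \<le> ?I / 2 * 1" using \<open>C \<ge> 0\<close> \<open>?I > 0\<close> by (intro mult_left_mono) auto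
      finally show ?thesis by simp
    qed
    ultimately show False by linarith
  qed
  have h: "continuous_on UNIV (\<lambda>y. shell_weight y * (g y * g y))"
    using continuous_on_weighted1[OF gc(2)] by simp
  have h0: "shell_weight y * (g y * g y) \<ge> 0" for y by (simp add: shell_weight_nonneg)
  have "(LINT y|lborel. shell_weight y * (g y * g y)) = 0"
    using \<open>?I \<le> 0\<close> by (intro antisym integral_nonneg_AE) (auto simp: h0)
  then have AE0: "AE y in lborel. shell_weight y * (g y * g y) = 0"
    using weighted_integrable[OF gc(2)] h0
    by (subst (asm) integral_nonneg_eq_0_iff_AE) auto
  let ?U = "{y. shell_weight y * (g y * g y) \<noteq> 0}"
  have "open ?U" using h by (intro open_Collect_neq) auto
  then have "?U \<in> null_sets lborel" using AE0 AE_iff_null_sets[of ?U lborel] by simp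
  then have "negligible ?U" using \<open>open ?U\<close>
    by (simp add: negligible_iff_null_sets null_sets_completionI)
  then have "?U = {}" using \<open>open ?U\<close> open_not_negligible by blast
  then have "shell_weight y * (g y * g y) = 0" by blast
  then show ?thesis using shell_weight_pos[OF y] by auto
qed

section \<open>The roots of a family of separable polynomials\<close>

lemma finite_separated:
  fixes R :: "'a::metric_space set"
  assumes "finite R"
  obtains d where "d > 0" "\<And>x y. x \<in> R \<Longrightarrow> y \<in> R \<Longrightarrow> x \<noteq> y \<Longrightarrow> d \<le> dist x y"
proof -
  have "\<forall>x\<in>R. \<exists>d>0. \<forall>y\<in>R. y \<noteq> x \<longrightarrow> d \<le> dist x y"
    by (intro ballI finite_set_avoid assms)
  then obtain f where f: "\<And>x. x \<in> R \<Longrightarrow> f x > 0" "\<And>x y. x \<in> R \<Longrightarrow> y \<in> R \<Longrightarrow> y \<noteq> x \<Longrightarrow> f x \<le> dist x y"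
    by metis
  show ?thesis
  proof (rule that)
    show "Min (insert 1 (f ` R)) > 0" using assms f(1) by (subst Min_gr_iff) auto
    fix x y assume xy: "x \<in> R" "y \<in> R" "x \<noteq> y"
    have "Min (insert 1 (f ` R)) \<le> f x" using assms xy by (intro Min_le) auto
    also have "f x \<le> dist x y" using f(2) xy by auto
    finally show "Min (insert 1 (f ` R)) \<le> dist x y" .
  qed
qed

text \<open>The constant degree keeps roots from escaping to infinity and simplicity keeps them from
  colliding; together they make the roots a covering of Z with N sheets.\<close>

locale separable_family =
  fixes p :: "'b::real_normed_vector \<Rightarrow> complex poly" and Z :: "'b set" and N :: nat
  assumes cont_coeff: "\<And>i. continuous_on Z (\<lambda>z. coeff (p z) i)"
    and deg: "\<And>z. z \<in> Z \<Longrightarrow> degree (p z) = N" and N: "N > 0"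
    and simple: "\<And>z w. z \<in> Z \<Longrightarrow> poly (p z) w = 0 \<Longrightarrow> poly (pderiv (p z)) w \<noteq> 0"
begin

lemma poly_sum_N: "z \<in> Z \<Longrightarrow> poly (p z) w = (\<Sum>i\<le>N. coeff (p z) i * w ^ i)"
  by (simp add: poly_altdef deg)

lemma continuous_poly: "continuous_on Z (\<lambda>z. poly (p z) w)"
proof -
  have "continuous_on Z (\<lambda>z. \<Sum>i\<le>N. coeff (p z) i * w ^ i)"
    by (intro continuous_intros cont_coeff)
  then show ?thesis by (rule continuous_on_eq) (simp add: poly_sum_N)
qed

lemma nonzero: "z \<in> Z \<Longrightarrow> p z \<noteq> 0"
  using deg N by fastforce

lemma card_roots:
  assumes z: "z \<in> Z"
  shows "card {w. poly (p z) w = 0} = N"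
proof -
  have "rsquarefree (p z)" using simple[OF z] by (auto simp: rsquarefree_roots)
  then have "order w (p z) = (if poly (p z) w = 0 then 1 else 0)" for w
    using nonzero[OF z] order_root[of "p z" w] unfolding rsquarefree_def by (metis (full_types) One_nat_def)
  then have "proots (p z) = mset_set {w. poly (p z) w = 0}"
    using nonzero[OF z] poly_roots_finite[OF nonzero[OF z]] by (intro multiset_eqI) auto
  then show ?thesis using size_proots_complex[of "p z"] deg[OF z] by simp
qed

lemma finite_roots: "z \<in> Z \<Longrightarrow> finite {w. poly (p z) w = 0}"
  by (rule poly_roots_finite[OF nonzero])

text \<open>If all N roots of a nearby \<open>p z\<close> had distance at least e from w0,
  factorization would bound |p z (w0)| from below by e^N times the modulus of the leading
  coefficient, while p z (w0) tends to 0.\<close>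

lemma root_persists:
  assumes z: "z0 \<in> Z" and w: "poly (p z0) w0 = 0" and e: "e > 0"
  shows "eventually (\<lambda>z. \<exists>w\<in>ball w0 e. poly (p z) w = 0) (at z0 within Z)"
proof -
  let ?c = "norm (coeff (p z0) N)"
  have c: "?c > 0" using nonzero[OF z] deg[OF z] by auto
  have "((\<lambda>z. coeff (p z) N) \<longlongrightarrow> coeff (p z0) N) (at z0 within Z)"
    using cont_coeff z by (simp add: continuous_on_def)
  then have "((\<lambda>z. norm (coeff (p z) N)) \<longlongrightarrow> ?c) (at z0 within Z)" by (rule tendsto_norm)
  then have ev1: "eventually (\<lambda>z. norm (coeff (p z) N) > ?c / 2) (at z0 within Z)"
    using c by (intro order_tendstoD) auto
  have "((\<lambda>z. poly (p z) w0) \<longlongrightarrow> poly (p z0) w0) (at z0 within Z)"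
    using continuous_poly z by (simp add: continuous_on_def)
  then have "((\<lambda>z. norm (poly (p z) w0)) \<longlongrightarrow> norm (poly (p z0) w0)) (at z0 within Z)"
    by (rule tendsto_norm)
  then have ev2: "eventually (\<lambda>z. norm (poly (p z) w0) < ?c / 2 * e ^ N) (at z0 within Z)"
    using c e w by (intro order_tendstoD) auto
  have ev3: "eventually (\<lambda>z. z \<in> Z) (at z0 within Z)" by (simp add: eventually_at_filter)
  from ev1 ev2 ev3 show ?thesis
  proof eventually_elim
    case (elim z)
    obtain A where A: "size A = degree (p z)"
      "p z = Polynomial.smult (lead_coeff (p z)) (\<Prod>x\<in>#A. [:-x, 1:])"
      using alg_closed_imp_factorization[OF nonzero[OF elim(3)]] by blast
    show ?case
    proof (rule ccontr)
      assume no: "\<not> (\<exists>w\<in>ball w0 e. poly (p z) w = 0)"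
      have far: "e \<le> norm (w0 - x)" if "x \<in># A" for x
      proof -
        have "poly (p z) x = 0" using that by (subst A(2)) (auto simp: poly_prod_mset prod_mset_zero_iff)
        then show ?thesis using no by (auto simp: dist_norm)
      qed
      have "e ^ size B \<le> norm (\<Prod>x\<in>#B. w0 - x)" if "\<forall>x\<in>#B. e \<le> norm (w0 - x)" for B
        using that
      proof (induction B)
        case (add x B)
        then have "e * e ^ size B \<le> norm (w0 - x) * norm (\<Prod>x\<in>#B. w0 - x)"
          using e by (intro mult_mono) auto
        then show ?case by (simp add: norm_mult)
      qed simp
      from this[of A] have "e ^ N \<le> norm (\<Prod>x\<in>#A. w0 - x)" using A(1) deg[OF elim(3)] far by simp
      moreover have "poly (p z) w0 = coeff (p z) N * (\<Prod>x\<in>#A. w0 - x)"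
        using deg[OF elim(3)] by (subst A(2)) (simp add: poly_prod_mset)
      moreover have "?c / 2 * e ^ N \<le> norm (coeff (p z) N) * norm (\<Prod>x\<in>#A. w0 - x)"
        using elim(1) e calculation(1) by (intro mult_mono) auto
      ultimately have "?c / 2 * e ^ N \<le> norm (poly (p z) w0)" by (simp add: norm_mult)
      then show False using elim(2) by simp
    qed
  qed
qed

text \<open>Near z0 each of the N disjoint balls around the roots of \<open>p z0\<close> contains a
  root, by persistence, and therefore exactly one, by counting. The sheets are the graphs of the
  resulting root functions \<open>q x\<close>, whose continuity is persistence again.\<close>

lemma root_covering: "covering_space {(z, w). z \<in> Z \<and> poly (p z) w = 0} fst Z"
proof -
  let ?c = "{(z, w). z \<in> Z \<and> poly (p z) w = 0}"
  have surj: "fst ` ?c = Z"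
  proof (intro equalityI subsetI)
    fix z assume z: "z \<in> Z"
    have "{w. poly (p z) w = 0} \<noteq> {}" using card_roots[OF z] N by (metis card.empty less_irrefl)
    then show "z \<in> fst ` ?c" using z by force
  qed auto
  have "\<exists>T. z0 \<in> T \<and> openin (top_of_set Z) T \<and>
      (\<exists>v. \<Union> v = ?c \<inter> fst -` T \<and> (\<forall>u\<in>v. openin (top_of_set ?c) u) \<and> disjoint v \<and>
        (\<forall>u\<in>v. \<exists>q. homeomorphism u T fst q))" if z0: "z0 \<in> Z" for z0
  proof -
    let ?R = "\<lambda>z. {w. poly (p z) w = 0}"
    obtain d where d: "d > 0" "\<And>x y. x \<in> ?R z0 \<Longrightarrow> y \<in> ?R z0 \<Longrightarrow> x \<noteq> y \<Longrightarrow> d \<le> dist x y"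
      using finite_separated[OF finite_roots[OF z0]] by metis
    \<comment> \<open>Half of a lower bound for the distance of two roots, so the balls of this
      radius are disjoint.\<close>
    define e where "e = d / 2"
    have e: "e > 0" using d by (simp add: e_def)
    have disj: "x = y" if "x \<in> ?R z0" "y \<in> ?R z0" "w \<in> ball x e" "w \<in> ball y e" for x y w
      using d(2)[OF that(1,2)] that(3,4) dist_triangle_less_add[of x w e y e] by (auto simp: e_def dist_commute)
    define T where "T = {z\<in>Z. \<forall>x\<in>?R z0. \<exists>w\<in>ball x e. poly (p z) w = 0}"
    have uniq: "\<exists>!w. w \<in> ball x e \<and> poly (p z) w = 0" and all: "?R z \<subseteq> (\<Union>x\<in>?R z0. ball x e)"
      if z: "z \<in> T" and x: "x \<in> ?R z0" for z x
    proof -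
      have "\<forall>x\<in>?R z0. \<exists>w. w \<in> ball x e \<and> poly (p z) w = 0"
        using z unfolding T_def by blast
      from bchoice[OF this] obtain f where f: "\<And>x. x \<in> ?R z0 \<Longrightarrow> f x \<in> ball x e \<and> poly (p z) (f x) = 0"
        by blast
      have "inj_on f (?R z0)" using f disj by (metis (no_types, lifting) inj_onI)
      moreover have "z \<in> Z" using z by (simp add: T_def)
      ultimately have "f ` ?R z0 = ?R z"
        using f by (intro card_subset_eq finite_roots) (auto simp: card_image card_roots z0)
      then have *: "\<exists>x\<in>?R z0. w = f x" if "poly (p z) w = 0" for w using that by blast
      show "?R z \<subseteq> (\<Union>x\<in>?R z0. ball x e)" using * f by blast
      have "w = f x" if "w \<in> ball x e \<and> poly (p z) w = 0" for w
        using *[of w] that f disj[OF x _] by blast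
      then show "\<exists>!w. w \<in> ball x e \<and> poly (p z) w = 0" using f[OF x] by blast
    qed
    have "z0 \<in> T" using z0 e by (auto simp: T_def)
    have opT: "openin (top_of_set Z) T"
    proof (subst openin_subopen, intro ballI)
      fix z assume z: "z \<in> T"
      have "eventually (\<lambda>z'. \<forall>x\<in>?R z0. \<exists>w\<in>ball x e. poly (p z') w = 0) (at z within Z)"
      proof (rule eventually_ball_finite[OF finite_roots[OF z0]], intro ballI)
        fix x assume x: "x \<in> ?R z0"
        then obtain w where w: "w \<in> ball x e" "poly (p z) w = 0" using z by (auto simp: T_def)
        then obtain e' where e': "e' > 0" "ball w e' \<subseteq> ball x e" using open_ball openE by blast
        show "eventually (\<lambda>z'. \<exists>w\<in>ball x e. poly (p z') w = 0) (at z within Z)"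
          using root_persists[OF _ w(2) e'(1)] z e'(2) by (auto simp: T_def elim!: eventually_mono)
      qed
      then obtain S where S: "open S" "z \<in> S" "\<And>z'. z' \<in> S \<Longrightarrow> z' \<noteq> z \<Longrightarrow> z' \<in> Z \<Longrightarrow>
          \<forall>x\<in>?R z0. \<exists>w\<in>ball x e. poly (p z') w = 0"
        unfolding eventually_at_topological by blast
      show "\<exists>U. openin (top_of_set Z) U \<and> z \<in> U \<and> U \<subseteq> T"
      proof (intro exI conjI)
        show "openin (top_of_set Z) (Z \<inter> S)" using S(1) by (rule openin_open_Int)
        show "z \<in> Z \<inter> S" using S(2) z by (simp add: T_def)
        show "Z \<inter> S \<subseteq> T" using S(3) z by (auto simp: T_def)
      qed
    qed
    define V where "V x = {(z, w). z \<in> T \<and> w \<in> ball x e \<and> poly (p z) w = 0}" for x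
    define q where "q x z = (THE w. w \<in> ball x e \<and> poly (p z) w = 0)" for x z
    have q: "q x z \<in> ball x e" "poly (p z) (q x z) = 0" if "z \<in> T" "x \<in> ?R z0" for x z
      using theI'[OF uniq[OF that]] unfolding q_def by auto
    have q_eq: "w = q x z" if "z \<in> T" "x \<in> ?R z0" "w \<in> ball x e" "poly (p z) w = 0" for x z w
      using uniq[OF that(1,2)] q[OF that(1,2)] that(3,4) by blast
    have TZ: "T \<subseteq> Z" by (auto simp: T_def)
    have contq: "continuous_on T (q x)" if x: "x \<in> ?R z0" for x
      unfolding continuous_on_def
    proof (intro ballI tendstoI)
      fix z and d' :: real assume z: "z \<in> T" and "d' > 0"
      obtain e' where e': "e' > 0" "ball (q x z) e' \<subseteq> ball x e"
        using q(1)[OF z x] open_ball openE by blast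
      have "eventually (\<lambda>z'. \<exists>w\<in>ball (q x z) (min d' e'). poly (p z') w = 0) (at z within Z)"
        by (rule root_persists) (use z TZ q(2)[OF z x] \<open>d' > 0\<close> e' in auto)
      then have "eventually (\<lambda>z'. \<exists>w\<in>ball (q x z) (min d' e'). poly (p z') w = 0) (at z within T)"
        using TZ by (rule filter_leD[OF at_le, rotated])
      moreover have "eventually (\<lambda>z'. z' \<in> T) (at z within T)" by (simp add: eventually_at_filter)
      ultimately show "eventually (\<lambda>z'. dist (q x z') (q x z) < d') (at z within T)"
      proof eventually_elim
        case (elim z')
        then obtain w where w: "w \<in> ball (q x z) (min d' e')" "poly (p z') w = 0" by blast
        then have "w = q x z'" using q_eq[OF elim(2) x] e' by auto
        then show ?case using w by (auto simp: dist_commute)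
      qed
    qed
    show ?thesis
    proof (intro exI conjI)
      show "z0 \<in> T" by fact
      show "openin (top_of_set Z) T" by fact
      show "\<Union> (V ` ?R z0) = ?c \<inter> fst -` T"
      proof (intro equalityI subsetI)
        fix u assume "u \<in> \<Union> (V ` ?R z0)"
        then show "u \<in> ?c \<inter> fst -` T" using TZ by (auto simp: V_def)
      next
        fix u assume u: "u \<in> ?c \<inter> fst -` T"
        have "?R z0 \<noteq> {}" using card_roots[OF z0] N by (metis card.empty less_irrefl)
        then obtain x0 where "x0 \<in> ?R z0" by blast
        then have "?R (fst u) \<subseteq> (\<Union>x\<in>?R z0. ball x e)" using u by (intro all) auto
        then show "u \<in> \<Union> (V ` ?R z0)" using u by (force simp: V_def)
      qed
      show "\<forall>u\<in>V ` ?R z0. openin (top_of_set ?c) u"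
      proof
        fix u assume "u \<in> V ` ?R z0"
        then obtain x where u: "u = V x" by blast
        obtain S where S: "open S" "T = Z \<inter> S" using opT by (auto simp: openin_open)
        have "u = ?c \<inter> (S \<times> ball x e)" unfolding u V_def using S(2) by auto
        moreover have "open (S \<times> ball x e)" using S(1) by (intro open_Times) auto
        ultimately show "openin (top_of_set ?c) u" by (auto intro: openin_open_Int)
      qed
      show "disjoint (V ` ?R z0)"
      proof (rule pairwiseI)
        fix A B assume "A \<in> V ` ?R z0" "B \<in> V ` ?R z0" "A \<noteq> B"
        obtain x y where "x \<in> ?R z0" "y \<in> ?R z0" "A = V x" "B = V y" "x \<noteq> y"
          using \<open>A \<in> _\<close> \<open>B \<in> _\<close> \<open>A \<noteq> B\<close> by auto
        note xy = this
        have False if "u \<in> V x" "u \<in> V y" for u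
          using that disj[OF xy(1,2), of "snd u"] xy(5) by (cases u) (simp add: V_def)
        then show "disjnt A B" unfolding disjnt_iff xy(3,4) by blast
      qed
      show "\<forall>u\<in>V ` ?R z0. \<exists>q. homeomorphism u T fst q"
      proof
        fix u assume "u \<in> V ` ?R z0"
        then obtain x where x: "x \<in> ?R z0" and u: "u = V x" by blast
        have "homeomorphism u T fst (\<lambda>z. (z, q x z))"
        proof (rule homeomorphismI)
          show "continuous_on u fst" by (intro continuous_intros)
          show "continuous_on T (\<lambda>z. (z, q x z))" by (intro continuous_intros contq x)
          show "fst (z, q x z) = z" if "z \<in> T" for z by simp
          show "(fst v, q x (fst v)) = v" if "v \<in> u" for v
          proof -
            obtain z w where v: "v = (z, w)" by (cases v)
            with that have "w = q x z" unfolding u V_def by (intro q_eq x) auto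
            then show ?thesis by (simp add: v)
          qed
          show "fst ` u \<subseteq> T" by (auto simp: u V_def)
          show "(\<lambda>z. (z, q x z)) ` T \<subseteq> u" using q[OF _ x] by (auto simp: u V_def)
        qed
        then show "\<exists>q. homeomorphism u T fst q" by blast
      qed
    qed
  qed
  then show ?thesis
    unfolding covering_space_def using surj by (auto intro!: continuous_intros)
qed

end

section \<open>Evaluation of the annihilating polynomial\<close>

lemma poly_altdef_le:
  fixes p :: "'a::comm_semiring_1 poly"
  assumes "degree p \<le> n"
  shows "poly p z = (\<Sum>i\<le>n. coeff p i * z ^ i)"
  unfolding poly_altdef using assms
  by (intro sum.mono_neutral_left) (auto simp: coeff_eq_0)

text \<open>The vector of powers w^(m+n-1), ..., w, 1 is annihilated by the Sylvester matrix, whose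
  rows evaluate multiples X^k f and X^k g at w.\<close>

lemma sylvester_common_root:
  fixes f g :: "'a::field poly"
  assumes "poly f w = 0" "poly g w = 0" "degree f > 0"
  shows "resultant f g = 0"
proof -
  define m n where "m = degree f" and "n = degree g"
  have m: "m > 0" using assms by (simp add: m_def)
  define v where "v = Matrix.vec (m + n) (\<lambda>j. w ^ (m + n - 1 - j))"
  have v: "v \<in> carrier_vec (m + n)" by (simp add: v_def)
  have "vec_index v (m + n - 1) = 1" using m by (simp add: v_def)
  then have "v \<noteq> 0\<^sub>v (m + n)" using m by auto
  \<comment> \<open>The formula for the matrix entries has X^(k+1) f and index m + n - j where X^k f
    and m + n - 1 - j are meant; the two shifts by one cancel.\<close>
  have key: "(\<Sum>j<m + n. coeff (monom 1 (Suc k) * h) (m + n - j) * w ^ (m + n - 1 - j)) = 0"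
    if h: "poly h w = 0" "k + degree h \<le> m + n - 1" for h k
  proof -
    have "coeff (monom 1 (Suc k) * h) (m + n - j) = coeff (monom 1 k * h) (m + n - 1 - j)"
      if "j < m + n" for j
      using that by (auto simp: coeff_monom_mult)
    then have "(\<Sum>j<m + n. coeff (monom 1 (Suc k) * h) (m + n - j) * w ^ (m + n - 1 - j)) =
        (\<Sum>j<m + n. coeff (monom 1 k * h) (m + n - 1 - j) * w ^ (m + n - 1 - j))"
      by (intro sum.cong) auto
    also have "\<dots> = (\<Sum>i<m + n. coeff (monom 1 k * h) i * w ^ i)"
      using sum.nat_diff_reindex[of "\<lambda>i. coeff (monom 1 k * h) i * w ^ i" "m + n"] by simp
    also have "\<dots> = (\<Sum>i\<le>m + n - 1. coeff (monom 1 k * h) i * w ^ i)"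
      using m by (intro sum.cong) auto
    also have "\<dots> = poly (monom 1 k * h) w"
    proof -
      have "degree (monom 1 k * h) \<le> m + n - 1"
        using degree_mult_le[of "monom 1 k" h] degree_monom_le[of "1::'a" k] h(2) by linarith
      then show ?thesis by (rule poly_altdef_le[symmetric])
    qed
    also have "\<dots> = 0" using h by simp
    finally show ?thesis .
  qed
  have "sylvester_mat f g *\<^sub>v v = 0\<^sub>v (m + n)"
  proof (rule eq_vecI)
    fix i assume i: "i < dim_vec (0\<^sub>v (m + n) :: 'a Matrix.vec)"
    then have i': "i < m + n" by simp
    have "vec_index (sylvester_mat f g *\<^sub>v v) i =
        (\<Sum>j<m + n. sylvester_mat f g $$ (i, j) * w ^ (m + n - 1 - j))"
      using i' by (simp add: scalar_prod_def v_def m_def n_def atLeast0LessThan)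
    also have "\<dots> = (\<Sum>j<m + n. (if i < n then coeff (monom 1 (Suc (n - 1 - i)) * f) (m + n - j)
        else coeff (monom 1 (Suc (m + n - 1 - i)) * g) (m + n - j)) * w ^ (m + n - 1 - j))"
    proof (intro sum.cong refl)
      fix j assume j: "j \<in> {..<m + n}"
      have "n - i = Suc (n - 1 - i)" if "i < n" using that by simp
      moreover have "m + n - i = Suc (m + n - 1 - i)" using i' by simp
      ultimately show "sylvester_mat f g $$ (i, j) * w ^ (m + n - 1 - j) =
          (if i < n then coeff (monom 1 (Suc (n - 1 - i)) * f) (m + n - j)
           else coeff (monom 1 (Suc (m + n - 1 - i)) * g) (m + n - j)) * w ^ (m + n - 1 - j)"
        using sylvester_index_mat2[of i f g j] i' j by (simp add: m_def n_def)
    qed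
    also have "\<dots> = 0"
    proof (cases "i < n")
      case True
      then show ?thesis using key[OF assms(1), of "n - 1 - i"] by (simp add: m_def del: One_nat_def)
    next
      case False
      then show ?thesis using key[OF assms(2), of "m + n - 1 - i"] i' by (simp add: n_def del: One_nat_def)
    qed
    finally show "vec_index (sylvester_mat f g *\<^sub>v v) i = vec_index (0\<^sub>v (m + n)) i" using i' by simp
  qed (simp add: m_def n_def)
  then have "Determinant.det (sylvester_mat f g) = 0"
    using det_0_iff_vec_prod_zero[of "sylvester_mat f g" "m + n"] v \<open>v \<noteq> 0\<^sub>v (m + n)\<close> sylvester_carrier_mat[of f g]
    unfolding m_def n_def by blast
  then show ?thesis by (simp add: resultant_def)
qed

lemma degree_deriv_w_le: "degree (deriv_w Q) \<le> degree Q - 1"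
  by (rule degree_le) (auto simp: coeff_deriv_w coeff_eq_0)

text \<open>Each entry in the first column of the Sylvester matrix is 0, the leading coefficient of
  Q or its multiple by \<open>degree Q\<close>; expand along this column.\<close>

lemma lead_coeff_dvd_resultant_deriv:
  fixes Q :: "'a::comm_ring_1 poly"
  assumes "degree Q > 0" and deg: "degree (deriv_w Q) = degree Q - 1"
  shows "lead_coeff Q dvd resultant Q (deriv_w Q)"
proof -
  define m n where "m = degree Q" and "n = degree (deriv_w Q)"
  let ?A = "sylvester_mat Q (deriv_w Q)"
  have A: "?A \<in> carrier_mat (m + n) (m + n)" unfolding m_def n_def by (rule sylvester_carrier_mat)
  have "lead_coeff Q dvd ?A $$ (i, 0)" if i: "i < m + n" for i
  proof -
    have "?A $$ (i, 0) = (if i < n then if i \<le> 0 \<and> 0 - i \<le> m then coeff Q (m + i - 0) else 0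
        else if i - n \<le> 0 \<and> 0 \<le> i then coeff (deriv_w Q) (i - 0) else 0)"
      using sylvester_index_mat[of i Q "deriv_w Q" 0] i unfolding m_def n_def by (simp split: if_splits)
    moreover have "coeff (deriv_w Q) n = of_nat m * lead_coeff Q"
      unfolding coeff_deriv_w n_def deg using assms(1) by (simp add: m_def)
    ultimately show ?thesis by (auto simp: m_def)
  qed
  then have "lead_coeff Q dvd (\<Sum>i<m + n. ?A $$ (i, 0) * cofactor ?A i 0)"
    by (intro dvd_sum dvd_mult2) auto
  then show ?thesis
    using laplace_expansion_column[OF A, of 0] assms(1) by (simp add: resultant_def m_def)
qed

section \<open>Specialization of Q at a direction and a time\<close>

lemma poly_map_poly_altdef:
  fixes f :: "'b::zero \<Rightarrow> 'a::comm_semiring_1"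
  assumes "f 0 = 0"
  shows "poly (map_poly f p) z = (\<Sum>k\<le>degree p. f (coeff p k) * z ^ k)"
  using poly_altdef_le[OF degree_map_poly_le[of f p]] assms by (simp add: coeff_map_poly)

lemma csphere_apply_comm_ring_hom:
  fixes \<xi> :: "real^'n::finite"
  assumes "\<xi> \<in> sphere 0 1"
  shows "comm_ring_hom (\<lambda>a. csphere_apply a \<xi>)"
  by unfold_locales
    (use assms in \<open>simp_all add: plus_csphere.rep_eq times_csphere.rep_eq one_csphere.rep_eq
      zero_csphere.rep_eq uminus_csphere.rep_eq minus_csphere.rep_eq\<close>)

lemma csphere_apply_zero[simp]: "csphere_apply 0 \<xi> = 0"
  by (simp add: zero_csphere.rep_eq)

lemma csphere_apply_continuous: "continuous_on (sphere 0 1) (csphere_apply a)"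
  using csphere_apply[of a] by simp

lemma eval_z_altdef: "eval_z q \<xi> z = (\<Sum>k\<le>degree q. csphere_apply (coeff q k) \<xi> * z ^ k)"
  unfolding eval_z_def by (rule poly_map_poly_altdef) simp

lemma eval_z_zero[simp]: "eval_z 0 \<xi> z = 0"
  by (simp add: eval_z_def)

lemma eval_z_comm_ring_hom:
  fixes \<xi> :: "real^'n::finite"
  assumes "\<xi> \<in> sphere 0 1"
  shows "comm_ring_hom (\<lambda>q. eval_z q \<xi> z)"
proof -
  interpret h: comm_ring_hom "\<lambda>a. csphere_apply a \<xi>" by (rule csphere_apply_comm_ring_hom[OF assms])
  interpret m: map_poly_comm_ring_hom "\<lambda>a. csphere_apply a \<xi>" ..
  show ?thesis
    unfolding eval_z_def by unfold_locales (simp_all add: m.hom_add m.hom_mult)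
qed

lemma eval_z_continuous: "continuous_on (sphere 0 1 \<times> UNIV) (\<lambda>v. eval_z q (fst v) (snd v))"
  unfolding eval_z_altdef
  by (intro continuous_intros continuous_on_compose2[OF csphere_apply_continuous]) auto

definition eval_z_deriv :: "('n::finite) csphere poly \<Rightarrow> real^'n \<Rightarrow> complex \<Rightarrow> complex" where
  "eval_z_deriv q \<xi> z = (\<Sum>k\<le>degree q. csphere_apply (coeff q k) \<xi> * (of_nat k * z ^ (k - 1)))"

lemma eval_z_deriv_continuous:
  "continuous_on (sphere 0 1 \<times> UNIV) (\<lambda>v. eval_z_deriv q (fst v) (snd v))"
  unfolding eval_z_deriv_def
  by (intro continuous_intros continuous_on_compose2[OF csphere_apply_continuous]) auto

lemma eval_z_has_field_derivative:
  "((\<lambda>z. eval_z q \<xi> z) has_field_derivative eval_z_deriv q \<xi> z) (at z)"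
  unfolding eval_z_altdef eval_z_deriv_def
  by (auto intro!: derivative_eq_intros sum.cong simp: mult_ac)

lemma csphere_bound:
  fixes a :: "('n::finite) csphere"
  obtains B where "B \<ge> 0" "\<And>\<xi>. cmod (csphere_apply a \<xi>) \<le> B"
proof -
  have "bounded (csphere_apply a ` sphere 0 1)"
    by (intro compact_imp_bounded compact_continuous_image csphere_apply_continuous) auto
  then obtain B where B: "\<forall>x\<in>sphere 0 1. cmod (csphere_apply a x) \<le> B"
    by (auto simp: bounded_iff)
  have "cmod (csphere_apply a \<xi>) \<le> max B 0" for \<xi>
    using B csphere_apply[of a] by (cases "\<xi> \<in> sphere 0 1") (auto simp: le_max_iff_disj)
  then show ?thesis using that[of "max B 0"] by auto
qed

lemma eval_z_bound:
  fixes q :: "('n::finite) csphere poly"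
  obtains B where "B \<ge> 0" "\<And>\<xi> z. cmod (eval_z q \<xi> z) \<le> B * (1 + cmod z) ^ degree q"
proof -
  have "\<exists>B. B \<ge> 0 \<and> (\<forall>\<xi>. cmod (csphere_apply (coeff q k) \<xi>) \<le> B)" for k
    using csphere_bound[of "coeff q k"] by metis
  then obtain B where B: "\<And>k. B k \<ge> 0" "\<And>k \<xi>. cmod (csphere_apply (coeff q k) \<xi>) \<le> B k"
    by metis
  have "cmod (eval_z q \<xi> z) \<le> (\<Sum>k\<le>degree q. B k) * (1 + cmod z) ^ degree q" for \<xi> z
  proof -
    have "cmod (eval_z q \<xi> z) \<le> (\<Sum>k\<le>degree q. cmod (csphere_apply (coeff q k) \<xi>) * cmod z ^ k)"
      unfolding eval_z_altdef by (rule order_trans[OF norm_sum]) (simp add: norm_mult norm_power)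
    also have "\<dots> \<le> (\<Sum>k\<le>degree q. B k * (1 + cmod z) ^ degree q)"
    proof (intro sum_mono mult_mono B)
      fix k assume k: "k \<in> {..degree q}"
      have "cmod z ^ k \<le> (1 + cmod z) ^ k" by (intro power_mono) auto
      also have "\<dots> \<le> (1 + cmod z) ^ degree q" using k by (intro power_increasing) auto
      finally show "cmod z ^ k \<le> (1 + cmod z) ^ degree q" .
    qed (auto simp: B)
    finally show ?thesis by (simp add: sum_distrib_right)
  qed
  then show ?thesis using that B(1) by (meson sum_nonneg)
qed

text \<open>The homogenization of \<open>q\<close> is continuous and has no zeros on the product of the sphere
  with the unit circle, the point at infinity being covered by the leading coefficient.\<close>

lemma eval_z_lower_bound:
  fixes q :: "('n::finite) csphere poly"
  assumes lc: "\<And>\<xi>. \<xi> \<in> sphere 0 1 \<Longrightarrow> csphere_apply (lead_coeff q) \<xi> \<noteq> 0"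
    and nz: "\<And>\<xi> t. \<xi> \<in> sphere 0 1 \<Longrightarrow> eval_z q \<xi> (of_real t) \<noteq> 0"
  obtains c where "c > 0" "\<And>\<xi> t. \<xi> \<in> sphere 0 1 \<Longrightarrow> c \<le> cmod (eval_z q \<xi> (of_real t))"
proof -
  define M where "M = degree q"
  define f where "f v = (\<Sum>k\<le>M. csphere_apply (coeff q k) (fst v) *
     (of_real (fst (snd v)) ^ k * of_real (snd (snd v)) ^ (M - k)))" for v :: "(real^'n) \<times> real \<times> real"
  let ?K = "sphere (0 :: real^'n) 1 \<times> sphere (0 :: real \<times> real) 1"
  have hom: "f (\<xi>, s, c) = of_real c ^ M * eval_z q \<xi> (of_real (s / c))" if "c \<noteq> 0" for \<xi> s c
  proof -
    have "of_real s ^ k * of_real c ^ (M - k) = (of_real c ^ M * of_real (s / c) ^ k :: complex)" if "k \<le> M" for k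
      using \<open>c \<noteq> 0\<close> that by (simp add: power_divide power_diff)
    then show ?thesis
      by (auto simp: f_def eval_z_altdef M_def[symmetric] sum_distrib_left mult_ac intro!: sum.cong)
  qed
  have nzf: "f v \<noteq> 0" if v: "v \<in> ?K" for v
  proof -
    obtain \<xi> s c where vv: "v = (\<xi>, s, c)" by (cases v)
    have \<xi>: "\<xi> \<in> sphere 0 1" and sc: "s\<^sup>2 + c\<^sup>2 = 1" using v by (auto simp: vv norm_Pair)
    show ?thesis
    proof (cases "c = 0")
      case True
      then have "s \<noteq> 0" using sc by auto
      have "f v = csphere_apply (coeff q M) \<xi> * of_real s ^ M"
        unfolding f_def vv using True by (subst sum.remove[of _ M]) (auto simp: zero_power intro!: sum.neutral)
      then show ?thesis using lc[OF \<xi>] \<open>s \<noteq> 0\<close> by (simp add: M_def)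
    next
      case False
      then show ?thesis using nz[OF \<xi>, of "s / c"] by (simp add: vv hom)
    qed
  qed
  have cont: "continuous_on ?K (\<lambda>v. cmod (f v))"
    unfolding f_def
    by (intro continuous_intros continuous_on_compose2[OF csphere_apply_continuous]) auto
  have "compact ?K" by (intro compact_Times compact_sphere)
  have "?K \<noteq> {}"
  proof -
    obtain x :: "real^'n" where "norm x = 1" using vector_choose_size[of 1] by auto
    then have "(x, (1, 0)) \<in> ?K" by (auto simp: norm_Pair)
    then show ?thesis by (metis empty_iff)
  qed
  from continuous_attains_inf[OF \<open>compact ?K\<close> \<open>?K \<noteq> {}\<close> cont]
  obtain v0 where v0: "v0 \<in> ?K" "\<forall>v\<in>?K. cmod (f v0) \<le> cmod (f v)" by (elim bexE)
  show ?thesis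
  proof
    show "cmod (f v0) > 0" using nzf[OF v0(1)] by simp
    fix \<xi> :: "real^'n" and t :: real assume \<xi>: "\<xi> \<in> sphere 0 1"
    \<comment> \<open>Places t on the unit circle as (t/r, 1/r); the factor (1/r)^M caused by
      homogenization is at most 1.\<close>
    define r where "r = sqrt (1 + t\<^sup>2)"
    have r: "r > 0" "r \<ge> 1" "r\<^sup>2 = 1 + t\<^sup>2" by (auto simp: r_def add_pos_nonneg)
    have "(t / r)\<^sup>2 + (1 / r)\<^sup>2 = (1 + t\<^sup>2) / r\<^sup>2" by (simp add: power_divide add_divide_distrib)
    also have "\<dots> = 1" using r(1) by (simp add: r(3)[symmetric])
    finally have "norm (t / r, 1 / r) = 1" by (simp add: norm_Pair del: abs_divide)
    then have "(\<xi>, t / r, 1 / r) \<in> ?K" using \<xi> by simp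
    from bspec[OF v0(2) this] have "cmod (f v0) \<le> (1 / r) ^ M * cmod (eval_z q \<xi> (of_real t))"
      using r by (simp add: hom norm_mult norm_power norm_divide)
    also have "\<dots> \<le> 1 * cmod (eval_z q \<xi> (of_real t))"
      using r by (intro mult_right_mono power_le_one) auto
    finally show "cmod (f v0) \<le> cmod (eval_z q \<xi> (of_real t))" by simp
  qed
qed

text \<open>Cauchy's bound: for |w| > 1 move the lower terms to the other side, estimate their
  powers by |w|^(N-1) and divide by it.\<close>

lemma poly_root_bound:
  fixes p :: "complex poly"
  assumes "poly p w = 0" "degree p = N" "N > 0"
  shows "cmod w \<le> 1 + (\<Sum>i<N. cmod (coeff p i)) / cmod (coeff p N)"
proof (cases "cmod w \<le> 1")
  case True
  then show ?thesis by (simp add: add_increasing2 sum_nonneg)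
next
  case False
  have lc: "cmod (coeff p N) > 0" using assms by auto
  have N: "N = Suc (N - 1)" using assms by simp
  have "0 = (\<Sum>i<Suc N. coeff p i * w ^ i)"
    using assms by (simp add: poly_altdef lessThan_Suc_atMost)
  then have "coeff p N * w ^ N = - (\<Sum>i<N. coeff p i * w ^ i)" by (simp add: eq_neg_iff_add_eq_0 add.commute)
  then have "cmod (coeff p N) * cmod w ^ N = cmod (\<Sum>i<N. coeff p i * w ^ i)"
    by (metis norm_minus_cancel norm_mult norm_power)
  also have "\<dots> \<le> (\<Sum>i<N. cmod (coeff p i) * cmod w ^ (N - 1))"
    using False by (intro order_trans[OF norm_sum] sum_mono)
      (auto simp: norm_mult norm_power intro!: mult_left_mono power_increasing)
  also have "\<dots> = (\<Sum>i<N. cmod (coeff p i)) * cmod w ^ (N - 1)" by (simp add: sum_distrib_right)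
  finally have "(cmod (coeff p N) * cmod w) * cmod w ^ (N - 1) \<le> (\<Sum>i<N. cmod (coeff p i)) * cmod w ^ (N - 1)"
    by (subst (asm) N) (simp add: mult_ac)
  then have "cmod (coeff p N) * cmod w \<le> (\<Sum>i<N. cmod (coeff p i))"
    by (rule mult_right_le_imp_le) (use False in \<open>intro zero_less_power, linarith\<close>)
  then have "cmod w \<le> (\<Sum>i<N. cmod (coeff p i)) / cmod (coeff p N)"
    using lc by (simp add: field_simps)
  then show ?thesis by simp
qed

definition poly_at :: "('n::finite) csphere poly poly \<Rightarrow> real^'n \<Rightarrow> complex \<Rightarrow> complex poly" where
  "poly_at Q \<xi> z = map_poly (\<lambda>q. eval_z q \<xi> z) Q"

lemma eval_zw_poly_at: "eval_zw Q \<xi> z w = poly (poly_at Q \<xi> z) w"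
  by (simp add: eval_zw_def poly_at_def)

lemma coeff_poly_at: "coeff (poly_at Q \<xi> z) i = eval_z (coeff Q i) \<xi> z"
  by (simp add: poly_at_def coeff_map_poly)

lemma csphere_of_nat_mult_eq_0:
  fixes a :: "('n::finite) csphere"
  assumes "of_nat k * a = 0" "k > 0"
  shows "a = 0"
proof -
  have "csphere_apply a \<xi> = 0" for \<xi>
  proof (cases "\<xi> \<in> sphere 0 1")
    case True
    then interpret h: comm_ring_hom "\<lambda>a. csphere_apply a \<xi>" by (rule csphere_apply_comm_ring_hom)
    have "of_nat k * csphere_apply a \<xi> = 0"
      using arg_cong[OF assms(1), of "\<lambda>a. csphere_apply a \<xi>"] by (simp add: h.hom_mult h.hom_of_nat)
    then show ?thesis using assms(2) by simp
  qed (use csphere_apply[of a] in auto)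
  then show ?thesis by (simp add: csphere_apply_inject[symmetric] fun_eq_iff)
qed

text \<open>The algebra of continuous functions has zero divisors but no torsion, so the factor
  \<open>degree Q\<close> does not annihilate the leading coefficient.\<close>

lemma degree_deriv_w:
  fixes Q :: "('n::finite) csphere poly poly"
  assumes "degree Q > 0"
  shows "degree (deriv_w Q) = degree Q - 1"
proof (rule antisym[OF degree_deriv_w_le])
  have "of_nat (degree Q) * lead_coeff Q \<noteq> 0"
  proof
    assume *: "of_nat (degree Q) * lead_coeff Q = 0"
    have "of_nat (degree Q) * coeff (lead_coeff Q) k = 0" for k
      using arg_cong[OF *, of "\<lambda>p. coeff p k"] by (simp add: of_nat_poly)
    then have "lead_coeff Q = 0"
      using assms csphere_of_nat_mult_eq_0 by (intro poly_eqI) auto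
    then show False using assms by auto
  qed
  then have "coeff (deriv_w Q) (degree Q - 1) \<noteq> 0"
    using assms by (simp add: coeff_deriv_w)
  then show "degree Q - 1 \<le> degree (deriv_w Q)" by (rule le_degree)
qed

lemma lead_coeff_dvd_Res:
  fixes Q :: "('n::finite) csphere poly poly"
  assumes "degree Q > 0"
  obtains S where "Res Q = lead_coeff Q * S"
  using lead_coeff_dvd_resultant_deriv[OF assms degree_deriv_w[OF assms]]
  by (auto simp: Res_def elim: dvdE)

text \<open>The leading coefficient divides the resultant. Hence specialization at a regular point
  keeps the degree in w, which in turn allows the resultant itself to be specialized.\<close>

lemma eval_lead_coeff_nonzero:
  fixes Q :: "('n::finite) csphere poly poly"
  assumes "degree Q > 0" "\<xi> \<in> sphere 0 1" "eval_z (Res Q) \<xi> z \<noteq> 0"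
  shows "eval_z (lead_coeff Q) \<xi> z \<noteq> 0"
proof -
  interpret h: comm_ring_hom "\<lambda>q. eval_z q \<xi> z" by (rule eval_z_comm_ring_hom[OF assms(2)])
  obtain S where "Res Q = lead_coeff Q * S" using lead_coeff_dvd_Res[OF assms(1)] .
  then show ?thesis using assms(3) by (auto simp: h.hom_mult)
qed

lemma degree_poly_at:
  fixes Q :: "('n::finite) csphere poly poly"
  assumes "degree Q > 0" "\<xi> \<in> sphere 0 1" "eval_z (Res Q) \<xi> z \<noteq> 0"
  shows "degree (poly_at Q \<xi> z) = degree Q"
proof (rule antisym)
  show "degree (poly_at Q \<xi> z) \<le> degree Q" unfolding poly_at_def by (rule degree_map_poly_le)
  show "degree Q \<le> degree (poly_at Q \<xi> z)"
    using eval_lead_coeff_nonzero[OF assms] by (intro le_degree) (simp add: coeff_poly_at)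
qed

text \<open>A multiple root would be a common root of the specialized polynomial and its derivative;
  since both keep their degrees, their resultant is the value of \<open>Res Q\<close>, which is
  nonzero.\<close>

lemma poly_at_simple:
  fixes Q :: "('n::finite) csphere poly poly"
  assumes "degree Q > 0" "\<xi> \<in> sphere 0 1" "eval_z (Res Q) \<xi> z \<noteq> 0"
    and w: "poly (poly_at Q \<xi> z) w = 0"
  shows "poly (pderiv (poly_at Q \<xi> z)) w \<noteq> 0"
proof
  assume w': "poly (pderiv (poly_at Q \<xi> z)) w = 0"
  interpret h: comm_ring_hom "\<lambda>q. eval_z q \<xi> z" by (rule eval_z_comm_ring_hom[OF assms(2)])
  have pd: "map_poly (\<lambda>q. eval_z q \<xi> z) (deriv_w Q) = pderiv (poly_at Q \<xi> z)"
    by (rule poly_eqI)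
      (simp add: coeff_map_poly coeff_deriv_w coeff_pderiv coeff_poly_at h.hom_mult h.hom_of_nat h.hom_add)
  have "resultant (map_poly (\<lambda>q. eval_z q \<xi> z) Q) (map_poly (\<lambda>q. eval_z q \<xi> z) (deriv_w Q))
      = eval_z (resultant Q (deriv_w Q)) \<xi> z"
  proof (rule h.resultant_map_poly)
    show "degree (map_poly (\<lambda>q. eval_z q \<xi> z) Q) = degree Q"
      using degree_poly_at[OF assms(1-3)] by (simp add: poly_at_def)
    show "degree (map_poly (\<lambda>q. eval_z q \<xi> z) (deriv_w Q)) = degree (deriv_w Q)"
      using degree_poly_at[OF assms(1-3)] by (simp add: pd degree_pderiv degree_deriv_w[OF assms(1)])
  qed
  then have "resultant (poly_at Q \<xi> z) (pderiv (poly_at Q \<xi> z)) = eval_z (Res Q) \<xi> z"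
    by (simp add: pd Res_def poly_at_def)
  moreover have "resultant (poly_at Q \<xi> z) (pderiv (poly_at Q \<xi> z)) = 0"
    using w w' assms(1) degree_poly_at[OF assms(1-3)] by (intro sylvester_common_root) auto
  ultimately show False using assms(3) by simp
qed

definition regular_set :: "('n::finite) csphere poly poly \<Rightarrow> ((real^'n) \<times> complex) set" where
  "regular_set Q = {v. fst v \<in> sphere 0 1 \<and> eval_z (Res Q) (fst v) (snd v) \<noteq> 0}"

lemma separable_family_poly_at:
  fixes Q :: "('n::finite) csphere poly poly"
  assumes "degree Q > 0"
  shows "separable_family (\<lambda>v. poly_at Q (fst v) (snd v)) (regular_set Q) (degree Q)"
proof
  show "continuous_on (regular_set Q) (\<lambda>v. coeff (poly_at Q (fst v) (snd v)) i)" for i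
    unfolding coeff_poly_at
    by (rule continuous_on_subset[OF eval_z_continuous]) (auto simp: regular_set_def mem_Times_iff)
  show "degree (poly_at Q (fst v) (snd v)) = degree Q" if "v \<in> regular_set Q" for v
    using that by (intro degree_poly_at assms) (auto simp: regular_set_def)
  show "poly (pderiv (poly_at Q (fst v) (snd v))) w \<noteq> 0"
    if "v \<in> regular_set Q" "poly (poly_at Q (fst v) (snd v)) w = 0" for v w
    using that by (intro poly_at_simple assms) (auto simp: regular_set_def)
qed (rule assms)

text \<open>Cauchy's bound combined with 1/|q_N| \<le> |S|/c, where Res = q_N S and c is a lower
  bound for |Res| on the sphere times the real line. The constants C and d do not depend on the
  direction.\<close>

lemma poly_at_root_growth:
  fixes Q :: "('n::finite) csphere poly poly"
  assumes "degree Q > 0"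
    and "\<And>\<xi>. \<xi> \<in> sphere 0 1 \<Longrightarrow> csphere_apply (lead_coeff (Res Q)) \<xi> \<noteq> 0"
    and res: "\<And>\<xi> t. \<xi> \<in> sphere 0 1 \<Longrightarrow> eval_z (Res Q) \<xi> (of_real t) \<noteq> 0"
  obtains C d where "C \<ge> 0" "\<And>\<xi> t w. \<xi> \<in> sphere 0 1 \<Longrightarrow> poly (poly_at Q \<xi> (of_real t)) w = 0 \<Longrightarrow>
    cmod w \<le> C * (1 + \<bar>t\<bar>) ^ d"
proof -
  define N where "N = degree Q"
  obtain c where c: "c > 0" "\<And>\<xi> t. \<xi> \<in> sphere 0 1 \<Longrightarrow> c \<le> cmod (eval_z (Res Q) \<xi> (of_real t))"
    using eval_z_lower_bound[of "Res Q"] assms(2,3) by blast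
  obtain S where S: "Res Q = lead_coeff Q * S" using lead_coeff_dvd_Res[OF assms(1)] .
  obtain B where B: "B \<ge> 0" "\<And>\<xi> z. cmod (eval_z S \<xi> z) \<le> B * (1 + cmod z) ^ degree S"
    using eval_z_bound by blast
  have "\<exists>A. A \<ge> 0 \<and> (\<forall>\<xi> z. cmod (eval_z (coeff Q i) \<xi> z) \<le> A * (1 + cmod z) ^ degree (coeff Q i))" for i
    using eval_z_bound[of "coeff Q i"] by metis
  then obtain A where A: "\<And>i. A i \<ge> 0"
    "\<And>i \<xi> z. cmod (eval_z (coeff Q i) \<xi> z) \<le> A i * (1 + cmod z) ^ degree (coeff Q i)"
    by metis
  define d1 where "d1 = Max ((\<lambda>i. degree (coeff Q i)) ` {..N})"
  define d where "d = d1 + degree S"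
  define C where "C = 1 + (\<Sum>i<N. A i) * B / c"
  have C: "C \<ge> 0" unfolding C_def
    using A(1) B(1) c(1) by (intro add_nonneg_nonneg divide_nonneg_nonneg mult_nonneg_nonneg sum_nonneg) auto
  have "cmod w \<le> C * (1 + \<bar>t\<bar>) ^ d"
    if \<xi>: "\<xi> \<in> sphere 0 1" and w: "poly (poly_at Q \<xi> (of_real t)) w = 0" for \<xi> t w
  proof -
    interpret h: comm_ring_hom "\<lambda>q. eval_z q \<xi> (of_real t)" by (rule eval_z_comm_ring_hom[OF \<xi>])
    let ?s = "1 + \<bar>t\<bar>" and ?lc = "cmod (eval_z (lead_coeff Q) \<xi> (of_real t))"
    have s: "?s \<ge> 1" by simp
    have lc: "?lc > 0" using eval_lead_coeff_nonzero[OF assms(1) \<xi> res[OF \<xi>]] by simp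
    have "c \<le> ?lc * (B * ?s ^ degree S)"
    proof -
      have "c \<le> ?lc * cmod (eval_z S \<xi> (of_real t))"
        using c(2)[OF \<xi>, of t] by (simp add: S h.hom_mult norm_mult)
      also have "\<dots> \<le> ?lc * (B * ?s ^ degree S)"
        using B(2)[of \<xi> "of_real t"] by (intro mult_left_mono) auto
      finally show ?thesis .
    qed
    then have inv: "1 / ?lc \<le> B * ?s ^ degree S / c" using lc c(1) by (simp add: field_simps)
    have sum: "(\<Sum>i<N. cmod (eval_z (coeff Q i) \<xi> (of_real t))) \<le> (\<Sum>i<N. A i) * ?s ^ d1"
      unfolding sum_distrib_right
    proof (rule sum_mono)
      fix i assume i: "i \<in> {..<N}"
      have "cmod (eval_z (coeff Q i) \<xi> (of_real t)) \<le> A i * ?s ^ degree (coeff Q i)"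
        using A(2)[of i \<xi> "of_real t"] by simp
      also have "\<dots> \<le> A i * ?s ^ d1"
        using A(1) s i by (intro mult_left_mono power_increasing) (auto simp: d1_def intro!: Max_ge)
      finally show "cmod (eval_z (coeff Q i) \<xi> (of_real t)) \<le> A i * ?s ^ d1" .
    qed
    have "cmod w \<le> 1 + (\<Sum>i<N. cmod (coeff (poly_at Q \<xi> (of_real t)) i)) / cmod (coeff (poly_at Q \<xi> (of_real t)) N)"
      using assms(1) by (intro poly_root_bound[OF w]) (simp_all add: N_def degree_poly_at[OF assms(1) \<xi> res[OF \<xi>]])
    also have "\<dots> = 1 + (\<Sum>i<N. cmod (eval_z (coeff Q i) \<xi> (of_real t))) * (1 / ?lc)"
      by (simp add: coeff_poly_at N_def)
    also have "\<dots> \<le> 1 + ((\<Sum>i<N. A i) * ?s ^ d1) * (B * ?s ^ degree S / c)"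
      using sum inv lc A(1) by (intro add_left_mono mult_mono) (auto intro!: mult_nonneg_nonneg sum_nonneg)
    also have "\<dots> = 1 + (\<Sum>i<N. A i) * B / c * ?s ^ d"
      by (simp add: d_def power_add)
    also have "\<dots> \<le> ?s ^ d + (\<Sum>i<N. A i) * B / c * ?s ^ d" by simp
    also have "\<dots> = C * ?s ^ d" by (simp add: C_def algebra_simps)
    finally show ?thesis .
  qed
  with C show ?thesis using that by blast
qed

section \<open>Analytic continuation of the volume function\<close>

lemma cut_vol_scale:
  assumes "c > 0"
  shows "cut_vol D (c *\<^sub>R y) (c * t) = cut_vol D y t"
  using assms by (simp add: cut_vol_def)

lemma cut_vol_sgn:
  assumes "y \<noteq> 0"
  shows "cut_vol D (sgn y) (t / norm y) = cut_vol D y t"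
  using cut_vol_scale[of "1 / norm y" D y t] assms by (simp add: sgn_div_norm divide_inverse mult.commute)

lemma vol_fun_eq_cut_vol:
  assumes "D \<in> sets borel"
  shows "vol_fun D y t = cut_vol D y t"
proof -
  have *: "D \<inter> {x. inner y x \<le> t} = {x\<in>D. inner y x \<le> t}" by auto
  have "D \<inter> {x. inner y x \<le> t} \<in> sets lborel" using assms by simp
  then show ?thesis unfolding vol_fun_def cut_vol_def * by (simp add: measure_completion)
qed

text \<open>Time is counted from the hyperplane through a: t stands for the height y \<bullet> a +
  t. Division by |y| passes to a unit normal, because the averages run over vectors y of different
  lengths.\<close>

definition ray_pt :: "real^'n \<Rightarrow> real^'n \<Rightarrow> complex \<Rightarrow> (real^'n::finite) \<times> complex" where
  "ray_pt a y t = (sgn y, (of_real (y \<bullet> a) + t) / of_real (norm y))"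

lemma ray_pt_continuous:
  assumes f: "continuous_on S f" and g: "continuous_on S g" and nz: "\<And>x. x \<in> S \<Longrightarrow> f x \<noteq> 0"
  shows "continuous_on S (\<lambda>x. ray_pt a (f x) (g x))"
  unfolding ray_pt_def using nz by (intro continuous_intros f g) auto

text \<open>The whole segment from 0 to t has to be regular, since the branch is continued along
  it.\<close>

definition branch_dom :: "('n::finite) csphere poly poly \<Rightarrow> real^'n \<Rightarrow> ((real^'n) \<times> complex) set" where
  "branch_dom Q a = {v. fst v \<noteq> 0 \<and> (\<forall>s\<in>{0..1}. ray_pt a (fst v) (of_real s * snd v) \<in> regular_set Q)}"

lemma branch_dom_real:
  assumes "\<And>\<xi> t. \<xi> \<in> sphere 0 1 \<Longrightarrow> eval_z (Res Q) \<xi> (of_real t) \<noteq> 0" "y \<noteq> 0"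
  shows "(y, of_real t) \<in> branch_dom Q a"
proof -
  have "(of_real (y \<bullet> a) + of_real s * of_real t) / of_real (norm y) = (of_real ((y \<bullet> a + s * t) / norm y) :: complex)" for s
    by simp
  then show ?thesis using assms
    by (simp add: branch_dom_def ray_pt_def regular_set_def norm_sgn del: of_real_add of_real_mult of_real_divide)
qed

lemma poly_at_cut_vol:
  fixes D :: "(real^'n::finite) set"
  assumes ann: "annihilates_vol Q D" and D: "open D" and "y \<noteq> 0" "x \<in> D" "y \<bullet> x = y \<bullet> a + t"
  shows "poly (poly_at Q (fst (ray_pt a y (of_real t))) (snd (ray_pt a y (of_real t))))
    (of_real (cut_vol D y (y \<bullet> a + t))) = 0"
proof -
  have "sgn y \<bullet> x = (y \<bullet> a + t) / norm y"
    using assms(5) by (simp add: sgn_div_norm divide_inverse mult.commute)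
  then have "(sgn y, (y \<bullet> a + t) / norm y) \<in> vol_domain D"
    using assms(3,4) by (auto simp: vol_domain_def norm_sgn)
  then have "eval_zw Q (sgn y) (of_real ((y \<bullet> a + t) / norm y)) (of_real (vol_fun D (sgn y) ((y \<bullet> a + t) / norm y))) = 0"
    using ann unfolding annihilates_vol_def by auto
  then show ?thesis
    using D assms(3) by (simp add: eval_zw_poly_at ray_pt_def vol_fun_eq_cut_vol cut_vol_sgn)
qed

text \<open>Homotopy lifting along the segments from 0 to t, for all (y, t) at once, starting from
  the hyperplane through a, where the volume is a root; no loops occur, hence no monodromy. If the
  hyperplane at a real time t meets D, the true volume is a lift along the segment as well and
  agrees with W by uniqueness.\<close>

lemma branch_extension:
  fixes D :: "(real^'n::finite) set"
  assumes deg: "degree Q > 0" and ann: "annihilates_vol Q D"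
    and res: "\<And>\<xi> t. \<xi> \<in> sphere 0 1 \<Longrightarrow> eval_z (Res Q) \<xi> (of_real t) \<noteq> 0"
    and D: "open D" "connected D" "bounded D" and a: "a \<in> D"
  obtains W :: "(real^'n) \<times> complex \<Rightarrow> complex" where
    "continuous_on (branch_dom Q a) W"
    "\<And>y t. (y, t) \<in> branch_dom Q a \<Longrightarrow>
      poly (poly_at Q (fst (ray_pt a y t)) (snd (ray_pt a y t))) (W (y, t)) = 0"
    "\<And>y t x. y \<noteq> 0 \<Longrightarrow> x \<in> D \<Longrightarrow> y \<bullet> x = y \<bullet> a + t \<Longrightarrow>
      W (y, of_real t) = of_real (cut_vol D y (y \<bullet> a + t))"
proof -
  interpret sf: separable_family "\<lambda>v. poly_at Q (fst v) (snd v)" "regular_set Q" "degree Q"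
    by (rule separable_family_poly_at[OF deg])
  have Db: "D \<in> sets borel" using D(1) by simp
  let ?U = "branch_dom Q a"
  let ?c = "{(z, w). z \<in> regular_set Q \<and> poly (poly_at Q (fst z) (snd z)) w = 0}"
  define h where "h v = ray_pt a (fst (snd v)) (of_real (fst v) * snd (snd v))"
    for v :: "real \<times> (real^'n) \<times> complex"
  define f where "f v = (ray_pt a (fst v) 0, complex_of_real (cut_vol D (fst v) (fst v \<bullet> a)))"
    for v :: "(real^'n) \<times> complex"
  have nz: "fst v \<noteq> 0" if "v \<in> ?U" for v using that by (simp add: branch_dom_def)
  have conth: "continuous_on ({0..1} \<times> ?U) h" unfolding h_def
    by (intro ray_pt_continuous continuous_intros) (auto simp: branch_dom_def)
  have him: "h \<in> {0..1} \<times> ?U \<rightarrow> regular_set Q" by (auto simp: h_def branch_dom_def)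
  have contf: "continuous_on ?U f" unfolding f_def
  proof (intro continuous_intros ray_pt_continuous)
    have "continuous_on ?U (\<lambda>v. (\<lambda>z. cut_vol D (fst z) (snd z)) (fst v, fst v \<bullet> a))"
      by (rule continuous_on_compose2[OF cut_vol_continuous[OF Db D(3)]])
        (auto intro!: continuous_intros dest: nz)
    then show "continuous_on ?U (\<lambda>v. cut_vol D (fst v) (fst v \<bullet> a))" by simp
  qed (use nz in auto)
  have fim: "f \<in> ?U \<rightarrow> ?c"
  proof
    fix v assume v: "v \<in> ?U"
    then have "ray_pt a (fst v) (of_real 0 * snd v) \<in> regular_set Q" unfolding branch_dom_def by force
    moreover have "poly (poly_at Q (fst (ray_pt a (fst v) 0)) (snd (ray_pt a (fst v) 0)))
        (of_real (cut_vol D (fst v) (fst v \<bullet> a))) = 0"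
      using poly_at_cut_vol[OF ann D(1) nz[OF v] a, of a 0] by simp
    ultimately show "f v \<in> ?c" by (simp add: f_def)
  qed
  obtain k where k: "continuous_on ({0..1} \<times> ?U) k" "k \<in> {0..1} \<times> ?U \<rightarrow> ?c"
    "\<And>v. v \<in> ?U \<Longrightarrow> k (0, v) = f v" "\<And>z. z \<in> {0..1} \<times> ?U \<Longrightarrow> h z = fst (k z)"
    using covering_space_lift_homotopy[OF sf.root_covering conth him _ contf fim]
    by (simp add: h_def f_def) blast
  define W where "W v = snd (k (1, v))" for v
  show ?thesis
  proof
    show "continuous_on ?U W" unfolding W_def
      by (intro continuous_intros continuous_on_compose2[OF k(1)]) auto
    show "poly (poly_at Q (fst (ray_pt a y t)) (snd (ray_pt a y t))) (W (y, t)) = 0"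
      if v: "(y, t) \<in> ?U" for y t
    proof -
      have "k (1, y, t) \<in> ?c" by (rule funcset_mem[OF k(2)]) (use v in auto)
      moreover have "fst (k (1, y, t)) = ray_pt a y t" using k(4)[of "(1, y, t)"] v by (simp add: h_def)
      ultimately show ?thesis by (auto simp: W_def case_prod_beta)
    qed
    fix y x :: "real^'n" and t :: real
    assume y: "y \<noteq> 0" and x: "x \<in> D" and yx: "y \<bullet> x = y \<bullet> a + t"
    have v: "(y, of_real t) \<in> ?U" by (rule branch_dom_real[OF res y])
    \<comment> \<open>D is connected, so all hyperplanes between those through a and x meet D, and Q
      annihilates the volume all along the segment.\<close>
    have mid: "\<exists>x'\<in>D. y \<bullet> x' = y \<bullet> a + s * t" if s: "s \<in> {0..1}" for s
    proof -
      have conn: "connected ((\<bullet>) y ` D)"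
        by (intro connected_continuous_image continuous_intros D)
      have "y \<bullet> a + s * t \<in> closed_segment (y \<bullet> a) (y \<bullet> x)"
        unfolding in_segment yx using s by (intro exI[of _ s]) (auto simp: algebra_simps)
      moreover have "convex ((\<bullet>) y ` D)" using conn by (simp add: connected_convex_1)
      then have "closed_segment (y \<bullet> a) (y \<bullet> x) \<subseteq> (\<bullet>) y ` D"
        using a x by (intro closed_segment_subset) auto
      ultimately have "y \<bullet> a + s * t \<in> (\<bullet>) y ` D" by (rule rev_subsetD)
      then show ?thesis by auto
    qed
    let ?g2 = "\<lambda>s. (ray_pt a y (of_real s * of_real t), complex_of_real (cut_vol D y (y \<bullet> a + s * t)))"
    have "k (1, y, of_real t) = ?g2 1"
    proof (rule covering_space_lift_unique[OF sf.root_covering, where T = "{0..1}" and a = 0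
          and f = "\<lambda>s. h (s, y, of_real t)" and ?g1.0 = "\<lambda>s. k (s, y, of_real t)" and ?g2.0 = ?g2])
      show "k (0, y, of_real t) = ?g2 0" using k(3)[OF v] by (simp add: f_def)
      show "continuous_on {0..1} (\<lambda>s. h (s, y, of_real t))"
        by (intro continuous_on_compose2[OF conth] continuous_intros) (use v in auto)
      show "(\<lambda>s. h (s, y, of_real t)) \<in> {0..1} \<rightarrow> regular_set Q" using him v by auto
      show "continuous_on {0..1} (\<lambda>s. k (s, y, of_real t))"
        by (intro continuous_on_compose2[OF k(1)] continuous_intros) (use v in auto)
      show "(\<lambda>s. k (s, y, of_real t)) \<in> {0..1} \<rightarrow> ?c"
        by (intro funcsetI funcset_mem[OF k(2)]) (use v in auto)
      show "continuous_on {0..1} ?g2"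
      proof (intro continuous_intros ray_pt_continuous)
        have "continuous_on {0..1} (\<lambda>s::real. (\<lambda>z. cut_vol D (fst z) (snd z)) (y, y \<bullet> a + s * t))"
          by (rule continuous_on_compose2[OF cut_vol_continuous[OF Db D(3)]])
            (use y in \<open>auto intro!: continuous_intros\<close>)
        then show "continuous_on {0..1} (\<lambda>s. cut_vol D y (y \<bullet> a + s * t))" by simp
      qed (use y in auto)
      show "?g2 \<in> {0..1} \<rightarrow> ?c"
      proof
        fix s :: real assume s: "s \<in> {0..1}"
        obtain x' where "x' \<in> D" "y \<bullet> x' = y \<bullet> a + s * t" using mid[OF s] by blast
        from poly_at_cut_vol[OF ann D(1) y this]
        show "?g2 s \<in> ?c" using v s by (simp add: branch_dom_def)
      qed
    qed (use v k(4) in \<open>auto simp: h_def\<close>)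
    then show "W (y, of_real t) = of_real (cut_vol D y (y \<bullet> a + t))" by (simp add: W_def)
  qed
qed

text \<open>Implicit differentiation from mere continuity of w. With Caratheodory's factor g of p t0
  at w t0, the two root equations give g (w t) (w t - w t0) = - (p t - p t0) (w t); divide by t -
  t0.\<close>

lemma root_has_field_derivative:
  fixes p :: "complex \<Rightarrow> complex poly" and w :: "complex \<Rightarrow> complex"
  assumes op: "open S" "t0 \<in> S" and cont: "isCont w t0"
    and root: "\<And>t. t \<in> S \<Longrightarrow> poly (p t) (w t) = 0" and deg: "\<And>t. t \<in> S \<Longrightarrow> degree (p t) \<le> N"
    and c: "\<And>i. ((\<lambda>t. coeff (p t) i) has_field_derivative c' i) (at t0)"
    and simple: "poly (pderiv (p t0)) (w t0) \<noteq> 0"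
  shows "(w has_field_derivative - (\<Sum>i\<le>N. c' i * w t0 ^ i) / poly (pderiv (p t0)) (w t0)) (at t0)"
proof -
  obtain g where g: "\<And>z. poly (p t0) z - poly (p t0) (w t0) = g z * (z - w t0)"
    "isCont g (w t0)" "g (w t0) = poly (pderiv (p t0)) (w t0)"
    using poly_DERIV[of "p t0" "w t0"] unfolding CARAT_DERIV by blast
  have wlim: "(w \<longlongrightarrow> w t0) (at t0)" using cont by (simp add: isCont_def)
  have glim: "((\<lambda>t. g (w t)) \<longlongrightarrow> poly (pderiv (p t0)) (w t0)) (at t0)"
    using isCont_tendsto_compose[OF g(2) wlim] g(3) by simp
  have clim: "((\<lambda>t. (coeff (p t) i - coeff (p t0) i) / (t - t0)) \<longlongrightarrow> c' i) (at t0)" for i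
    using c[of i] by (simp add: has_field_derivative_iff)
  have "((\<lambda>t. - (\<Sum>i\<le>N. (coeff (p t) i - coeff (p t0) i) / (t - t0) * w t ^ i) / g (w t)) \<longlongrightarrow>
      - (\<Sum>i\<le>N. c' i * w t0 ^ i) / poly (pderiv (p t0)) (w t0)) (at t0)"
    by (intro tendsto_intros clim wlim glim simple)
  moreover have "eventually (\<lambda>t. - (\<Sum>i\<le>N. (coeff (p t) i - coeff (p t0) i) / (t - t0) * w t ^ i) / g (w t)
      = (w t - w t0) / (t - t0)) (at t0)"
  proof -
    have "eventually (\<lambda>t. t \<in> S) (at t0)" using op by (auto simp: eventually_at_topological)
    moreover have "eventually (\<lambda>t. t \<noteq> t0) (at t0)" by (simp add: eventually_at_filter)
    moreover have "eventually (\<lambda>t. g (w t) \<noteq> 0) (at t0)"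
      using tendsto_imp_eventually_ne[OF glim simple] .
    ultimately show ?thesis
    proof eventually_elim
      case (elim t)
      have "poly (p t) (w t) = (\<Sum>i\<le>N. coeff (p t) i * w t ^ i)"
        "poly (p t0) (w t) = (\<Sum>i\<le>N. coeff (p t0) i * w t ^ i)"
        using deg elim op(2) by (auto intro: poly_altdef_le)
      then have "(\<Sum>i\<le>N. (coeff (p t) i - coeff (p t0) i) * w t ^ i) = - (g (w t) * (w t - w t0))"
        using root[OF elim(1)] root[OF op(2)] g(1)[of "w t"]
        by (simp add: left_diff_distrib sum_subtractf)
      then have "(\<Sum>i\<le>N. (coeff (p t) i - coeff (p t0) i) / (t - t0) * w t ^ i) =
          - (g (w t) * (w t - w t0)) / (t - t0)"
        by (simp add: sum_divide_distrib[symmetric])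
      then show ?case using elim by (simp add: field_simps)
    qed
  qed
  ultimately show ?thesis
    unfolding has_field_derivative_iff by (rule Lim_transform_eventually)
qed

text \<open>Minus the z-derivative of Q over its w-derivative, as in implicit differentiation; 1 /
  |y| comes from the chain rule for \<open>ray_pt\<close>.\<close>

definition branch_deriv ::
  "('n::finite) csphere poly poly \<Rightarrow> real^'n \<Rightarrow> ((real^'n) \<times> complex \<Rightarrow> complex) \<Rightarrow> (real^'n) \<times> complex \<Rightarrow> complex" where
  "branch_deriv Q a W v = - (\<Sum>i\<le>degree Q. eval_z_deriv (coeff Q i) (fst (ray_pt a (fst v) (snd v)))
      (snd (ray_pt a (fst v) (snd v))) / of_real (norm (fst v)) * W v ^ i) /
    poly (pderiv (poly_at Q (fst (ray_pt a (fst v) (snd v))) (snd (ray_pt a (fst v) (snd v))))) (W v)"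

abbreviation closed_shell :: "'a::real_normed_vector set" where
  "closed_shell \<equiv> cball 0 1 - ball 0 (1/2)"

text \<open>Times admissible for all y of the closed shell simultaneously, so that the integrals
  over the shell are holomorphic on one common set.\<close>

definition branch_times :: "('n::finite) csphere poly poly \<Rightarrow> real^'n \<Rightarrow> complex set" where
  "branch_times Q a = {t. \<forall>y\<in>closed_shell. (y, t) \<in> branch_dom Q a}"

lemma branch_dom_regular:
  assumes "(y, t) \<in> branch_dom Q a"
  shows "fst (ray_pt a y t) \<in> sphere 0 1" "eval_z (Res Q) (fst (ray_pt a y t)) (snd (ray_pt a y t)) \<noteq> 0" "y \<noteq> 0"
proof -
  have "\<forall>s\<in>{0..1}. ray_pt a y (of_real s * t) \<in> regular_set Q" using assms by (simp add: branch_dom_def)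
  from bspec[OF this, of 1] have "ray_pt a y (of_real 1 * t) \<in> regular_set Q" by simp
  then show "fst (ray_pt a y t) \<in> sphere 0 1" "eval_z (Res Q) (fst (ray_pt a y t)) (snd (ray_pt a y t)) \<noteq> 0"
    by (simp_all add: regular_set_def)
  show "y \<noteq> 0" using assms by (simp add: branch_dom_def)
qed

lemma compact_closed_shell: "compact (closed_shell :: 'a::euclidean_space set)"
  by (intro compact_diff) auto

text \<open>The bad times are the projection of a closed set along the compact factor formed by y
  and s, hence a closed set.\<close>

lemma open_branch_times:
  fixes Q :: "('n::finite) csphere poly poly"
  shows "open (branch_times Q a)"
proof -
  let ?K = "(closed_shell :: (real^'n) set) \<times> {0..1::real}"
  define E where "E v = eval_z (Res Q) (fst (ray_pt a (fst (fst v)) (of_real (snd (fst v)) * snd v)))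
     (snd (ray_pt a (fst (fst v)) (of_real (snd (fst v)) * snd v)))" for v :: "((real^'n) \<times> real) \<times> complex"
  have nz: "y \<noteq> 0" if "y \<in> closed_shell" for y :: "real^'n" using that by auto
  have ray: "continuous_on (?K \<times> UNIV) (\<lambda>v. ray_pt a (fst (fst v)) (of_real (snd (fst v)) * snd v))"
    by (intro ray_pt_continuous continuous_intros) auto
  have "continuous_on (?K \<times> UNIV) (\<lambda>v. (\<lambda>u. eval_z (Res Q) (fst u) (snd u))
      (ray_pt a (fst (fst v)) (of_real (snd (fst v)) * snd v)))"
    by (rule continuous_on_compose2[OF eval_z_continuous ray])
      (auto simp: ray_pt_def norm_sgn)
  then have contE: "continuous_on (?K \<times> UNIV) E" by (simp add: E_def[abs_def])
  have "closedin (top_of_set (?K \<times> UNIV)) {v \<in> ?K \<times> UNIV. E v = 0}"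
    by (rule continuous_closedin_preimage_constant[OF contE])
  moreover have "compact ?K" by (intro compact_Times compact_closed_shell) auto
  ultimately have "closedin (top_of_set UNIV) {t. \<exists>k. k \<in> ?K \<and> (k, t) \<in> {v \<in> ?K \<times> UNIV. E v = 0}}"
    by (rule closedin_compact_projection[rotated])
  moreover have "{t. \<exists>k. k \<in> ?K \<and> (k, t) \<in> {v \<in> ?K \<times> UNIV. E v = 0}} = snd ` {v \<in> ?K \<times> UNIV. E v = 0}"
    by force
  ultimately have "closedin (top_of_set UNIV) (snd ` {v \<in> ?K \<times> UNIV. E v = 0})" by simp
  then have "open (- snd ` {v \<in> ?K \<times> UNIV. E v = 0})" by (simp add: open_closed)
  moreover have "- snd ` {v \<in> ?K \<times> UNIV. E v = 0} = branch_times Q a"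
  proof (rule Set.set_eqI)
    fix t
    have "t \<in> snd ` {v \<in> ?K \<times> UNIV. E v = 0} \<longleftrightarrow> (\<exists>y\<in>closed_shell. \<exists>s\<in>{0..1}. E ((y, s), t) = 0)"
      by (auto simp: image_iff Bex_def)
    also have "\<dots> \<longleftrightarrow> t \<notin> branch_times Q a"
      using nz by (auto simp: branch_times_def branch_dom_def regular_set_def E_def ray_pt_def norm_sgn Bex_def)
    finally show "t \<in> - snd ` {v \<in> ?K \<times> UNIV. E v = 0} \<longleftrightarrow> t \<in> branch_times Q a" by blast
  qed
  ultimately show ?thesis by simp
qed

lemma branch_times_real:
  assumes "\<And>\<xi> t. \<xi> \<in> sphere 0 1 \<Longrightarrow> eval_z (Res Q) \<xi> (of_real t) \<noteq> 0"
  shows "of_real t \<in> branch_times Q a"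
  unfolding branch_times_def by (auto intro!: branch_dom_real assms)

text \<open>Star-shaped about 0, because \<open>branch_dom\<close> demands whole segments.\<close>

lemma connected_branch_times:
  assumes "\<And>\<xi> t. \<xi> \<in> sphere 0 1 \<Longrightarrow> eval_z (Res Q) \<xi> (of_real t) \<noteq> 0"
  shows "connected (branch_times Q a)"
proof (rule starlike_imp_connected)
  have "0 \<in> branch_times Q a" using branch_times_real[OF assms, of 0] by simp
  moreover have "closed_segment 0 t \<subseteq> branch_times Q a" if t: "t \<in> branch_times Q a" for t
  proof
    fix u assume "u \<in> closed_segment 0 t"
    then obtain c where c: "0 \<le> c" "c \<le> 1" "u = of_real c * t"
      by (auto simp: in_segment scaleR_conv_of_real)
    have "(y, u) \<in> branch_dom Q a" if y: "y \<in> closed_shell" for y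
    proof -
      have yt: "(y, t) \<in> branch_dom Q a" using t y by (simp add: branch_times_def)
      have "ray_pt a y (of_real s * u) \<in> regular_set Q" if s: "s \<in> {0..1}" for s
      proof -
        have "s * c \<in> {0..1}" using s c by (auto intro: mult_le_one)
        then have "ray_pt a y (of_real (s * c) * t) \<in> regular_set Q"
          using yt unfolding branch_dom_def by fastforce
        then show ?thesis by (simp add: c(3) mult.assoc)
      qed
      then show ?thesis using yt by (simp add: branch_dom_def)
    qed
    then show "u \<in> branch_times Q a" by (simp add: branch_times_def)
  qed
  ultimately show "starlike (branch_times Q a)" unfolding starlike_def by blast
qed

lemma branch_has_field_derivative:
  fixes Q :: "('n::finite) csphere poly poly"
  assumes deg: "degree Q > 0" and W: "continuous_on (branch_dom Q a) W"
    and root: "\<And>y t. (y, t) \<in> branch_dom Q a \<Longrightarrow>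
      poly (poly_at Q (fst (ray_pt a y t)) (snd (ray_pt a y t))) (W (y, t)) = 0"
    and y: "y \<in> closed_shell" and t: "t \<in> branch_times Q a"
  shows "((\<lambda>t. W (y, t)) has_field_derivative branch_deriv Q a W (y, t)) (at t)"
proof -
  let ?O = "branch_times Q a"
  have dom: "(y, s) \<in> branch_dom Q a" if "s \<in> ?O" for s using that y by (simp add: branch_times_def)
  have y0: "y \<noteq> 0" using y by auto
  have "continuous_on ?O (\<lambda>s. W (y, s))"
    by (rule continuous_on_compose2[OF W]) (auto intro!: continuous_intros dom)
  then have cont: "isCont (\<lambda>s. W (y, s)) t"
    using t by (simp add: continuous_on_eq_continuous_at[OF open_branch_times])
  let ?p = "\<lambda>s. poly_at Q (fst (ray_pt a y s)) (snd (ray_pt a y s))"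
  have "((\<lambda>s. W (y, s)) has_field_derivative - (\<Sum>i\<le>degree Q. (eval_z_deriv (coeff Q i) (sgn y)
      (snd (ray_pt a y t)) / of_real (norm y)) * W (y, t) ^ i) / poly (pderiv (?p t)) (W (y, t))) (at t)"
  proof (rule root_has_field_derivative[OF open_branch_times t cont])
    show "poly (?p s) (W (y, s)) = 0" if "s \<in> ?O" for s by (rule root[OF dom[OF that]])
    show "degree (?p s) \<le> degree Q" for s unfolding poly_at_def by (rule degree_map_poly_le)
    show "((\<lambda>s. coeff (?p s) i) has_field_derivative
        eval_z_deriv (coeff Q i) (sgn y) (snd (ray_pt a y t)) / of_real (norm y)) (at t)" for i
    proof -
      have "((\<lambda>s. snd (ray_pt a y s)) has_field_derivative 1 / of_real (norm y)) (at t)"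
        unfolding ray_pt_def snd_conv using y0 by (auto intro!: derivative_eq_intros)
      from DERIV_chain2[OF eval_z_has_field_derivative this]
      show ?thesis by (simp add: coeff_poly_at ray_pt_def)
    qed
    show "poly (pderiv (?p t)) (W (y, t)) \<noteq> 0"
      using branch_dom_regular[OF dom[OF t]] root[OF dom[OF t]] by (intro poly_at_simple[OF deg])
  qed
  then show ?thesis by (simp add: branch_deriv_def ray_pt_def)
qed

lemma branch_deriv_continuous:
  fixes Q :: "('n::finite) csphere poly poly"
  assumes deg: "degree Q > 0" and W: "continuous_on (branch_dom Q a) W"
    and root: "\<And>y t. (y, t) \<in> branch_dom Q a \<Longrightarrow>
      poly (poly_at Q (fst (ray_pt a y t)) (snd (ray_pt a y t))) (W (y, t)) = 0"
  shows "continuous_on (branch_dom Q a) (branch_deriv Q a W)"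
proof -
  let ?U = "branch_dom Q a"
  have nz: "fst v \<noteq> 0" if "v \<in> ?U" for v using that by (simp add: branch_dom_def)
  have ray: "continuous_on ?U (\<lambda>v. ray_pt a (fst v) (snd v))"
    by (intro ray_pt_continuous continuous_intros) (use nz in auto)
  have sph: "(\<lambda>v. ray_pt a (fst v) (snd v)) ` ?U \<subseteq> sphere 0 1 \<times> UNIV"
    using nz by (auto simp: ray_pt_def norm_sgn)
  have 1: "continuous_on ?U (\<lambda>v. eval_z q (fst (ray_pt a (fst v) (snd v))) (snd (ray_pt a (fst v) (snd v))))" for q
    using continuous_on_compose2[OF eval_z_continuous ray sph] by simp
  have 2: "continuous_on ?U (\<lambda>v. eval_z_deriv q (fst (ray_pt a (fst v) (snd v))) (snd (ray_pt a (fst v) (snd v))))" for q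
    using continuous_on_compose2[OF eval_z_deriv_continuous ray sph] by simp
  have "poly (pderiv (poly_at Q \<xi> z)) w = (\<Sum>i\<le>degree Q. (of_nat (Suc i) * eval_z (coeff Q (Suc i)) \<xi> z) * w ^ i)" for \<xi> z w
  proof -
    have "degree (pderiv (poly_at Q \<xi> z)) \<le> degree Q"
      using degree_map_poly_le[of "\<lambda>q. eval_z q \<xi> z" Q] by (simp add: degree_pderiv poly_at_def)
    then show ?thesis by (simp add: poly_altdef_le[of _ "degree Q"] coeff_pderiv coeff_poly_at)
  qed
  then have 3: "continuous_on ?U (\<lambda>v. poly (pderiv (poly_at Q (fst (ray_pt a (fst v) (snd v)))
      (snd (ray_pt a (fst v) (snd v))))) (W v))"
    by (simp add: continuous_intros 1 W del: of_nat_Suc)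
  have 4: "poly (pderiv (poly_at Q (fst (ray_pt a (fst v) (snd v))) (snd (ray_pt a (fst v) (snd v))))) (W v) \<noteq> 0"
    if "v \<in> ?U" for v
    using branch_dom_regular[of "fst v" "snd v" Q a] root[of "fst v" "snd v"] that
    by (intro poly_at_simple[OF deg]) simp_all
  show ?thesis unfolding branch_deriv_def
    by (intro continuous_intros 2 3 W) (use nz 4 in auto)
qed

text \<open>At complex times G is available on the closed shell only, so closed pieces are glued; on
  their overlap, the two bounding spheres, the weight is 0.\<close>

lemma continuous_on_weighted_closed:
  fixes G :: "'b::metric_space \<times> 'a::euclidean_space \<Rightarrow> 'c::real_normed_vector"
  assumes G: "continuous_on (U \<times> closed_shell) G"
  shows "continuous_on (U \<times> UNIV) (\<lambda>z. shell_weight (snd z) *\<^sub>R G z)"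
proof -
  let ?f = "\<lambda>z. shell_weight (snd z) *\<^sub>R G z"
  let ?C = "cball 0 (1/2) \<union> - ball (0::'a) 1"
  have 1: "continuous_on (U \<times> closed_shell) ?f"
    by (intro continuous_intros G continuous_on_compose2[OF continuous_on_shell_weight]) auto
  have 2: "continuous_on (U \<times> ?C) ?f"
    by (rule continuous_on_eq[OF continuous_on_const[of _ 0]]) (auto simp: shell_weight_zero)
  have eq: "U \<times> UNIV = U \<times> closed_shell \<union> U \<times> ?C" by auto
  have cl: "closedin (top_of_set (U \<times> UNIV)) (U \<times> V)" if "closed V" for V :: "'a set"
    using that by (intro closedin_Times) auto
  have "closed (closed_shell :: 'a set)" "closed ?C" by (auto intro!: closed_Diff closed_Un)
  then show ?thesis
    using continuous_on_Un_local[of "U \<times> closed_shell" "U \<times> ?C" ?f] cl 1 2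
    unfolding eq[symmetric] by blast
qed

text \<open>An integral over a box around the unit ball, the shape in which the Leibniz rule for
  holomorphic parameters is stated; the weight vanishes outside the ball.\<close>

definition shell_int :: "('a::euclidean_space \<Rightarrow> complex) \<Rightarrow> complex" where
  "shell_int g = integral (cbox (- One) One) (\<lambda>y. shell_weight y *\<^sub>R g y)"

lemma cball_subset_cbox_One: "cball (0::'a::euclidean_space) 1 \<subseteq> cbox (- One) One"
proof
  fix y :: 'a assume "y \<in> cball 0 1"
  then have "\<bar>y \<bullet> i\<bar> \<le> 1" if "i \<in> Basis" for i
    using Basis_le_norm[OF that, of y] by simp
  then show "y \<in> cbox (- One) One" by (auto simp: mem_box abs_le_iff)
qed

lemma weighted_continuous_UNIV:
  fixes g :: "'a::euclidean_space \<Rightarrow> 'c::real_normed_vector"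
  assumes "continuous_on closed_shell g"
  shows "continuous_on UNIV (\<lambda>y. shell_weight y *\<^sub>R g y)"
proof -
  have "continuous_on ({0::real} \<times> UNIV) (\<lambda>z. shell_weight (snd z) *\<^sub>R g (snd z))"
    by (rule continuous_on_weighted_closed) (auto intro!: continuous_on_compose2[OF assms] continuous_intros)
  then have "continuous_on UNIV (\<lambda>y. (\<lambda>z. shell_weight (snd z) *\<^sub>R g (snd z)) (0::real, y))"
    by (rule continuous_on_compose2) (auto intro!: continuous_intros)
  then show ?thesis by simp
qed

lemma weighted_integrable_on:
  fixes g :: "'a::euclidean_space \<Rightarrow> 'c::euclidean_space"
  assumes "continuous_on closed_shell g"
  shows "(\<lambda>y. shell_weight y *\<^sub>R g y) integrable_on cbox (- One) One"
  by (intro integrable_continuous continuous_on_subset[OF weighted_continuous_UNIV[OF assms]]) auto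

lemma integral_weighted_real:
  fixes g :: "'a::euclidean_space \<Rightarrow> real"
  assumes g: "continuous_on (- {0}) g"
  shows "integral (cbox (- One) One) (\<lambda>y. shell_weight y * g y) = (LINT y|lborel. shell_weight y * g y)"
proof -
  have "integral (cbox (- One) One) (\<lambda>y. shell_weight y * g y)
      = integral UNIV (\<lambda>y. if y \<in> cbox (- One) One then shell_weight y * g y else 0)"
    by (rule integral_restrict_UNIV[symmetric])
  also have "(\<lambda>y. if y \<in> cbox (- One) One then shell_weight y * g y else 0) = (\<lambda>y. shell_weight y * g y)"
  proof
    fix y :: 'a
    have "shell_weight y = 0" if "y \<notin> cbox (- One) One"
    proof -
      have "y \<notin> cball 0 1" using that cball_subset_cbox_One by blast
      then show ?thesis by (intro shell_weight_zero) auto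
    qed
    then show "(if y \<in> cbox (- One) One then shell_weight y * g y else 0) = shell_weight y * g y" by simp
  qed
  also have "integral UNIV (\<lambda>y. shell_weight y * g y) = (LINT y|lborel. shell_weight y * g y)"
    using integral_lborel[OF weighted_integrable[OF g]] by simp
  finally show ?thesis .
qed

lemma shell_int_of_real:
  assumes g: "continuous_on (- {0}) g"
  shows "shell_int (\<lambda>y. of_real (g y)) = of_real (LINT y|lborel. shell_weight y * g y)"
proof -
  have "shell_int (\<lambda>y. of_real (g y)) = integral (cbox (- One) One) (\<lambda>y. complex_of_real (shell_weight y * g y))"
    by (simp add: shell_int_def scaleR_conv_of_real)
  also have "\<dots> = of_real (integral (cbox (- One) One) (\<lambda>y. shell_weight y * g y))"
  proof -
    have "continuous_on closed_shell g" by (rule continuous_on_subset[OF g]) auto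
    from weighted_integrable_on[OF this]
    show ?thesis using integral_linear[OF _ bounded_linear_of_real] by (fastforce simp: o_def)
  qed
  finally show ?thesis by (simp add: integral_weighted_real[OF g])
qed

lemma Re_shell_int:
  assumes g: "continuous_on (- {0}) g"
  shows "Re (shell_int g) = (LINT y|lborel. shell_weight y * Re (g y))"
    and "Im (shell_int g) = (LINT y|lborel. shell_weight y * Im (g y))"
proof -
  have "continuous_on closed_shell g" by (rule continuous_on_subset[OF g]) auto
  then have int: "(\<lambda>y. shell_weight y *\<^sub>R g y) integrable_on cbox (- One) One"
    by (rule weighted_integrable_on)
  have "continuous_on (- {0}) (\<lambda>y. Re (g y))" "continuous_on (- {0}) (\<lambda>y. Im (g y))"
    using g by (auto intro!: continuous_intros)
  note * = this[THEN integral_weighted_real]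
  show "Re (shell_int g) = (LINT y|lborel. shell_weight y * Re (g y))"
    using integral_linear[OF int bounded_linear_Re] *(1) by (simp add: shell_int_def o_def)
  show "Im (shell_int g) = (LINT y|lborel. shell_weight y * Im (g y))"
    using integral_linear[OF int bounded_linear_Im] *(2) by (simp add: shell_int_def o_def)
qed

lemma shell_int_holomorphic:
  fixes G G' :: "complex \<times> 'a::euclidean_space \<Rightarrow> complex"
  assumes S: "open S" and G: "continuous_on (S \<times> closed_shell) G"
    and G': "continuous_on (S \<times> closed_shell) G'"
    and d: "\<And>t y. t \<in> S \<Longrightarrow> y \<in> closed_shell \<Longrightarrow> ((\<lambda>t. G (t, y)) has_field_derivative G' (t, y)) (at t)"
  shows "(\<lambda>t. shell_int (\<lambda>y. G (t, y))) holomorphic_on S"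
proof -
  \<comment> \<open>Balls are convex, as the Leibniz rule requires of the parameter set; holomorphy
    is local.\<close>
  have "(\<lambda>t. shell_int (\<lambda>y. G (t, y))) holomorphic_on ball t0 e" if e: "ball t0 e \<subseteq> S" for t0 e
    unfolding shell_int_def
  proof (rule leibniz_rule_holomorphic[where fx = "\<lambda>t y. shell_weight y *\<^sub>R G' (t, y)"])
    fix t y assume t: "t \<in> ball t0 e"
    have "((\<lambda>t. shell_weight y *\<^sub>R G (t, y)) has_field_derivative shell_weight y *\<^sub>R G' (t, y)) (at t)"
    proof (cases "y \<in> closed_shell")
      case True
      then have "((\<lambda>t. of_real (shell_weight y) * G (t, y)) has_field_derivative
          of_real (shell_weight y) * G' (t, y)) (at t)"
        using d[of t y] t e by (intro DERIV_cmult) auto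
      then show ?thesis by (simp add: scaleR_conv_of_real)
    next
      case False
      then have "shell_weight y = 0" by (intro shell_weight_zero) auto
      then show ?thesis by simp
    qed
    then show "((\<lambda>t. shell_weight y *\<^sub>R G (t, y)) has_field_derivative shell_weight y *\<^sub>R G' (t, y))
        (at t within ball t0 e)" by (rule has_field_derivative_at_within)
  next
    fix t assume "t \<in> ball t0 e"
    then have "continuous_on closed_shell (\<lambda>y. G (t, y))"
      using e by (intro continuous_on_compose2[OF G] continuous_intros) auto
    then show "(\<lambda>y. shell_weight y *\<^sub>R G (t, y)) integrable_on cbox (- One) One"
      by (rule weighted_integrable_on)
  next
    have "continuous_on (ball t0 e \<times> UNIV) (\<lambda>z. shell_weight (snd z) *\<^sub>R G' z)"
      by (rule continuous_on_weighted_closed) (rule continuous_on_subset[OF G'], use e in auto)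
    then show "continuous_on (ball t0 e \<times> cbox (- One) One) (\<lambda>(t, y). shell_weight y *\<^sub>R G' (t, y))"
      by (rule continuous_on_subset[THEN continuous_on_eq]) (auto simp: case_prod_beta)
  qed simp
  then show ?thesis
    unfolding holomorphic_on_def using S
    by (metis (no_types, lifting) at_within_open centre_in_ball open_ball openE)
qed

text \<open>C depends on P alone, so all moments inherit the order of growth of W.\<close>

lemma shell_int_bound:
  fixes P :: "'a::euclidean_space \<Rightarrow> real"
  assumes P: "continuous_on UNIV P"
  obtains C where "\<And>g B. continuous_on closed_shell g \<Longrightarrow> (\<And>y. y \<in> closed_shell \<Longrightarrow> cmod (g y) \<le> B) \<Longrightarrow>
    cmod (shell_int (\<lambda>y. of_real (P y) * g y)) \<le> C * B"
proof
  fix g :: "'a \<Rightarrow> complex" and B :: real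
  assume g: "continuous_on closed_shell g" and B: "\<And>y. y \<in> closed_shell \<Longrightarrow> cmod (g y) \<le> B"
  let ?I = "cbox (- One) One :: 'a set"
  have Ps: "continuous_on closed_shell P" by (rule continuous_on_subset[OF P]) auto
  have c: "continuous_on closed_shell (\<lambda>y. \<bar>P y\<bar>)" "continuous_on closed_shell (\<lambda>y. of_real (P y) * g y)"
    by (intro continuous_intros Ps g)+
  have "cmod (shell_int (\<lambda>y. of_real (P y) * g y)) \<le> integral ?I (\<lambda>y. shell_weight y * \<bar>P y\<bar> * B)"
    unfolding shell_int_def
  proof (rule integral_norm_bound_integral)
    show "(\<lambda>y. shell_weight y *\<^sub>R (of_real (P y) * g y)) integrable_on ?I"
      by (rule weighted_integrable_on[OF c(2)])
    show "(\<lambda>y. shell_weight y * \<bar>P y\<bar> * B) integrable_on ?I"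
      using integrable_on_mult_left[OF weighted_integrable_on[OF c(1)], of B] by simp
    show "cmod (shell_weight y *\<^sub>R (of_real (P y) * g y)) \<le> shell_weight y * \<bar>P y\<bar> * B" for y
    proof (cases "y \<in> closed_shell")
      case True
      then show ?thesis
        using B[OF True] shell_weight_nonneg[of y]
        by (auto simp: norm_mult mult.assoc intro!: mult_left_mono)
    next
      case False
      then have "shell_weight y = 0" by (intro shell_weight_zero) auto
      then show ?thesis by simp
    qed
  qed
  also have "\<dots> = integral ?I (\<lambda>y. shell_weight y * \<bar>P y\<bar>) * B" by simp
  finally show "cmod (shell_int (\<lambda>y. of_real (P y) * g y)) \<le> integral ?I (\<lambda>y. shell_weight y * \<bar>P y\<bar>) * B" .
qed

lemma shell_int_orthogonal_zero:
  fixes g :: "'a::euclidean_space \<Rightarrow> complex"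
  assumes g: "continuous_on (- {0}) g"
    and orth: "\<And>P. real_polynomial_function P \<Longrightarrow> shell_int (\<lambda>y. of_real (P y) * g y) = 0"
    and y: "1/2 < norm y" "norm y < 1"
  shows "g y = 0"
proof (rule complex_eqI)
  have cont: "continuous_on (- {0}) (\<lambda>y. of_real (P y) * g y)" if "real_polynomial_function P" for P
  proof -
    have "continuous_on UNIV P"
      using that by (simp add: continuous_at_imp_continuous_on continuous_real_polymonial_function)
    then have "continuous_on (- {0}) P" by (rule continuous_on_subset) auto
    then show ?thesis by (intro continuous_intros g)
  qed
  show "Re (g y) = Re 0"
    using weighted_orthogonal_zero[of "\<lambda>y. Re (g y)", OF _ _ y] g Re_shell_int(1)[OF cont] orth
    by (auto intro!: continuous_intros)
  show "Im (g y) = Im 0"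
    using weighted_orthogonal_zero[of "\<lambda>y. Im (g y)", OF _ _ y] g Re_shell_int(2)[OF cont] orth
    by (auto intro!: continuous_intros)
qed

lemma cut_vol_translate:
  fixes D :: "'a::euclidean_space set"
  assumes "D \<in> sets borel"
  shows "cut_vol ((\<lambda>x. x - a) ` D) y t = cut_vol D y (y \<bullet> a + t)"
proof -
  have *: "{x \<in> (\<lambda>x. x - a) ` D. y \<bullet> x \<le> t} = (+) (- a) ` {x\<in>D. y \<bullet> x \<le> y \<bullet> a + t}"
    by (auto simp: image_iff inner_diff_right algebra_simps)
  have "{x\<in>D. y \<bullet> x \<le> y \<bullet> a + t} = D \<inter> {x. y \<bullet> x \<le> y \<bullet> a + t}" by auto
  then have m: "{x\<in>D. y \<bullet> x \<le> y \<bullet> a + t} \<in> sets borel" using assms by simp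
  have "(+) (- a) ` {x\<in>D. y \<bullet> x \<le> y \<bullet> a + t} = (+) a -` {x\<in>D. y \<bullet> x \<le> y \<bullet> a + t}"
    by (auto simp: image_iff algebra_simps)
  then have "measure lborel ((+) (- a) ` {x\<in>D. y \<bullet> x \<le> y \<bullet> a + t})
      = measure (distr lborel borel ((+) a)) {x\<in>D. y \<bullet> x \<le> y \<bullet> a + t}"
    using m by (simp add: measure_distr)
  then show ?thesis by (simp add: cut_vol_def * lborel_distr_plus)
qed

text \<open>The bound M is the same for all y; it fixes the number of derivatives in
  \<open>moment_form\<close>.\<close>

definition volume_polynomial :: "'a::euclidean_space set \<Rightarrow> nat \<Rightarrow> bool" where
  "volume_polynomial D M \<longleftrightarrow>
     (\<forall>y. y \<noteq> 0 \<longrightarrow> (\<exists>q. degree q \<le> M \<and> (\<forall>x\<in>D. cut_vol D y (y \<bullet> x) = poly q (y \<bullet> x))))"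

text \<open>The shell moments of the continued volume function are polynomials near \<open>0\<close>, hence
  everywhere, and their degrees are bounded by the order of growth of the roots of \<open>Q\<close>, which
  does not depend on the moment.\<close>

theorem free_imp_volume_polynomial:
  fixes D :: "(real^'n::finite) set"
  assumes odd: "odd CARD('n)" and D: "open D" "connected D" "bounded D" "D \<noteq> {}"
    and free: "free_of_real_singularities D"
  shows "\<exists>M. volume_polynomial D M"
proof -
  obtain Q :: "'n csphere poly poly" where deg: "degree Q > 0" and ann: "annihilates_vol Q D"
    and lc: "\<And>\<xi>. \<xi> \<in> sphere 0 1 \<Longrightarrow> csphere_apply (lead_coeff (Res Q)) \<xi> \<noteq> 0"
    and res: "\<And>\<xi> t. \<xi> \<in> sphere 0 1 \<Longrightarrow> eval_z (Res Q) \<xi> (of_real t) \<noteq> 0"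
    using free unfolding free_of_real_singularities_def by (auto simp: Suc_le_eq)
  obtain a where a: "a \<in> D" using D(4) by blast
  obtain r where r: "r > 0" "ball a r \<subseteq> D" using D(1) a open_contains_ball by blast
  have Db: "D \<in> sets borel" using D(1) by simp
  let ?D0 = "(\<lambda>x. x - a) ` D" and ?O = "branch_times Q a"
  have "?D0 = (+) (- a) ` D" by auto
  then have D0: "?D0 \<in> sets borel" "bounded ?D0"
    using D open_translation[of D "- a"] bounded_translation[of D "- a"] by simp_all
  have rD0: "ball 0 r \<subseteq> ?D0"
  proof
    fix x :: "real^'n" assume "x \<in> ball 0 r"
    then have "a + x \<in> D" using r(2) by (auto simp: dist_norm subset_iff)
    then show "x \<in> ?D0" by (auto intro!: image_eqI[of _ _ "a + x"])
  qed
  obtain W where W: "continuous_on (branch_dom Q a) W"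
    and root: "\<And>y t. (y, t) \<in> branch_dom Q a \<Longrightarrow>
      poly (poly_at Q (fst (ray_pt a y t)) (snd (ray_pt a y t))) (W (y, t)) = 0"
    and WV: "\<And>y t x. y \<noteq> 0 \<Longrightarrow> x \<in> D \<Longrightarrow> y \<bullet> x = y \<bullet> a + t \<Longrightarrow>
      W (y, of_real t) = of_real (cut_vol D y (y \<bullet> a + t))"
    using branch_extension[OF deg ann res D(1-3) a] by blast
  \<comment> \<open>The point a + (t / |y|^2) y lies on the hyperplane at time t, and in the ball
    around a since |t| < r/2 \<le> r |y|.\<close>
  have WV0: "W (y, of_real t) = of_real (cut_vol ?D0 y t)" if y: "1/2 \<le> norm y" and t: "\<bar>t\<bar> < r / 2" for y t
  proof -
    have y0: "y \<noteq> 0" using y by auto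
    let ?x = "a + (t / (norm y)\<^sup>2) *\<^sub>R y"
    have "r / 2 \<le> r * norm y" using mult_left_mono[OF y, of r] r(1) by simp
    then have "\<bar>t\<bar> < r * norm y" using t by linarith
    then have "norm ((t / (norm y)\<^sup>2) *\<^sub>R y) < r"
      using y0 by (simp add: power2_eq_square field_simps)
    then have "?x \<in> D" using r(2) by (auto simp: dist_norm subset_iff)
    moreover have "y \<bullet> ?x = y \<bullet> a + t" using y0 by (simp add: inner_add_right power2_norm_eq_inner)
    ultimately show ?thesis using WV[OF y0] by (simp add: cut_vol_translate[OF Db])
  qed
  have WO: "continuous_on (?O \<times> closed_shell) (\<lambda>z. W (snd z, fst z))"
    by (rule continuous_on_compose2[OF W]) (auto intro!: continuous_intros simp: branch_times_def)
  have W'O: "continuous_on (?O \<times> closed_shell) (\<lambda>z. branch_deriv Q a W (snd z, fst z))"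
    by (rule continuous_on_compose2[OF branch_deriv_continuous[OF deg W root]])
      (auto intro!: continuous_intros simp: branch_times_def)
  have Wreal: "continuous_on (- {0}) (\<lambda>y. W (y, of_real t))" for t
    by (rule continuous_on_compose2[OF W]) (auto intro!: continuous_intros branch_dom_real res)
  obtain C d where C: "C \<ge> 0" and growth: "\<And>\<xi> t w. \<xi> \<in> sphere 0 1 \<Longrightarrow>
      poly (poly_at Q \<xi> (of_real t)) w = 0 \<Longrightarrow> cmod w \<le> C * (1 + \<bar>t\<bar>) ^ d"
    using poly_at_root_growth[OF deg lc res] by blast
  \<comment> \<open>The constant comes from |s| \<le> |a| + 2 |t| for the normalized height s, as
    |y| \<ge> 1/2.\<close>
  have Wgrowth: "cmod (W (y, of_real t)) \<le> C * (2 + norm a) ^ d * (1 + \<bar>t\<bar>) ^ d" if y: "y \<in> closed_shell" for y t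
  proof -
    have y': "y \<noteq> 0" "1/2 \<le> norm y" using y by auto
    let ?s = "(y \<bullet> a + t) / norm y"
    have "poly (poly_at Q (sgn y) (of_real ?s)) (W (y, of_real t)) = 0"
      using root[OF branch_dom_real[OF res y'(1), of t]] by (simp add: ray_pt_def)
    then have "cmod (W (y, of_real t)) \<le> C * (1 + \<bar>?s\<bar>) ^ d"
      using y' by (intro growth) (auto simp: norm_sgn)
    also have "\<dots> \<le> C * ((2 + norm a) * (1 + \<bar>t\<bar>)) ^ d"
    proof (intro mult_left_mono power_mono C)
      have "\<bar>y \<bullet> a\<bar> \<le> norm y * norm a" by (rule Cauchy_Schwarz_ineq2)
      then have "\<bar>y \<bullet> a + t\<bar> / norm y \<le> (norm y * norm a + \<bar>t\<bar>) / norm y"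
        by (intro divide_right_mono) auto
      also have "\<dots> = norm a + \<bar>t\<bar> / norm y" using y'(1) by (simp add: add_divide_distrib)
      finally have "\<bar>?s\<bar> \<le> norm a + \<bar>t\<bar> / norm y" by simp
      moreover have "\<bar>t\<bar> / norm y \<le> 2 * \<bar>t\<bar>"
        using divide_left_mono[of "1/2" "norm y" "\<bar>t\<bar>"] y' by auto
      ultimately have "1 + \<bar>?s\<bar> \<le> 1 + norm a + 2 * \<bar>t\<bar>" by linarith
      also have "\<dots> \<le> (2 + norm a) * (1 + \<bar>t\<bar>)" by (simp add: algebra_simps)
      finally show "1 + \<bar>?s\<bar> \<le> (2 + norm a) * (1 + \<bar>t\<bar>)" .
    qed simp
    finally show ?thesis by (simp add: power_mult_distrib mult.assoc)
  qed
  \<comment> \<open>Nodes in [0, r/4), where W is the true volume; their number d + 1 is dictated by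
    the growth order d.\<close>
  define x where "x j = r / 4 * (real j / real (Suc d))" for j
  have inj: "inj_on x {..d}" using r by (auto simp: inj_on_def x_def)
  have x: "\<bar>x j\<bar> < r / 2" if "j \<le> d" for j
  proof -
    have "r / 4 * (real j / real (Suc d)) \<le> r / 4 * 1" using that r by (intro mult_left_mono) auto
    then have "x j \<le> r / 4" unfolding x_def by linarith
    moreover have "0 \<le> x j" using r by (simp add: x_def)
    ultimately show ?thesis using r by linarith
  qed
  let ?L = "\<lambda>j. poly (lagrange_basis x d j)"
  \<comment> \<open>The nodes and weights are the same for all P, so the formula can be transferred
    from the moments to W.\<close>
  have moment: "shell_int (\<lambda>y. of_real (P y) * W (y, of_real t)) =
      (\<Sum>j\<le>d. of_real (?L j t) * shell_int (\<lambda>y. of_real (P y) * W (y, of_real (x j))))"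
    if P: "real_polynomial_function P" for P t
  proof -
    have Pc: "continuous_on S P" for S
      using P by (simp add: continuous_at_imp_continuous_on continuous_real_polymonial_function)
    define F where "F z = shell_int (\<lambda>y. of_real (P y) * W (y, z))" for z
    have "(\<lambda>z. shell_int (\<lambda>y. (\<lambda>v. of_real (P (snd v)) * W (snd v, fst v)) (z, y))) holomorphic_on ?O"
    proof (rule shell_int_holomorphic[OF open_branch_times])
      show "continuous_on (?O \<times> closed_shell) (\<lambda>v. complex_of_real (P (snd v)) * W (snd v, fst v))"
        by (intro continuous_intros WO continuous_on_compose2[OF Pc]) auto
      show "continuous_on (?O \<times> closed_shell) (\<lambda>v. complex_of_real (P (snd v)) * branch_deriv Q a W (snd v, fst v))"
        by (intro continuous_intros W'O continuous_on_compose2[OF Pc]) auto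
      show "((\<lambda>t. complex_of_real (P (snd (t, y))) * W (snd (t, y), fst (t, y))) has_field_derivative
          complex_of_real (P (snd (t, y))) * branch_deriv Q a W (snd (t, y), fst (t, y))) (at t)"
        if "t \<in> ?O" "y \<in> closed_shell" for t y
        using branch_has_field_derivative[OF deg W root that(2,1)] by (auto intro!: DERIV_cmult)
    qed
    then have holF: "F holomorphic_on ?O" by (simp add: F_def[abs_def])
    \<comment> \<open>The polynomial factor \<open>shell_poly\<close> converts the weighted average
      into a plain average over the shell, as treated by \<open>shell_moment_poly\<close>.\<close>
    have rpf: "real_polynomial_function (\<lambda>y. P y * shell_poly y)"
      by (intro real_polynomial_function.intros(4) P real_polynomial_function_shell_poly)
    obtain q where q: "\<And>t. \<bar>t\<bar> < r / 2 \<Longrightarrow>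
        (LINT y|lborel. indicator shell y * (P y * shell_poly y * cut_vol ?D0 y t)) = poly q t"
      using shell_moment_poly[OF _ rpf D0 r(1) rD0] odd by auto
    define qc where "qc = map_poly complex_of_real q"
    have qc: "poly qc (of_real t) = of_real (poly q t)" for t
      by (simp add: qc_def poly_map_poly_altdef poly_altdef)
    have near: "F (of_real t) = poly qc (of_real t)" if t: "\<bar>t\<bar> < r / 2" for t
    proof -
      have "F (of_real t) = shell_int (\<lambda>y. of_real (P y * cut_vol ?D0 y t))"
        unfolding F_def shell_int_def
      proof (rule integral_cong)
        fix y
        show "shell_weight y *\<^sub>R (of_real (P y) * W (y, of_real t)) = shell_weight y *\<^sub>R of_real (P y * cut_vol ?D0 y t)"
          using WV0[OF _ t, of y] shell_weight_zero[of y] by (cases "1/2 \<le> norm y") auto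
      qed
      also have "\<dots> = of_real (LINT y|lborel. shell_weight y * (P y * cut_vol ?D0 y t))"
      proof (rule shell_int_of_real)
        have "continuous_on (- {0}) (\<lambda>y. (\<lambda>z. cut_vol ?D0 (fst z) (snd z)) (y, t))"
          by (rule continuous_on_compose2[OF cut_vol_continuous[OF D0]]) (auto intro!: continuous_intros)
        then show "continuous_on (- {0}) (\<lambda>y. P y * cut_vol ?D0 y t)" by (intro continuous_intros Pc) simp
      qed
      also have "(LINT y|lborel. shell_weight y * (P y * cut_vol ?D0 y t)) = poly q t"
        unfolding q[OF t, symmetric] shell_weight_eq[symmetric] by (simp add: mult_ac)
      finally show ?thesis by (simp add: qc)
    qed
    \<comment> \<open>Identity theorem: both sides are holomorphic on the connected open set
      \<open>?O\<close> and agree on a real interval around 0.\<close>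
    have all: "F z = poly qc z" if z: "z \<in> ?O" for z
    proof -
      have "F z - poly qc z = 0"
      proof (rule analytic_continuation[where f = "\<lambda>z. F z - poly qc z" and S = ?O
            and U = "of_real ` {-(r/2)<..<r/2}" and \<xi> = 0])
        show "(\<lambda>z. F z - poly qc z) holomorphic_on ?O" by (intro holomorphic_intros holF)
        show "open ?O" by (rule open_branch_times)
        show "connected ?O" by (rule connected_branch_times[OF res])
        show "complex_of_real ` {- (r / 2)<..<r / 2} \<subseteq> ?O" using branch_times_real[OF res] by auto
        show "0 \<in> ?O" using branch_times_real[OF res, where t = 0] by simp
        show "0 islimpt complex_of_real ` {- (r / 2)<..<r / 2}"
        proof (unfold islimpt_approachable, intro allI impI)
          fix e :: real assume e: "0 < e"
          let ?t = "min (e / 2) (r / 4)"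
          show "\<exists>x'\<in>complex_of_real ` {- (r / 2)<..<r / 2}. x' \<noteq> 0 \<and> dist x' 0 < e"
            using e r(1) by (intro bexI[of _ "of_real ?t"]) (auto simp: min_def)
        qed
        show "F z - poly qc z = 0" if "z \<in> complex_of_real ` {- (r / 2)<..<r / 2}" for z
          using that near by auto
      qed (rule z)
      then show ?thesis by simp
    qed
    have real: "F (of_real t) = poly qc (of_real t)" for t by (rule all[OF branch_times_real[OF res]])
    \<comment> \<open>Growth of order d along the real axis, with d independent of P, bounds the
      degree.\<close>
    have "degree qc \<le> d"
    proof -
      obtain B where B: "\<And>g E. continuous_on closed_shell g \<Longrightarrow> (\<And>y. y \<in> closed_shell \<Longrightarrow> cmod (g y) \<le> E) \<Longrightarrow>
          cmod (shell_int (\<lambda>y. of_real (P y) * g y)) \<le> B * E"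
        using shell_int_bound[OF Pc] by blast
      have "cmod (poly qc (of_real t)) \<le> B * (C * (2 + norm a) ^ d) * (1 + t) ^ d" if "t \<ge> 1" for t
      proof -
        have "continuous_on closed_shell (\<lambda>y. W (y, of_real t))"
          by (rule continuous_on_subset[OF Wreal]) auto
        from B[OF this Wgrowth] show ?thesis using that by (simp add: real[symmetric] F_def mult_ac)
      qed
      then show ?thesis by (rule degree_le_of_growth)
    qed
    from lagrange_interpolation[OF inj this, of t]
    show ?thesis by (simp add: real[symmetric] F_def)
  qed
  \<comment> \<open>The difference of the two sides is orthogonal to all polynomials with respect to
    the weight.\<close>
  have interp: "W (y, of_real t) = (\<Sum>j\<le>d. of_real (?L j t) * W (y, of_real (x j)))"
    if y: "1/2 < norm y" "norm y < 1" for y t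
  proof -
    let ?g = "\<lambda>y. W (y, of_real t) - (\<Sum>j\<le>d. of_real (?L j t) * W (y, of_real (x j)))"
    have "?g y = 0"
    proof (rule shell_int_orthogonal_zero[OF _ _ y])
      show "continuous_on (- {0}) ?g" by (intro continuous_intros Wreal)
      fix P :: "real^'n \<Rightarrow> real" assume P: "real_polynomial_function P"
      have int: "(\<lambda>y. shell_weight y *\<^sub>R (of_real (P y) * W (y, of_real s))) integrable_on cbox (- One) One" for s
        using P by (intro weighted_integrable_on continuous_intros continuous_on_subset[OF Wreal]
            continuous_at_imp_continuous_on ballI continuous_real_polymonial_function) auto
      have "shell_int (\<lambda>y. of_real (P y) * ?g y) = integral (cbox (- One) One) (\<lambda>y.
          shell_weight y *\<^sub>R (of_real (P y) * W (y, of_real t)) -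
          (\<Sum>j\<le>d. of_real (?L j t) * (shell_weight y *\<^sub>R (of_real (P y) * W (y, of_real (x j))))))"
        unfolding shell_int_def
        by (intro integral_cong) (simp add: algebra_simps scaleR_sum_right sum_distrib_left scaleR_conv_of_real)
      also have "\<dots> = shell_int (\<lambda>y. of_real (P y) * W (y, of_real t)) -
          (\<Sum>j\<le>d. of_real (?L j t) * shell_int (\<lambda>y. of_real (P y) * W (y, of_real (x j))))"
        unfolding shell_int_def
        by (intro integral_unique has_integral_diff has_integral_sum has_integral_mult_right
            integrable_integral int) auto
      also have "\<dots> = 0" using moment[OF P, of t] by simp
      finally show "shell_int (\<lambda>y. of_real (P y) * ?g y) = 0" .
    qed
    then show ?thesis by simp
  qed
  have "\<exists>q. degree q \<le> d \<and> (\<forall>x\<in>D. cut_vol D y (y \<bullet> x) = poly q (y \<bullet> x))" if y: "y \<noteq> 0" for y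
  proof -
    \<comment> \<open>Rescales y to length 3/4, inside the open shell.\<close>
    define c where "c = 3 / (4 * norm y)"
    have c: "c > 0" using y by (simp add: c_def)
    define z where "z = c *\<^sub>R y"
    have nz: "norm z = 3/4" using y by (simp add: z_def c_def)
    have z0: "z \<noteq> 0" using nz by auto
    define p where "p = (\<Sum>j\<le>d. Polynomial.smult (cut_vol ?D0 z (x j)) (lagrange_basis x d j))"
    have p: "cut_vol D z (z \<bullet> a + t) = poly p t" if "x0 \<in> D" "z \<bullet> x0 = z \<bullet> a + t" for t x0
    proof -
      have "complex_of_real (cut_vol D z (z \<bullet> a + t)) = W (z, of_real t)"
        using WV[OF z0 that] by simp
      also have "\<dots> = (\<Sum>j\<le>d. of_real (?L j t) * W (z, of_real (x j)))"
        by (rule interp) (simp_all add: nz)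
      also have "\<dots> = (\<Sum>j\<le>d. of_real (?L j t) * of_real (cut_vol ?D0 z (x j)))"
        using x nz by (intro sum.cong refl) (simp add: WV0)
      also have "\<dots> = of_real (poly p t)" by (simp add: p_def poly_sum mult.commute)
      finally show ?thesis by (simp only: of_real_eq_iff)
    qed
    \<comment> \<open>The height s in direction y is the time c s - z \<bullet> a in direction
      z.\<close>
    let ?q = "pcompose p [:- (z \<bullet> a), c:]"
    have "degree p \<le> d" unfolding p_def
      by (intro degree_sum_le) (auto intro: le_trans[OF degree_smult_le] degree_lagrange_basis)
    then have "degree ?q \<le> d" using degree_pcompose_le[of p "[:- (z \<bullet> a), c:]"] c by simp
    moreover have "cut_vol D y (y \<bullet> x) = poly ?q (y \<bullet> x)" if "x \<in> D" for x
    proof -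
      have "cut_vol D y (y \<bullet> x) = cut_vol D z (c * (y \<bullet> x))"
        unfolding z_def using cut_vol_scale[OF c] by metis
      also have "\<dots> = poly p (c * (y \<bullet> x) - z \<bullet> a)"
        using p[OF that, of "c * (y \<bullet> x) - z \<bullet> a"] by (simp add: z_def)
      finally show ?thesis by (simp add: poly_pcompose algebra_simps)
    qed
    ultimately show ?thesis by blast
  qed
  then show ?thesis unfolding volume_polynomial_def by blast
qed

section \<open>Moments and support functions\<close>

definition hi :: "'a::euclidean_space set \<Rightarrow> 'a \<Rightarrow> real" where
  "hi D y = Sup ((\<bullet>) y ` D)"

definition lo :: "'a::euclidean_space set \<Rightarrow> 'a \<Rightarrow> real" where
  "lo D y = Inf ((\<bullet>) y ` D)"

lemma bdd_inner_image:
  assumes "bounded (D :: 'a::euclidean_space set)"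
  shows "bdd_above ((\<bullet>) y ` D)" "bdd_below ((\<bullet>) y ` D)"
proof -
  have "bounded ((\<bullet>) y ` D)"
    by (rule bounded_linear_image[OF assms bounded_linear_inner_right])
  then show "bdd_above ((\<bullet>) y ` D)" "bdd_below ((\<bullet>) y ` D)"
    by (auto intro: bounded_imp_bdd_above bounded_imp_bdd_below)
qed

lemma hi_upper: "bounded D \<Longrightarrow> x \<in> D \<Longrightarrow> y \<bullet> x \<le> hi D y"
  unfolding hi_def by (intro cSup_upper bdd_inner_image) auto

lemma hi_least: "D \<noteq> {} \<Longrightarrow> (\<And>x. x \<in> D \<Longrightarrow> y \<bullet> x \<le> z) \<Longrightarrow> hi D y \<le> z"
  unfolding hi_def by (intro cSup_least) auto

lemma lo_eq: "lo D y = - hi D (- y)"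
proof -
  have "(\<bullet>) (- y) ` D = uminus ` (\<bullet>) y ` D" by (auto simp: image_image)
  then show ?thesis by (simp add: hi_def lo_def Inf_real_def image_image)
qed

lemma hi_scale:
  assumes "bounded D" "D \<noteq> {}" "c \<ge> 0"
  shows "hi D (c *\<^sub>R y) = c * hi D y"
proof (cases "c = 0")
  case True
  then show ?thesis using assms(2) by (simp add: hi_def image_constant_conv)
next
  case False
  with assms have c: "c > 0" by simp
  show ?thesis
  proof (rule antisym)
    show "hi D (c *\<^sub>R y) \<le> c * hi D y"
      using c by (intro hi_least assms) (simp add: hi_upper[OF assms(1)])
    have "hi D y \<le> hi D (c *\<^sub>R y) / c"
      using c hi_upper[OF assms(1), of _ "c *\<^sub>R y"] by (intro hi_least assms) (simp add: field_simps)
    then show "c * hi D y \<le> hi D (c *\<^sub>R y)" using c by (simp add: field_simps)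
  qed
qed

lemma lo_scale:
  assumes "bounded D" "D \<noteq> {}" "c \<ge> 0"
  shows "lo D (c *\<^sub>R y) = c * lo D y"
  using hi_scale[OF assms, of "- y"] by (simp add: lo_eq)

lemma hi_lipschitz:
  assumes "bounded D" "D \<noteq> {}"
  obtains K where "K \<ge> 0" "\<And>y z. \<bar>hi D y - hi D z\<bar> \<le> K * norm (y - z)" "\<And>y. \<bar>hi D y\<bar> \<le> K * norm y"
proof -
  obtain K where K: "K > 0" "\<And>x. x \<in> D \<Longrightarrow> norm x \<le> K"
    using assms(1) by (auto simp: bounded_pos)
  have le: "hi D y \<le> hi D z + K * norm (y - z)" for y z
  proof (rule hi_least[OF assms(2)])
    fix x assume x: "x \<in> D"
    have "y \<bullet> x = z \<bullet> x + (y - z) \<bullet> x" by (simp add: inner_diff_left)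
    also have "(y - z) \<bullet> x \<le> norm (y - z) * norm x" by (rule norm_cauchy_schwarz)
    also have "\<dots> \<le> norm (y - z) * K" using K(2)[OF x] by (intro mult_left_mono) auto
    finally show "y \<bullet> x \<le> hi D z + K * norm (y - z)"
      using hi_upper[OF assms(1) x, of z] by (simp add: mult.commute)
  qed
  have lip: "\<bar>hi D y - hi D z\<bar> \<le> K * norm (y - z)" for y z
    using le[of y z] le[of z y] by (simp add: norm_minus_commute abs_le_iff)
  moreover have "hi D 0 = 0" using hi_scale[OF assms, of 0 0] by simp
  ultimately show ?thesis using that[of K] K(1) lip[of _ 0] by simp
qed

lemma lo_less_inner_less_hi:
  assumes "open D" "bounded D" "y \<noteq> 0" "x \<in> D"
  shows "lo D y < y \<bullet> x" "y \<bullet> x < hi D y"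
proof -
  have *: "z \<bullet> x < hi D z" if z: "z \<noteq> 0" for z
  proof -
    obtain e where e: "e > 0" "ball x e \<subseteq> D" using assms by (meson open_contains_ball)
    let ?x = "x + (e / (2 * norm z)) *\<^sub>R z"
    have "?x \<in> ball x e" using e z by (simp add: dist_norm)
    then have "z \<bullet> ?x \<le> hi D z" using e by (intro hi_upper assms) auto
    moreover have "z \<bullet> ?x = z \<bullet> x + e / 2 * norm z"
      using z by (simp add: inner_add_right dot_square_norm power2_eq_square)
    ultimately show ?thesis using e z by (smt (verit) mult_pos_pos zero_less_norm_iff half_gt_zero)
  qed
  show "y \<bullet> x < hi D y" by (rule *[OF assms(3)])
  show "lo D y < y \<bullet> x" using *[of "- y"] assms(3) by (simp add: lo_eq)
qed

lemma inner_value_attained: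
  assumes "connected D" "D \<noteq> {}" "bounded D" "lo D y < t" "t < hi D y"
  shows "\<exists>x\<in>D. y \<bullet> x = t"
proof -
  obtain x1 where x1: "x1 \<in> D" "t < y \<bullet> x1"
    using less_cSup_iff[of "(\<bullet>) y ` D" t] assms bdd_inner_image[of D y] by (auto simp: hi_def)
  obtain x2 where x2: "x2 \<in> D" "y \<bullet> x2 < t"
    using cInf_less_iff[of "(\<bullet>) y ` D" t] assms bdd_inner_image[of D y] by (auto simp: lo_def)
  have "connected ((\<bullet>) y ` D)" by (intro connected_continuous_image continuous_intros assms)
  then have "t \<in> (\<bullet>) y ` D"
    using x1 x2 connectedD_interval[of "(\<bullet>) y ` D" "y \<bullet> x2" "y \<bullet> x1" t] by auto
  then show ?thesis by auto
qed

lemma integral_pderiv_interval: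
  fixes p F :: "real poly"
  assumes "a \<le> b" "pderiv F = p"
  shows "(LINT s|lborel. indicator {a..b} s * poly p s) = poly F b - poly F a"
proof -
  have "pderiv (F - antideriv p) = 0" by (simp add: pderiv_diff pderiv_antideriv assms(2))
  then obtain c where "F - antideriv p = [:c:]" using pderiv_iszero by blast
  then have "F = antideriv p + [:c:]" by (metis add.commute diff_add_cancel)
  then show ?thesis using integral_poly_interval[OF assms(1), of p] by simp
qed

text \<open>Write p(hi) - p(y \<bullet> x) as the integral of p' from y \<bullet> x to hi and
  interchange the integrals.\<close>

lemma integral_poly_inner:
  fixes D :: "'a::euclidean_space set"
  assumes D: "D \<in> sets borel" "bounded D" "D \<noteq> {}"
  shows "(LINT x|lborel. indicator D x * poly p (y \<bullet> x)) = poly p (hi D y) * measure lborel D -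
    (LINT t|lborel. indicator {lo D y..hi D y} t * (poly (pderiv p) t * cut_vol D y t))"
proof -
  note [measurable] = D(1)
  let ?a = "lo D y" and ?b = "hi D y"
  have [measurable]: "poly q \<in> borel_measurable borel" for q :: "real poly"
    by (intro borel_measurable_continuous_onI continuous_intros)
  obtain r where r: "D \<subseteq> cball 0 r" using bounded_subset_ballD[OF D(2), of 0] by (meson ball_subset_cball order_trans)
  define F where "F = (\<lambda>(x::'a, t::real). indicator D x * (indicator {?a..?b} t *
      (poly (pderiv p) t * (if y \<bullet> x \<le> t then 1 else 0))) :: real)"
  have F[measurable]: "F \<in> borel_measurable (borel \<Otimes>\<^sub>M borel)" unfolding F_def by measurable
  have "continuous_on {?a..?b} (poly (pderiv p))" by (intro continuous_intros)
  then have "bounded (poly (pderiv p) ` {?a..?b})"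
    by (intro compact_imp_bounded compact_continuous_image) auto
  then obtain B where B: "\<forall>t\<in>{?a..?b}. \<bar>poly (pderiv p) t\<bar> \<le> B" by (auto simp: bounded_iff)
  have "integrable lborel F"
  proof (rule bounded_measurable_integrable[of _ "\<bar>r\<bar> + (\<bar>?a\<bar> + \<bar>?b\<bar>)" "max B 0"])
    show "F \<in> borel_measurable borel" using F by (simp add: borel_prod)
    show "F z = 0" if "z \<notin> cball 0 (\<bar>r\<bar> + (\<bar>?a\<bar> + \<bar>?b\<bar>))" for z
    proof (rule ccontr)
      assume "F z \<noteq> 0"
      then have "fst z \<in> D" "snd z \<in> {?a..?b}"
        by (auto simp: F_def case_prod_beta indicator_def split: if_splits)
      then have "norm (fst z) \<le> \<bar>r\<bar>" "norm (snd z) \<le> \<bar>?a\<bar> + \<bar>?b\<bar>" using r by auto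
      then have "norm z \<le> \<bar>r\<bar> + (\<bar>?a\<bar> + \<bar>?b\<bar>)" using norm_Pair_le[of "fst z" "snd z"] by simp
      then show False using that by simp
    qed
    show "\<bar>F z\<bar> \<le> max B 0" for z
      using B by (auto simp: F_def case_prod_beta indicator_def le_max_iff_disj)
  qed
  then have int: "integrable (lborel \<Otimes>\<^sub>M lborel) (\<lambda>(x, t). F (x, t))" by (simp add: lborel_prod)
  have 1: "(LINT t|lborel. F (x, t)) = indicator D x * (poly p ?b - poly p (y \<bullet> x))" for x
  proof (cases "x \<in> D")
    case True
    have ab: "?a \<le> y \<bullet> x" "y \<bullet> x \<le> ?b"
      using hi_upper[OF D(2) True, of y] hi_upper[OF D(2) True, of "- y"] by (auto simp: lo_eq)
    have "(LINT t|lborel. F (x, t)) = (LINT t|lborel. indicator {y \<bullet> x..?b} t * poly (pderiv p) t)"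
      using True ab by (intro Bochner_Integration.integral_cong) (auto simp: F_def indicator_def)
    then show ?thesis using integral_pderiv_interval[OF ab(2) refl, of p] True by simp
  qed (simp add: F_def)
  have 2: "(LINT x|lborel. F (x, t)) = indicator {?a..?b} t * (poly (pderiv p) t * cut_vol D y t)" for t
  proof -
    have "(LINT x|lborel. F (x, t)) = (LINT x|lborel. (indicator {?a..?b} t * poly (pderiv p) t) *
        (indicator D x * (if y \<bullet> x \<le> t then 1 else 0)))"
      by (intro Bochner_Integration.integral_cong) (auto simp: F_def)
    then show ?thesis by (simp add: cut_vol_integral[OF D(1)])
  qed
  have fin: "emeasure lborel D < \<infinity>" by (rule emeasure_bounded_finite[OF D(2)])
  have iD: "integrable lborel (\<lambda>x. indicator D x * poly p (y \<bullet> x))"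
    by (rule integrable_indicator_mult_continuous[OF _ D(1) r]) (intro continuous_intros)
  have "(LINT t|lborel. indicator {?a..?b} t * (poly (pderiv p) t * cut_vol D y t)) =
      (LINT x|lborel. indicator D x * (poly p ?b - poly p (y \<bullet> x)))"
    using lborel_pair.integral_fst[OF int] lborel_pair.integral_snd[OF int] by (simp add: 1 2)
  also have "\<dots> = (LINT x|lborel. poly p ?b * indicator D x - indicator D x * poly p (y \<bullet> x))"
    by (intro Bochner_Integration.integral_cong) (auto simp: algebra_simps)
  also have "\<dots> = poly p ?b * measure lborel D - (LINT x|lborel. indicator D x * poly p (y \<bullet> x))"
    using fin D(1) by (subst Bochner_Integration.integral_diff[OF _ iD]) auto
  finally show ?thesis by simp
qed

lemma pderiv_power_dvd:
  fixes p :: "real poly"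
  assumes "[:- a, 1:] ^ Suc k dvd p"
  shows "[:- a, 1:] ^ k dvd pderiv p"
proof -
  obtain u where "p = [:- a, 1:] ^ Suc k * u" using assms by (elim dvdE)
  then have "pderiv p = [:- a, 1:] ^ k * (Polynomial.smult (of_nat (Suc k)) u + [:- a, 1:] * pderiv u)"
    by (simp add: pderiv_mult pderiv_power_Suc pderiv_pCons algebra_simps del: of_nat_Suc power_Suc)
      (simp add: algebra_simps)
  then show ?thesis by simp
qed

lemma pderiv_iter_root:
  fixes p :: "real poly"
  assumes "[:- a, 1:] ^ Suc k dvd p" "i \<le> k"
  shows "poly ((pderiv ^^ i) p) a = 0"
proof -
  have "[:- a, 1:] ^ (Suc k - i) dvd (pderiv ^^ i) p" using assms(2)
  proof (induction i)
    case (Suc i)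
    then have "Suc k - i = Suc (Suc k - Suc i)" by simp
    then show ?case using Suc pderiv_power_dvd[of a "Suc k - Suc i" "(pderiv ^^ i) p"] by simp
  qed (use assms in simp)
  moreover have "Suc k - i = Suc (k - i)" using assms(2) by simp
  ultimately have "[:- a, 1:] dvd (pderiv ^^ i) p" by (metis dvd_mult_left power_Suc)
  then show ?thesis by (simp add: poly_eq_0_iff_dvd)
qed

text \<open>Repeated integration by parts: the derivatives of p vanish at both ends up to order m,
  and m + 1 steps use up q. R is the antiderivative so produced.\<close>

lemma iterated_parts:
  fixes p q :: "real poly"
  assumes "degree q \<le> m" "\<And>i. i \<le> m \<Longrightarrow> poly ((pderiv ^^ i) p) a = 0" "\<And>i. i \<le> m \<Longrightarrow> poly ((pderiv ^^ i) p) b = 0"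
  shows "\<exists>R. pderiv R = (pderiv ^^ Suc m) p * q \<and> poly R a = 0 \<and> poly R b = 0"
  using assms
proof (induction m arbitrary: q)
  case 0
  then obtain c where "q = [:c:]" by (meson degree_eq_zeroE le_zero_eq)
  then show ?case using 0(2,3)[of 0]
    by (intro exI[of _ "Polynomial.smult c p"]) (simp add: pderiv_smult)
next
  case (Suc m)
  have "degree (pderiv q) \<le> m" using Suc.prems(1) by (simp add: degree_pderiv)
  from Suc.IH[OF this] Suc.prems obtain R where
    R: "pderiv R = (pderiv ^^ Suc m) p * pderiv q" "poly R a = 0" "poly R b = 0" by auto
  show ?case
    using R Suc.prems(2,3)[of "Suc m"]
    by (intro exI[of _ "(pderiv ^^ Suc m) p * q - R"]) (simp add: pderiv_diff pderiv_mult algebra_simps)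
qed

text \<open>Up to sign, the M-th distributional derivative of the image of Lebesgue measure on D
  under \<open>(\<bullet>) y\<close>. If the volume function is a polynomial of degree at most M,
  the density has vanishing M-th derivative between lo and hi, so the form is supported at these two
  points.\<close>

definition moment_form :: "'a::euclidean_space set \<Rightarrow> nat \<Rightarrow> 'a \<Rightarrow> real poly \<Rightarrow> real" where
  "moment_form D M y p = (LINT x|lborel. indicator D x * poly ((pderiv ^^ M) p) (y \<bullet> x))"

text \<open>In \<open>integral_poly_inner\<close> the boundary term vanishes because p has a zero of
  order M + 1 at hi, and \<open>iterated_parts\<close> disposes of the integral. This provides a
  nonzero element of the annihilator of the form.\<close>

lemma moment_form_annihilated:
  fixes D :: "'a::euclidean_space set"
  assumes D: "open D" "connected D" "bounded D" "D \<noteq> {}" and vp: "volume_polynomial D M" and y: "y \<noteq> 0"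
    and p: "[:- lo D y, 1:] ^ Suc M dvd p" "[:- hi D y, 1:] ^ Suc M dvd p"
  shows "moment_form D M y p = 0"
proof -
  let ?a = "lo D y" and ?b = "hi D y"
  have Db: "D \<in> sets borel" using D by simp
  obtain x0 where "x0 \<in> D" using D by blast
  then have ab: "?a \<le> ?b" using lo_less_inner_less_hi[OF D(1,3) y] by fastforce
  obtain q where q: "degree q \<le> M" "\<And>x. x \<in> D \<Longrightarrow> cut_vol D y (y \<bullet> x) = poly q (y \<bullet> x)"
    using vp y unfolding volume_polynomial_def by blast
  have V: "cut_vol D y t = poly q t" if "?a < t" "t < ?b" for t
    using inner_value_attained[OF D(2,4,3) that] q(2) by auto
  have [measurable]: "cut_vol D y \<in> borel_measurable borel"
  proof -
    have "continuous_on UNIV (\<lambda>t. (\<lambda>z. cut_vol D (fst z) (snd z)) (y, t))"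
      by (rule continuous_on_compose2[OF cut_vol_continuous[OF Db D(3)]]) (use y in \<open>auto intro!: continuous_intros\<close>)
    then show ?thesis by (intro borel_measurable_continuous_onI) simp
  qed
  have [measurable]: "poly q \<in> borel_measurable borel" for q :: "real poly"
    by (intro borel_measurable_continuous_onI continuous_intros)
  obtain R where R: "pderiv R = (pderiv ^^ Suc M) p * q" "poly R ?a = 0" "poly R ?b = 0"
    using iterated_parts[OF q(1), of p ?a ?b] pderiv_iter_root[OF p(1)] pderiv_iter_root[OF p(2)] by blast
  have "(LINT t|lborel. indicator {?a..?b} t * (poly (pderiv ((pderiv ^^ M) p)) t * cut_vol D y t))
      = (LINT t|lborel. indicator {?a..?b} t * poly ((pderiv ^^ Suc M) p * q) t)"
  proof (rule integral_cong_AE)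
    have "AE t in lborel. t \<noteq> ?a" "AE t in lborel. t \<noteq> ?b" by (rule AE_lborel_singleton)+
    then show "AE t in lborel. indicator {?a..?b} t * (poly (pderiv ((pderiv ^^ M) p)) t * cut_vol D y t)
      = indicator {?a..?b} t * poly ((pderiv ^^ Suc M) p * q) t"
      by eventually_elim (use V in \<open>auto simp: indicator_def\<close>)
  qed measurable
  also have "\<dots> = 0" using integral_pderiv_interval[OF ab R(1)] R by simp
  finally show ?thesis
    unfolding moment_form_def integral_poly_inner[OF Db D(3,4)]
    using pderiv_iter_root[OF p(2), of M] by simp
qed

section \<open>Hankel determinants of a linear form on polynomials\<close>

locale poly_form =
  fixes L :: "real poly \<Rightarrow> real"
  assumes L_add: "L (p + q) = L p + L q" and L_smult: "L (Polynomial.smult c p) = c * L p"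
begin

lemma L_zero[simp]: "L 0 = 0"
  using L_smult[of 0 0] by simp

lemma L_sum: "finite A \<Longrightarrow> L (\<Sum>i\<in>A. f i) = (\<Sum>i\<in>A. L (f i))"
  by (induction rule: finite_induct) (simp_all add: L_add)

text \<open>The largest ideal on which L vanishes, as opposed to the null space of L.\<close>

definition kernel :: "real poly set" where
  "kernel = {f. \<forall>p. L (f * p) = 0}"

lemma kernelD:
  assumes "f \<in> kernel"
  shows "L (f * p) = 0" "L (p * f) = 0"
  using assms unfolding kernel_def by (auto simp: mult.commute[of p f])

lemma kernel_smult: "f \<in> kernel \<Longrightarrow> Polynomial.smult c f \<in> kernel"
  by (simp add: kernel_def L_smult)

lemma kernel_mult: "f \<in> kernel \<Longrightarrow> f * g \<in> kernel"
  by (simp add: kernel_def mult.assoc)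

lemma kernel_diff:
  assumes "f \<in> kernel" "g \<in> kernel"
  shows "f - g \<in> kernel"
  unfolding kernel_def
proof (intro CollectI allI)
  fix p
  have "f * p = (f - g) * p + g * p" by (simp add: left_diff_distrib)
  then have "L (f * p) = L ((f - g) * p) + L (g * p)" by (simp only: L_add)
  then show "L ((f - g) * p) = 0" using kernelD(1)[OF assms(1)] kernelD(1)[OF assms(2)] by simp
qed

lemma kernel_generator:
  assumes "g \<in> kernel" "g \<noteq> 0"
  obtains m where "lead_coeff m = 1" "m \<in> kernel" "\<And>f. f \<in> kernel \<Longrightarrow> m dvd f"
proof -
  obtain m0 where m0: "m0 \<in> kernel" "m0 \<noteq> 0" "\<And>f. f \<in> kernel \<Longrightarrow> f \<noteq> 0 \<Longrightarrow> degree m0 \<le> degree f"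
    using ex_has_least_nat[of "\<lambda>f. f \<in> kernel \<and> f \<noteq> 0" g degree] assms by auto
  define m where "m = Polynomial.smult (1 / lead_coeff m0) m0"
  have m: "lead_coeff m = 1" "m \<in> kernel" "degree m = degree m0" "m \<noteq> 0"
    using m0 by (simp_all add: m_def kernel_smult)
  have "m dvd f" if f: "f \<in> kernel" for f
  proof -
    have "f mod m \<in> kernel"
      using kernel_diff[OF f kernel_mult[OF m(2), of "f div m"]] by (simp add: minus_mult_div_eq_mod)
    then have "f mod m = 0"
      using m0(3)[of "f mod m"] degree_mod_less[of m f] m by fastforce
    then show ?thesis by (simp add: dvd_eq_mod_eq_0)
  qed
  with m show ?thesis using that by blast
qed

text \<open>The Hankel matrix of the twisted form p -> L ((c - X)^k p). The twist makes the
  determinant see the value at c of the generator of the kernel.\<close>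

definition hankel :: "nat \<Rightarrow> real \<Rightarrow> nat \<Rightarrow> real Matrix.mat" where
  "hankel r c k = Matrix.mat r r (\<lambda>(i, j). L ([:c, -1:] ^ k * monom 1 (i + j)))"

lemma hankel_carrier[simp]:
  "hankel r c k \<in> carrier_mat r r" "dim_row (hankel r c k) = r" "dim_col (hankel r c k) = r"
  by (simp_all add: hankel_def)

lemma poly_as_sum_lessThan:
  assumes "degree (f :: real poly) < r"
  shows "f = (\<Sum>i<r. Polynomial.smult (coeff f i) (monom 1 i))"
proof -
  have "f = (\<Sum>i\<le>degree f. monom (coeff f i) i)" by (simp add: poly_as_sum_of_monoms)
  also have "\<dots> = (\<Sum>i<r. monom (coeff f i) i)"
    using assms by (intro sum.mono_neutral_left) (auto simp: coeff_eq_0)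
  finally show ?thesis by (simp add: smult_monom)
qed

lemma L_product_expand:
  assumes "degree f < r" "degree g < r"
  shows "L (h * (f * g)) = (\<Sum>i<r. \<Sum>j<r. coeff f i * (L (h * monom 1 (i + j)) * coeff g j))"
proof -
  have "h * (f * g) = h * ((\<Sum>i<r. Polynomial.smult (coeff f i) (monom 1 i)) * (\<Sum>j<r. Polynomial.smult (coeff g j) (monom 1 j)))"
    using poly_as_sum_lessThan[OF assms(1)] poly_as_sum_lessThan[OF assms(2)] by simp
  also have "\<dots> = (\<Sum>i<r. \<Sum>j<r. h * (Polynomial.smult (coeff f i) (monom 1 i) * Polynomial.smult (coeff g j) (monom 1 j)))"
    by (subst sum_product) (simp only: sum_distrib_left)
  also have "\<dots> = (\<Sum>i<r. \<Sum>j<r. Polynomial.smult (coeff f i * coeff g j) (h * monom 1 (i + j)))"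
    by (intro sum.cong refl) (simp add: mult_monom mult_smult_right[symmetric] mult_smult_left[symmetric] smult_monom del: mult_smult_right mult_smult_left)
  finally have "h * (f * g) = (\<Sum>i<r. \<Sum>j<r. Polynomial.smult (coeff f i * coeff g j) (h * monom 1 (i + j)))" .
  then show ?thesis by (simp add: L_sum L_smult mult_ac)
qed

text \<open>In the Newton basis P_i, the product of the X - \<rho>_l with l < i, multiplication by c
  - X is triangular with diagonal entries c - \<rho>_l, once P_r is discarded as an element of the
  kernel. The passage from monomials to this basis has determinant 1.\<close>

lemma det_hankel_power:
  assumes m: "(\<Prod>l<r. [:- \<rho> l, 1:]) \<in> kernel"
  shows "Determinant.det (hankel r c k) = Determinant.det (hankel r c 0) * (\<Prod>l<r. c - \<rho> l) ^ k"
proof -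
  define P where "P i = (\<Prod>l<i. [:- \<rho> l, 1:])" for i
  have degP: "degree (P i) = i" for i
    unfolding P_def by (subst degree_prod_eq_sum_degree) auto
  have lcP: "lead_coeff (P i) = 1" for i unfolding P_def by (simp add: lead_coeff_prod)
  define U where "U = Matrix.mat r r (\<lambda>(i, l). coeff (P i) l)"
  define G where "G k = Matrix.mat r r (\<lambda>(i, j). L ([:c, -1:] ^ k * (P i * P j)))" for k
  define B where "B = Matrix.mat r r (\<lambda>(l, j). if l = j then c - \<rho> j else if l = Suc j then -1 else 0)"
  have car: "U \<in> carrier_mat r r" "G k \<in> carrier_mat r r" "B \<in> carrier_mat r r" for k
    by (simp_all add: U_def G_def B_def)
  have detU: "Determinant.det U = 1"
  proof -
    have "Determinant.det U = prod_list (diag_mat U)"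
      by (rule det_lower_triangular[OF _ car(1)]) (auto simp: U_def coeff_eq_0 degP)
    also have "diag_mat U = map (\<lambda>i. 1) [0..<r]"
      unfolding diag_mat_def using lcP degP by (auto simp: U_def)
    finally show ?thesis by (simp add: map_replicate_const)
  qed
  have GU: "G k = U * hankel r c k * transpose_mat U" for k
  proof (rule eq_matI)
    fix i j assume "i < dim_row (U * hankel r c k * transpose_mat U)" "j < dim_col (U * hankel r c k * transpose_mat U)"
    then have ij: "i < r" "j < r" by (simp_all add: U_def)
    have "(U * hankel r c k * transpose_mat U) $$ (i, j) =
        (\<Sum>l'<r. (\<Sum>l<r. coeff (P i) l * L ([:c, -1:] ^ k * monom 1 (l + l'))) * coeff (P j) l')"
      using ij by (simp add: U_def hankel_def scalar_prod_def atLeast0LessThan)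
    also have "\<dots> = (\<Sum>l<r. \<Sum>l'<r. coeff (P i) l * (L ([:c, -1:] ^ k * monom 1 (l + l')) * coeff (P j) l'))"
      by (subst sum.swap) (simp add: sum_distrib_right mult.assoc)
    also have "\<dots> = G k $$ (i, j)"
      using ij L_product_expand[of "P i" r "P j" "[:c, -1:] ^ k"] by (simp add: G_def degP)
    finally show "G k $$ (i, j) = (U * hankel r c k * transpose_mat U) $$ (i, j)" ..
  qed (simp_all add: G_def U_def)
  have detG: "Determinant.det (G k) = Determinant.det (hankel r c k)" for k
    unfolding GU using car(1)
    by (subst det_mult[of _ r], simp, simp, subst det_mult[of _ r])
      (simp_all add: det_transpose[of _ r] detU)
  have GB: "G (Suc k) = G k * B" for k
  proof (rule eq_matI)
    fix i j assume "i < dim_row (G k * B)" "j < dim_col (G k * B)"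
    then have ij: "i < r" "j < r" by (simp_all add: G_def B_def)
    have step: "[:c, -1:] * P j = Polynomial.smult (c - \<rho> j) (P j) - P (Suc j)"
      by (simp add: P_def smult_diff_left)
    let ?l = "\<lambda>l. L ([:c, -1:] ^ k * (P i * P l))"
    have "L ([:c, -1:] ^ Suc k * (P i * P j)) = L ([:c, -1:] ^ k * P i * ([:c, -1:] * P j))"
      by (simp only: power_Suc mult_ac)
    also have "[:c, -1:] ^ k * P i * ([:c, -1:] * P j) =
        Polynomial.smult (c - \<rho> j) ([:c, -1:] ^ k * (P i * P j)) + Polynomial.smult (-1) ([:c, -1:] ^ k * (P i * P (Suc j)))"
      unfolding step by (simp add: algebra_simps)
    also have "L \<dots> = (c - \<rho> j) * ?l j - ?l (Suc j)"
      by (subst L_add, subst (1 2) L_smult) simp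
    also have "\<dots> = (\<Sum>l<r. ?l l * (if l = j then c - \<rho> j else if l = Suc j then -1 else 0))"
    proof -
      have "(\<Sum>l<r. ?l l * (if l = j then c - \<rho> j else if l = Suc j then -1 else 0)) =
          (\<Sum>l<r. (if l = j then (c - \<rho> j) * ?l j else 0) + (if l = Suc j then - ?l (Suc j) else 0))"
        by (intro sum.cong) auto
      also have "\<dots> = (c - \<rho> j) * ?l j + (if Suc j < r then - ?l (Suc j) else 0)"
        using ij by (simp add: sum.distrib)
      \<comment> \<open>For j = r - 1 the missing basis element is P_r, on whose multiples the form
        vanishes.\<close>
      also have "(if Suc j < r then - ?l (Suc j) else 0) = - ?l (Suc j)"
      proof (cases "Suc j < r")
        case False
        then have "Suc j = r" using ij by simp
        then have "P (Suc j) \<in> kernel" using m by (simp only: P_def)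
        then have "?l (Suc j) = 0" using kernelD(2)[of "P (Suc j)" "[:c, -1:] ^ k * P i"] by (simp add: mult.assoc)
        then show ?thesis by simp
      qed simp
      finally show ?thesis by simp
    qed
    finally show "G (Suc k) $$ (i, j) = (G k * B) $$ (i, j)"
      using ij by (simp add: G_def B_def scalar_prod_def atLeast0LessThan)
  qed (simp_all add: G_def B_def)
  have detB: "Determinant.det B = (\<Prod>l<r. c - \<rho> l)"
  proof -
    have "Determinant.det B = prod_list (diag_mat B)"
      by (rule det_lower_triangular[OF _ car(3)]) (auto simp: B_def)
    also have "diag_mat B = map (\<lambda>l. c - \<rho> l) [0..<r]"
      unfolding diag_mat_def by (auto simp: B_def)
    also have "prod_list \<dots> = (\<Prod>l<r. c - \<rho> l)"
      by (simp add: prod.list_conv_set_nth atLeast0LessThan)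
    finally show ?thesis .
  qed
  have "Determinant.det (G k) = Determinant.det (G 0) * (\<Prod>l<r. c - \<rho> l) ^ k"
    by (induction k) (simp_all add: GB det_mult[OF car(2,3)] detB mult_ac)
  then show ?thesis by (simp add: detG)
qed

lemma hankel_mult_coeffs:
  assumes "degree f < r" "i < r"
  shows "vec_index (hankel r c k *\<^sub>v Matrix.vec r (coeff f)) i = L ([:c, -1:] ^ k * (monom 1 i * f))"
proof -
  have "vec_index (hankel r c k *\<^sub>v Matrix.vec r (coeff f)) i =
      (\<Sum>j<r. L ([:c, -1:] ^ k * monom 1 (i + j)) * coeff f j)"
    using assms by (simp add: hankel_def scalar_prod_def atLeast0LessThan)
  also have "\<dots> = L (\<Sum>j<r. Polynomial.smult (coeff f j) ([:c, -1:] ^ k * monom 1 (i + j)))"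
    by (simp add: L_sum L_smult mult.commute)
  also have "(\<Sum>j<r. Polynomial.smult (coeff f j) ([:c, -1:] ^ k * monom 1 (i + j))) = [:c, -1:] ^ k * (monom 1 i * f)"
  proof -
    have "[:c, -1:] ^ k * (monom 1 i * f) =
        [:c, -1:] ^ k * (monom 1 i * (\<Sum>j<r. Polynomial.smult (coeff f j) (monom 1 j)))"
      using poly_as_sum_lessThan[OF assms(1)] by simp
    then show ?thesis by (simp add: sum_distrib_left mult_monom)
  qed
  finally show ?thesis .
qed

text \<open>The coefficient vector of f is a null vector of the matrix.\<close>

lemma det_hankel_zero:
  assumes "f \<in> kernel" "f \<noteq> 0" "degree f < r"
  shows "Determinant.det (hankel r c k) = 0"
proof -
  let ?v = "Matrix.vec r (coeff f)"
  have "vec_index ?v (degree f) \<noteq> 0" using assms by simp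
  then have "?v \<noteq> 0\<^sub>v r" using assms(3) by (metis index_zero_vec(1))
  moreover have "hankel r c k *\<^sub>v ?v = 0\<^sub>v r"
    by (rule eq_vecI)
      (simp_all add: hankel_mult_coeffs[OF assms(3)] kernelD(2)[OF assms(1)] mult.assoc[symmetric] del: index_mult_mat_vec)
  ultimately show ?thesis
    using det_0_iff_vec_prod_zero[OF hankel_carrier(1)] by (metis vec_carrier)
qed

text \<open>A null vector is a polynomial f of degree below r with L (f p) = 0 for all p of degree
  below r. Reducing p modulo m removes the restriction on p, so f is in the kernel, although its
  degree is too small for a nonzero multiple of m.\<close>

lemma det_hankel_nonzero:
  assumes m: "m \<in> kernel" "\<And>f. f \<in> kernel \<Longrightarrow> m dvd f" "degree m = r" "lead_coeff m = 1"
  shows "Determinant.det (hankel r c 0) \<noteq> 0"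
proof
  assume "Determinant.det (hankel r c 0) = 0"
  then obtain v where v: "v \<in> carrier_vec r" "v \<noteq> 0\<^sub>v r" "hankel r c 0 *\<^sub>v v = 0\<^sub>v r"
    using det_0_iff_vec_prod_zero[OF hankel_carrier(1)] by blast
  define f where "f = (\<Sum>i<r. monom (vec_index v i) i)"
  have cf: "coeff f i = (if i < r then vec_index v i else 0)" for i
    by (simp add: f_def coeff_sum if_distrib cong: if_cong)
  have r: "r > 0" using v(1,2) by (intro gr0I) auto
  have degf: "degree f < r"
    using r cf by (intro degree_lessI) auto
  have vf: "v = Matrix.vec r (coeff f)" using v(1) by (intro eq_vecI) (auto simp: cf)
  have f0: "f \<noteq> 0"
  proof
    assume "f = 0"
    then have "v = 0\<^sub>v r" unfolding vf by (intro eq_vecI) auto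
    then show False using v(2) by simp
  qed
  have mon: "L (monom 1 i * f) = 0" if "i < r" for i
    using hankel_mult_coeffs[OF degf that, of c 0] v(3) that by (simp add: vf[symmetric])
  have "f \<in> kernel" unfolding kernel_def
  proof (intro CollectI allI)
    fix p
    define u where "u = p mod m"
    have "m \<noteq> 0" using m(4) by auto
    then have "degree u < r" using degree_mod_less[of m p] m(3) r by (auto simp: u_def)
    have "f * p = m * (p div m * f) + u * f" by (metis u_def distrib_right mult.commute mult.assoc mult_div_mod_eq)
    then have "L (f * p) = L (u * f)" by (simp add: L_add kernelD(1)[OF m(1)])
    also have "u * f = (\<Sum>i<r. Polynomial.smult (coeff u i) (monom 1 i * f))"
      by (subst poly_as_sum_lessThan[OF \<open>degree u < r\<close>]) (simp add: sum_distrib_right)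
    also have "L \<dots> = 0" by (simp add: L_sum L_smult mon)
    finally show "L (f * p) = 0" .
  qed
  then have "m dvd f" by (rule m(2))
  from dvd_imp_degree_le[OF this f0] show False using degf m(3) by simp
qed

end

text \<open>At every prime, k times the multiplicity in x is at most the multiplicity in c plus k
  times the multiplicity in y; choose k large.\<close>

lemma power_dvd_imp_dvd:
  fixes x y c :: "real poly"
  assumes d: "\<And>k. x ^ k dvd c * y ^ k" and c: "c \<noteq> 0"
  shows "x dvd y"
proof (cases "x = 0 \<or> y = 0")
  case True
  then show ?thesis using d[of 1] c by auto
next
  case False
  show ?thesis
  proof (rule multiplicity_le_imp_dvd)
    fix p :: "real poly" assume p: "prime p"
    show "multiplicity p x \<le> multiplicity p y"
    proof (rule ccontr)
      assume "\<not> ?thesis"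
      then have m: "Suc (multiplicity p y) \<le> multiplicity p x" by simp
      \<comment> \<open>An excess of one in the multiplicity is amplified to k, more than c can
        compensate.\<close>
      define k where "k = Suc (multiplicity p c)"
      have "multiplicity p (x ^ k) \<le> multiplicity p (c * y ^ k)"
        using False c by (intro dvd_imp_multiplicity_le d) auto
      then have "k * multiplicity p x \<le> multiplicity p c + k * multiplicity p y"
        using p False c by (simp add: prime_elem_multiplicity_power_distrib prime_elem_multiplicity_mult_distrib)
      moreover have "k * Suc (multiplicity p y) \<le> k * multiplicity p x" using m by (rule mult_le_mono2)
      ultimately show False by (simp add: k_def)
    qed
  qed (use False in simp)
qed

section \<open>Polynomials with two distinct roots\<close>

lemma poly_ext: "(\<And>s::real. poly p s = poly q s) \<Longrightarrow> p = q"
  using poly_eq_poly_eq_iff by blast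

lemma cofinite_closed_UNIV:
  fixes S :: "real set"
  assumes "closed S" "finite (- S)"
  shows "S = UNIV"
  using finite_imp_not_open[OF assms(2)] assms(1) by auto

lemma dvd_linear_power:
  fixes x :: "real poly"
  assumes "x dvd [:- c, 1:] ^ k"
  shows "\<exists>i u. i \<le> k \<and> x = [:u:] * [:- c, 1:] ^ i"
  using assms
proof (induction k arbitrary: x)
  case 0
  then have "degree x = 0" using dvd_imp_degree_le[of x 1] by simp
  then obtain u where "x = [:u:]" by (rule degree_eq_zeroE)
  then show ?case by auto
next
  case (Suc k)
  show ?case
  proof (cases "[:- c, 1:] dvd x")
    case True
    then obtain x' where x': "x = [:- c, 1:] * x'" by (elim dvdE)
    then have "x' dvd [:- c, 1:] ^ k"
      using Suc.prems dvd_mult_cancel_left[of "[:- c, 1:]" x' "[:- c, 1:] ^ k"] by simp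
    then obtain i u where "i \<le> k" "x' = [:u:] * [:- c, 1:] ^ i" using Suc.IH by blast
    then show ?thesis by (intro exI[of _ "Suc i"] exI[of _ u]) (simp add: x' mult_ac)
  next
    case False
    have "prime_elem [:- c, 1:]" by (rule prime_elem_linear_field_poly) simp
    then have "coprime x [:- c, 1:]"
      using prime_elem_imp_coprime[OF _ False] by (simp add: coprime_commute)
    then have "x dvd [:- c, 1:] ^ k"
      using Suc.prems coprime_dvd_mult_right_iff[of x "[:- c, 1:]" "[:- c, 1:] ^ k"] by simp
    then obtain i u where "i \<le> k" "x = [:u:] * [:- c, 1:] ^ i" using Suc.IH by blast
    then show ?thesis by (intro exI[of _ i] exI[of _ u]) auto
  qed
qed

lemma two_root_factor:
  fixes m :: "real poly"
  assumes ab: "a \<noteq> b" and m: "lead_coeff m = 1" "m dvd [:- a, 1:] ^ k * [:- b, 1:] ^ k"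
  obtains i j where "m = [:- a, 1:] ^ i * [:- b, 1:] ^ j" "i \<le> k" "j \<le> k"
proof -
  have cop: "coprime [:- a, 1:] [:- b, 1:]"
  proof (rule coprimeI)
    fix c assume "c dvd [:- a, 1:]" "c dvd [:- b, 1:]"
    then have "c dvd [:- a, 1:] - [:- b, 1:]" by (rule dvd_diff)
    then have "c dvd [:b - a:]" by simp
    moreover have "[:b - a:] dvd 1" using ab by (simp add: const_poly_dvd_1)
    ultimately show "is_unit c" by (rule dvd_trans)
  qed
  obtain x y where xy: "m = x * y" "x dvd [:- a, 1:] ^ k" "y dvd [:- b, 1:] ^ k"
    using division_decomp[OF m(2)] by blast
  obtain i u where x: "i \<le> k" "x = [:u:] * [:- a, 1:] ^ i" using dvd_linear_power[OF xy(2)] by blast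
  obtain j v where y: "j \<le> k" "y = [:v:] * [:- b, 1:] ^ j" using dvd_linear_power[OF xy(3)] by blast
  have "lead_coeff m = u * v" unfolding xy(1) x y by (simp add: lead_coeff_mult lead_coeff_power)
  then have "u * v = 1" using m(1) by simp
  moreover have "m = Polynomial.smult (u * v) ([:- a, 1:] ^ i * [:- b, 1:] ^ j)"
    unfolding xy(1) x y by (simp add: mult_ac)
  ultimately show ?thesis using that x(1) y(1) by simp
qed

text \<open>Newton's identities for the two leading power sums, with \<open>X\<^sup>2\<close> as a factor so that they
  also hold for products of fewer than two linear factors.\<close>

lemma power_sum_coeffs:
  fixes \<rho> :: "nat \<Rightarrow> real"
  defines "m \<equiv> \<lambda>r. monom 1 2 * (\<Prod>l<r. [:- \<rho> l, 1:])"
  shows "coeff (m r) (Suc (Suc r)) = 1" "coeff (m r) (Suc r) = - (\<Sum>l<r. \<rho> l)"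
    "coeff (m r) r = ((\<Sum>l<r. \<rho> l)\<^sup>2 - (\<Sum>l<r. (\<rho> l)\<^sup>2)) / 2"
proof -
  have step: "m (Suc r) = pCons 0 (m r) - Polynomial.smult (\<rho> r) (m r)" for r
  proof -
    have "m (Suc r) = m r * [:- \<rho> r, 1:]" by (simp only: m_def prod.lessThan_Suc mult.assoc)
    then show ?thesis by simp
  qed
  have z: "coeff (m r) (Suc (Suc (Suc r))) = 0" for r
  proof -
    have "degree (\<Prod>l<r. [:- \<rho> l, 1:]) = r" by (subst degree_prod_eq_sum_degree) auto
    then have "degree (m r) \<le> 2 + r"
      using degree_mult_le[of "monom 1 2" "\<Prod>l<r. [:- \<rho> l, 1:]"] degree_monom_le[of "1::real" 2]
      unfolding m_def by linarith
    then show ?thesis by (intro coeff_eq_0) simp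
  qed
  have "coeff (m r) (Suc (Suc r)) = 1 \<and> coeff (m r) (Suc r) = - (\<Sum>l<r. \<rho> l) \<and>
    coeff (m r) r = ((\<Sum>l<r. \<rho> l)\<^sup>2 - (\<Sum>l<r. (\<rho> l)\<^sup>2)) / 2"
  proof (induction r)
    case 0
    show ?case by (simp add: m_def)
  next
    case (Suc r)
    then show ?case using z[of r] unfolding step
      by (simp add: power2_eq_square algebra_simps)
  qed
  then show "coeff (m r) (Suc (Suc r)) = 1" "coeff (m r) (Suc r) = - (\<Sum>l<r. \<rho> l)"
    "coeff (m r) r = ((\<Sum>l<r. \<rho> l)\<^sup>2 - (\<Sum>l<r. (\<rho> l)\<^sup>2)) / 2" by auto
qed

lemma prod_two_roots:
  fixes a b :: "'a::comm_ring_1"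
  shows "(\<Prod>l<i+j. f (if l < i then a else b)) = f a ^ i * f b ^ j"
proof -
  have eq: "{..<i+j} = {..<i} \<union> {i..<i+j}" by auto
  have "(\<Prod>l<i+j. f (if l < i then a else b)) =
      (\<Prod>l<i. f (if l < i then a else b)) * (\<Prod>l=i..<i+j. f (if l < i then a else b))"
    by (subst eq) (rule prod.union_disjoint, auto)
  then show ?thesis by simp
qed

lemma sum_two_roots:
  fixes f :: "real \<Rightarrow> real"
  shows "(\<Sum>l<i+j. f (if l < i then a else b)) = real i * f a + real j * f b"
proof -
  have eq: "{..<i+j} = {..<i} \<union> {i..<i+j}" by auto
  have "(\<Sum>l<i+j. f (if l < i then a else b)) =
      (\<Sum>l<i. f (if l < i then a else b)) + (\<Sum>l=i..<i+j. f (if l < i then a else b))"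
    by (subst eq) (rule sum.union_disjoint, auto)
  then show ?thesis by simp
qed

section \<open>The support function of a domain with polynomial volume function\<close>

lemma measure_open_pos:
  fixes D :: "'a::euclidean_space set"
  assumes D: "open D" "bounded D" "D \<noteq> {}"
  shows "measure lborel D > 0"
proof -
  have "D \<notin> null_sets lborel"
    using D(1,3) open_not_negligible by (auto simp: negligible_iff_null_sets dest: null_sets_completionI)
  then have "emeasure lborel D \<noteq> 0" using D(1) by (auto simp: null_sets_def)
  moreover have "emeasure lborel D \<noteq> \<infinity>" using emeasure_bounded_finite[OF D(2)] by simp
  ultimately show ?thesis by (simp add: measure_def enn2real_positive_iff top.not_eq_extremum zero_less_iff_neq_zero)
qed

locale volume_poly_domain =
  fixes D :: "'a::euclidean_space set" and M :: nat
  assumes D: "open D" "connected D" "bounded D" "D \<noteq> {}" and vp: "volume_polynomial D M"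
begin

lemma integrable_poly_inner: "integrable lborel (\<lambda>x. indicator D x * poly p (y \<bullet> x))"
proof -
  obtain r where r: "D \<subseteq> cball 0 r" using bounded_subset_ballD[OF D(3), of 0] by (meson ball_subset_cball order_trans)
  show ?thesis
    by (rule integrable_indicator_mult_continuous[OF _ _ r]) (use D in \<open>auto intro!: continuous_intros\<close>)
qed

lemma pderiv_iter_add: "(pderiv ^^ k) (p + q :: real poly) = (pderiv ^^ k) p + (pderiv ^^ k) q"
  by (induction k) (simp_all add: pderiv_add)

lemma pderiv_iter_smult: "(pderiv ^^ k) (Polynomial.smult c p :: real poly) = Polynomial.smult c ((pderiv ^^ k) p)"
  by (induction k) (simp_all add: pderiv_smult)

sublocale poly_form "moment_form D M y" for y
proof
  show "moment_form D M y (p + q) = moment_form D M y p + moment_form D M y q" for p q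
    unfolding moment_form_def pderiv_iter_add
    using Bochner_Integration.integral_add[OF integrable_poly_inner integrable_poly_inner]
    by (simp add: distrib_left)
  show "moment_form D M y (Polynomial.smult c p) = c * moment_form D M y p" for c p
    unfolding moment_form_def pderiv_iter_smult
    by (simp add: mult.left_commute)
qed

text \<open>For fixed x the integrand is a polynomial in s of degree at most d; interpolation at 0,
  ..., d commutes with the integral over D.\<close>

lemma moment_form_line:
  "\<exists>C. \<forall>s. moment_form D M (x0 + s *\<^sub>R y) p = poly C s"
proof -
  define f where "f = (pderiv ^^ M) p"
  define d where "d = degree f"
  have inj: "inj_on real {..d}" by (simp add: inj_on_def)
  let ?L = "\<lambda>j. lagrange_basis real d j"
  have pt: "poly f ((x0 + s *\<^sub>R y) \<bullet> x) = (\<Sum>j\<le>d. poly (?L j) s * poly f ((x0 + real j *\<^sub>R y) \<bullet> x))" for s x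
  proof -
    have "degree (pcompose f [:x0 \<bullet> x, y \<bullet> x:]) \<le> d"
      using degree_pcompose_le[of f "[:x0 \<bullet> x, y \<bullet> x:]"] by (auto simp: d_def split: if_splits)
    from lagrange_interpolation[OF inj this, of s] show ?thesis
      by (simp add: poly_pcompose inner_add_left)
  qed
  have "moment_form D M (x0 + s *\<^sub>R y) p = poly (\<Sum>j\<le>d. Polynomial.smult (moment_form D M (x0 + real j *\<^sub>R y) p) (?L j)) s" for s
  proof -
    have "moment_form D M (x0 + s *\<^sub>R y) p =
        (LINT x|lborel. (\<Sum>j\<le>d. poly (?L j) s * (indicator D x * poly f ((x0 + real j *\<^sub>R y) \<bullet> x))))"
      unfolding moment_form_def f_def[symmetric]
      by (intro Bochner_Integration.integral_cong refl, subst pt) (simp add: sum_distrib_left mult.left_commute)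
    also have "\<dots> = (\<Sum>j\<le>d. poly (?L j) s * moment_form D M (x0 + real j *\<^sub>R y) p)"
      by (subst Bochner_Integration.integral_sum) (auto simp: integrable_poly_inner moment_form_def f_def)
    finally show ?thesis by (simp add: poly_sum mult.commute)
  qed
  then show ?thesis by blast
qed

lemma volume_pos: "measure lborel D > 0"
  using D(1,3,4) by (rule measure_open_pos)

text \<open>On the M-fold antiderivative of 1 the form takes the volume of D as its value. Hence the
  generator of the kernel is not constant.\<close>

lemma one_not_in_kernel: "1 \<notin> kernel y"
proof
  assume "1 \<in> kernel y"
  then have L: "moment_form D M y p = 0" for p using kernelD(1)[of 1 y p] by simp
  have "(pderiv ^^ k) ((antideriv ^^ k) 1) = 1" for k
  proof (induction k)
    case (Suc k)
    have "(pderiv ^^ Suc k) ((antideriv ^^ Suc k) 1) = (pderiv ^^ k) (pderiv (antideriv ((antideriv ^^ k) 1)))"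
      by (metis funpow.simps(2) funpow_Suc_right o_apply)
    then show ?case using Suc by (simp only: pderiv_antideriv)
  qed simp
  then have "moment_form D M y ((antideriv ^^ M) 1) = measure lborel D"
    by (simp add: moment_form_def)
  then show False using L volume_pos by simp
qed

lemma lo_less_hi: "y \<noteq> 0 \<Longrightarrow> lo D y < hi D y"
  using lo_less_inner_less_hi[OF D(1,3)] D(4) by (meson all_not_in_conv order_less_trans)

lemma kernel_generator_form:
  assumes y: "y \<noteq> 0"
  shows "\<exists>i j. i + j \<le> 2 * Suc M \<and> i + j \<ge> 1 \<and> [:- lo D y, 1:] ^ i * [:- hi D y, 1:] ^ j \<in> kernel y \<and>
     (\<forall>f\<in>kernel y. [:- lo D y, 1:] ^ i * [:- hi D y, 1:] ^ j dvd f)"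
proof -
  let ?g = "[:- lo D y, 1:] ^ Suc M * [:- hi D y, 1:] ^ Suc M"
  have gK: "?g \<in> kernel y"
    unfolding kernel_def
    by (intro CollectI allI moment_form_annihilated[OF D vp y]) (simp_all add: dvd_mult2 dvd_mult del: power_Suc)
  have "?g \<noteq> 0" by (simp del: power_Suc)
  then obtain m where m: "lead_coeff m = 1" "m \<in> kernel y" "\<And>f. f \<in> kernel y \<Longrightarrow> m dvd f"
    using kernel_generator[OF gK] by blast
  obtain i j where ij: "m = [:- lo D y, 1:] ^ i * [:- hi D y, 1:] ^ j" "i \<le> Suc M" "j \<le> Suc M"
    using two_root_factor[OF less_imp_neq[OF lo_less_hi[OF y]] m(1) m(3)[OF gK]] by blast
  have "i + j \<ge> 1"
  proof (rule ccontr)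
    assume "\<not> i + j \<ge> 1"
    then have "i = 0" "j = 0" by auto
    then have "m = 1" using ij(1) by simp
    then show False using m(2) one_not_in_kernel by simp
  qed
  then show ?thesis using ij m by (intro exI[of _ i] exI[of _ j]) auto
qed

lemma hi_continuous: "continuous_on UNIV (hi D)"
proof -
  obtain K where K: "K \<ge> 0" "\<And>y z. \<bar>hi D y - hi D z\<bar> \<le> K * norm (y - z)"
    using hi_lipschitz[OF D(3,4)] by metis
  have "K-lipschitz_on UNIV (hi D)"
    by (rule lipschitz_onI) (use K in \<open>auto simp: dist_norm\<close>)
  then show ?thesis by (rule lipschitz_on_continuous_on)
qed

lemma line_continuous:
  "continuous_on UNIV (\<lambda>s::real. hi D (x0 + s *\<^sub>R y))" "continuous_on UNIV (\<lambda>s::real. lo D (x0 + s *\<^sub>R y))"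
  unfolding lo_eq
  by (intro continuous_intros continuous_on_compose2[OF hi_continuous] subset_UNIV)+

text \<open>Along a line of directions, let \<open>(X - lo)\<^sup>i (X - hi)\<^sup>j\<close> generate the annihilator of the
  moment form. The Hankel determinants of the form are polynomials in the line parameter, and
  consecutive ones differ by the factor \<open>(c - lo)\<^sup>i (c - hi)\<^sup>j\<close>; since all powers of this factor
  times a fixed polynomial are polynomials, it is a polynomial itself.\<close>

lemma line_generic:
  assumes nz: "\<And>s. x0 + s *\<^sub>R y \<noteq> 0"
  shows "\<exists>r E P Z. r \<ge> 1 \<and> finite Z \<and> (\<forall>s. s \<notin> Z \<longrightarrow> (\<exists>i j. i + j = r \<and>
    poly E s = real i * lo D (x0 + s *\<^sub>R y) + real j * hi D (x0 + s *\<^sub>R y) \<and>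
    poly P s = real i * (lo D (x0 + s *\<^sub>R y))\<^sup>2 + real j * (hi D (x0 + s *\<^sub>R y))\<^sup>2))"
proof -
  let ?y = "\<lambda>s::real. x0 + s *\<^sub>R y"
  let ?a = "\<lambda>s. lo D (?y s)" and ?b = "\<lambda>s. hi D (?y s)"
  have "\<forall>s. \<exists>i j. i + j \<le> 2 * Suc M \<and> i + j \<ge> 1 \<and> [:- ?a s, 1:] ^ i * [:- ?b s, 1:] ^ j \<in> kernel (?y s) \<and>
     (\<forall>f\<in>kernel (?y s). [:- ?a s, 1:] ^ i * [:- ?b s, 1:] ^ j dvd f)"
    using kernel_generator_form[OF nz] by blast
  then obtain i j where ij: "\<And>s. i s + j s \<le> 2 * Suc M" "\<And>s. i s + j s \<ge> 1"
    "\<And>s. [:- ?a s, 1:] ^ i s * [:- ?b s, 1:] ^ j s \<in> kernel (?y s)"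
    "\<And>s f. f \<in> kernel (?y s) \<Longrightarrow> [:- ?a s, 1:] ^ i s * [:- ?b s, 1:] ^ j s dvd f"
    by metis
  define m where "m s = [:- ?a s, 1:] ^ i s * [:- ?b s, 1:] ^ j s" for s
  have degm: "degree (m s) = i s + j s" for s
    unfolding m_def by (simp add: degree_mult_eq degree_power_eq)
  have lcm: "lead_coeff (m s) = 1" for s
    unfolding m_def by (simp add: lead_coeff_mult lead_coeff_power)
  \<comment> \<open>The generic degree of the generator. Where the degree is smaller, the
    determinants of size r vanish.\<close>
  define r where "r = Max (range (\<lambda>s. i s + j s))"
  have finr: "finite (range (\<lambda>s. i s + j s))"
    by (rule finite_subset[of _ "{..2 * Suc M}"]) (use ij(1) in auto)
  have r_max: "i s + j s \<le> r" for s unfolding r_def using finr by (intro Max_ge) auto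
  obtain s1 where s1: "i s1 + j s1 = r" using Max_in[OF finr] unfolding r_def by auto
  have r1: "r \<ge> 1" using ij(2)[of s1] s1 by simp
  define \<rho> where "\<rho> s l = (if l < i s then ?a s else ?b s)" for s l
  have m_prod: "m s = (\<Prod>l<r. [:- \<rho> s l, 1:])" if "i s + j s = r" for s
    unfolding m_def \<rho>_def using prod_two_roots[of "\<lambda>x. [:- x, 1:]" "i s" "?a s" "?b s" "j s"] that by simp
  obtain C where C: "\<And>p s. moment_form D M (?y s) p = poly (C p) s"
    using moment_form_line[of x0 y] by metis
  define H where "H c k = Matrix.mat r r (\<lambda>(u, v). C ([:c, -1:] ^ k * monom 1 (u + v)))" for c k
  define Dt where "Dt c k = Determinant.det (H c k)" for c k
  have Dt_eval: "poly (Dt c k) s = Determinant.det (hankel (?y s) r c k)" for c k s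
  proof -
    have "Determinant.det (map_mat (\<lambda>p. poly p s) (H c k)) = poly (Dt c k) s"
      unfolding Dt_def by (rule comm_ring_hom.hom_det) (rule poly_hom.comm_ring_hom_axioms)
    moreover have "map_mat (\<lambda>p. poly p s) (H c k) = hankel (?y s) r c k"
      by (rule eq_matI) (simp_all add: H_def hankel_def C)
    ultimately show ?thesis by simp
  qed
  define D0 where "D0 = Dt 0 0"
  have D0: "Dt c 0 = D0" for c by (simp add: D0_def Dt_def H_def)
  have generic: "poly (Dt c k) s = poly D0 s * (poly (m s) c) ^ k \<and> poly D0 s \<noteq> 0" if "i s + j s = r" for s c k
  proof -
    have "poly (Dt c k) s = Determinant.det (hankel (?y s) r c 0) * (\<Prod>l<r. c - \<rho> s l) ^ k"
      unfolding Dt_eval using ij(3)[of s] m_prod[OF that] by (intro det_hankel_power) (simp add: m_def)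
    moreover have "(\<Prod>l<r. c - \<rho> s l) = poly (m s) c" by (simp add: m_prod[OF that] poly_prod)
    moreover have "Determinant.det (hankel (?y s) r c 0) = poly D0 s" by (simp add: Dt_eval[symmetric] D0)
    moreover have "Determinant.det (hankel (?y s) r c 0) \<noteq> 0"
      using ij(3)[of s] ij(4)[where s = s] that degm lcm by (intro det_hankel_nonzero[where m = "m s"]) (auto simp: m_def[symmetric])
    ultimately show ?thesis by simp
  qed
  have degenerate: "poly (Dt c k) s = 0" if "i s + j s \<noteq> r" for s c k
    unfolding Dt_eval
  proof (rule det_hankel_zero)
    show "m s \<in> kernel (?y s)" using ij(3) by (simp add: m_def)
    show "m s \<noteq> 0" using lcm[of s] by auto
    show "degree (m s) < r" using r_max[of s] that degm by simp
  qed
  have D0nz: "D0 \<noteq> 0" using generic[OF s1] by auto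
  \<comment> \<open>Generically \<open>Dt c k\<close> is D0 times the k-th power of the value of the
    generator at c, and at the other parameters everything vanishes; comparing k with 1 gives an
    identity of polynomials.\<close>
  have "D0 ^ k dvd D0 * Dt c 1 ^ k" for c k
  proof -
    have "Dt c k * D0 ^ k = D0 * Dt c 1 ^ k"
    proof (rule poly_ext)
      fix s
      show "poly (Dt c k * D0 ^ k) s = poly (D0 * Dt c 1 ^ k) s"
      proof (cases "i s + j s = r")
        case True
        then show ?thesis using generic[OF True] by (simp add: power_mult_distrib mult_ac)
      next
        case False
        then show ?thesis using degenerate[OF False, of c] degenerate[OF False, of 0 0] by (simp add: D0_def)
      qed
    qed
    then show ?thesis by (metis dvd_triv_right)
  qed
  then have "D0 dvd Dt c 1" for c by (rule power_dvd_imp_dvd[OF _ D0nz])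
  then have "\<forall>c. \<exists>q. Dt c 1 = D0 * q" unfolding dvd_def by blast
  \<comment> \<open>\<open>\<pi> c\<close> is a polynomial in s whose value is that of the generator
    at c for all but finitely many s.\<close>
  from choice[OF this] obtain \<pi> where \<pi>: "\<forall>c. Dt c 1 = D0 * \<pi> c" by (elim exE)
  define Z where "Z = {s. poly D0 s = 0}"
  have finZ: "finite Z" unfolding Z_def by (rule poly_roots_finite[OF D0nz])
  have notZ: "i s + j s = r" "poly (\<pi> c) s = poly (m s) c" if "s \<notin> Z" for s c
  proof -
    show 1: "i s + j s = r" using degenerate[of s 0 0] that by (auto simp: Z_def D0_def)
    have "poly (Dt c 1) s = poly D0 s * poly (\<pi> c) s" by (metis \<pi> poly_mult)
    then show "poly (\<pi> c) s = poly (m s) c" using generic[OF 1, of c 1] by auto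
  qed
  have inj: "inj_on real {..r}" by (simp add: inj_on_def)
  \<comment> \<open>The coefficients of the generator are recovered from its values at c = 0, ...,
    r; the factor X^2 is the shift of \<open>power_sum_coeffs\<close>.\<close>
  let ?L = "\<lambda>l. monom 1 2 * lagrange_basis real r l"
  define E where "E k = (\<Sum>l\<le>r. Polynomial.smult (coeff (?L l) k) (\<pi> (real l)))" for k
  have E: "poly (E k) s = coeff (monom 1 2 * m s) k" if "s \<notin> Z" for s k
  proof -
    have "m s = (\<Sum>l\<le>r. Polynomial.smult (poly (m s) (real l)) (lagrange_basis real r l))"
    proof (rule poly_ext)
      fix t show "poly (m s) t = poly (\<Sum>l\<le>r. Polynomial.smult (poly (m s) (real l)) (lagrange_basis real r l)) t"
        using lagrange_interpolation[OF inj, of "m s" t] degm[of s] notZ(1)[OF that]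
        by (simp add: poly_sum mult.commute)
    qed
    then have "coeff (monom 1 2 * m s) k = coeff (monom 1 2 *
        (\<Sum>l\<le>r. Polynomial.smult (poly (m s) (real l)) (lagrange_basis real r l))) k" by simp
    also have "\<dots> = (\<Sum>l\<le>r. poly (m s) (real l) * coeff (?L l) k)"
      by (simp add: sum_distrib_left coeff_sum)
    also have "\<dots> = poly (E k) s" by (simp add: E_def poly_sum notZ(2)[OF that] mult.commute)
    finally show ?thesis ..
  qed
  have "\<exists>i j. i + j = r \<and> poly (- E (Suc r)) s = real i * ?a s + real j * ?b s \<and>
      poly (E (Suc r) ^ 2 - Polynomial.smult 2 (E r)) s = real i * (?a s)\<^sup>2 + real j * (?b s)\<^sup>2" if s: "s \<notin> Z" for s
  proof (intro exI conjI)
    show ir: "i s + j s = r" by (rule notZ(1)[OF s])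
    have s1: "(\<Sum>l<r. \<rho> s l) = real (i s) * ?a s + real (j s) * ?b s"
      unfolding \<rho>_def ir[symmetric] using sum_two_roots[of "\<lambda>x. x" "i s" "?a s" "?b s" "j s"] by simp
    have s2: "(\<Sum>l<r. (\<rho> s l)\<^sup>2) = real (i s) * (?a s)\<^sup>2 + real (j s) * (?b s)\<^sup>2"
      unfolding \<rho>_def ir[symmetric] using sum_two_roots[of "\<lambda>x. x\<^sup>2" "i s" "?a s" "?b s" "j s"] by simp
    note ps = power_sum_coeffs[of "\<rho> s" r]
    show "poly (- E (Suc r)) s = real (i s) * ?a s + real (j s) * ?b s"
      using ps(2) by (simp add: E[OF s] m_prod[OF ir] s1)
    show "poly (E (Suc r) ^ 2 - Polynomial.smult 2 (E r)) s = real (i s) * (?a s)\<^sup>2 + real (j s) * (?b s)\<^sup>2"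
      using ps(2,3) by (simp add: E[OF s] m_prod[OF ir] s2)
  qed
  then show ?thesis using r1 finZ by blast
qed

end

lemma real_degree_le_of_growth:
  fixes p :: "real poly"
  assumes "\<And>t. t \<ge> 1 \<Longrightarrow> \<bar>poly p t\<bar> \<le> C * (1 + t) ^ k"
  shows "degree p \<le> k"
proof -
  let ?p = "map_poly complex_of_real p"
  have "poly ?p (of_real t) = of_real (poly p t)" for t
    by (simp add: poly_map_poly_altdef poly_altdef)
  then have "degree ?p \<le> k" using assms by (intro degree_le_of_growth[of ?p C]) simp
  then show ?thesis by (simp add: degree_map_poly)
qed

lemma bounded_poly_const:
  fixes p :: "real poly"
  assumes "\<And>t. t \<ge> 1 \<Longrightarrow> \<bar>poly p t\<bar> \<le> C"
  shows "poly p t = poly p 0"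
proof -
  have "degree p = 0" using real_degree_le_of_growth[of p C 0] assms by simp
  then show ?thesis by (metis degree_eq_zeroE poly_const_conv)
qed

context volume_poly_domain
begin

text \<open>So far the exponents may jump with s. The quotient u is continuous and equals j off the
  finite set Z, so it takes finitely many values and is constant.\<close>

lemma line_constant:
  assumes nz: "\<And>s. x0 + s *\<^sub>R y \<noteq> 0"
  shows "\<exists>i j E P. i + j \<ge> 1 \<and> (\<forall>s.
    poly E s = real i * lo D (x0 + s *\<^sub>R y) + real j * hi D (x0 + s *\<^sub>R y) \<and>
    poly P s = real i * (lo D (x0 + s *\<^sub>R y))\<^sup>2 + real j * (hi D (x0 + s *\<^sub>R y))\<^sup>2)"
proof -
  let ?a = "\<lambda>s. lo D (x0 + s *\<^sub>R y)" and ?b = "\<lambda>s. hi D (x0 + s *\<^sub>R y)"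
  obtain r E P Z where r: "r \<ge> 1" "finite Z" and EP: "\<And>s. s \<notin> Z \<Longrightarrow> \<exists>i j. i + j = r \<and>
    poly E s = real i * ?a s + real j * ?b s \<and> poly P s = real i * (?a s)\<^sup>2 + real j * (?b s)\<^sup>2"
    using line_generic[OF nz] by blast
  have ab: "?a s < ?b s" for s by (rule lo_less_hi[OF nz])
  \<comment> \<open>If E = i lo + j hi and i + j = r, this quotient is j.\<close>
  define u where "u s = (poly E s - real r * ?a s) / (?b s - ?a s)" for s
  have contu: "continuous_on UNIV u" unfolding u_def
    using ab by (intro continuous_intros line_continuous) (auto simp: less_imp_neq[symmetric])
  have u: "\<exists>i j. i + j = r \<and> u s = real j \<and> poly P s = real i * (?a s)\<^sup>2 + real j * (?b s)\<^sup>2" if sZ: "s \<notin> Z" for s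
  proof -
    obtain i j where ij: "i + j = r" "poly E s = real i * ?a s + real j * ?b s"
      "poly P s = real i * (?a s)\<^sup>2 + real j * (?b s)\<^sup>2" using EP[OF sZ] by blast
    have "poly E s - real r * ?a s = real j * (?b s - ?a s)"
      unfolding ij(2) ij(1)[symmetric] by (simp add: algebra_simps)
    then have "u s = real j" using ab[of s] by (simp add: u_def)
    with ij show ?thesis by blast
  qed
  have "{s. u s \<in> real ` {..r}} = UNIV"
  proof (rule cofinite_closed_UNIV)
    have "closed (u -` (real ` {..r}))"
      using contu by (intro continuous_closed_vimage finite_imp_closed) (auto simp: continuous_on_eq_continuous_at)
    then show "closed {s. u s \<in> real ` {..r}}" by (simp add: vimage_def)
    have "- {s. u s \<in> real ` {..r}} \<subseteq> Z"
    proof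
      fix s assume s: "s \<in> - {s. u s \<in> real ` {..r}}"
      show "s \<in> Z"
      proof (rule ccontr)
        assume "s \<notin> Z"
        from u[OF this] show False using s by auto
      qed
    qed
    then show "finite (- {s. u s \<in> real ` {..r}})" using r(2) finite_subset by blast
  qed
  then have "range u \<subseteq> real ` {..r}" by blast
  then have "finite (range u)" by (rule finite_subset) simp
  then have "u constant_on UNIV"
    using contu by (intro continuous_finite_range_constant) auto
  then obtain c where c: "\<And>s. u s = c" by (auto simp: constant_on_def)
  obtain s0 where "s0 \<notin> Z" using r(2) ex_new_if_finite[OF infinite_UNIV_char_0] by blast
  then obtain i j where ij: "i + j = r" "c = real j" using u c by metis
  have E: "poly E s = real i * ?a s + real j * ?b s" for s
  proof -
    have "poly E s - real r * ?a s = real j * (?b s - ?a s)"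
      using c[of s] ij(2) ab[of s] by (simp add: u_def field_simps)
    then show ?thesis unfolding ij(1)[symmetric] by (simp add: algebra_simps)
  qed
  have "{s. poly P s = real i * (?a s)\<^sup>2 + real j * (?b s)\<^sup>2} = UNIV"
  proof (rule cofinite_closed_UNIV)
    show "closed {s. poly P s = real i * (?a s)\<^sup>2 + real j * (?b s)\<^sup>2}"
      by (intro closed_Collect_eq continuous_intros line_continuous)
    have "- {s. poly P s = real i * (?a s)\<^sup>2 + real j * (?b s)\<^sup>2} \<subseteq> Z"
    proof
      fix s assume s: "s \<in> - {s. poly P s = real i * (?a s)\<^sup>2 + real j * (?b s)\<^sup>2}"
      show "s \<in> Z"
      proof (rule ccontr)
        assume "s \<notin> Z"
        then obtain i' j' where "i' + j' = r" "u s = real j'"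
          "poly P s = real i' * (?a s)\<^sup>2 + real j' * (?b s)\<^sup>2" using u by blast
        moreover have "j' = j" using c[of s] ij(2) calculation(2) by simp
        ultimately show False using s ij(1) by auto
      qed
    qed
    then show "finite (- {s. poly P s = real i * (?a s)\<^sup>2 + real j * (?b s)\<^sup>2})" using r(2) finite_subset by blast
  qed
  then have "poly P s = real i * (?a s)\<^sup>2 + real j * (?b s)\<^sup>2" for s by blast
  with E r(1) ij(1) show ?thesis by blast
qed

lemma support_lipschitz:
  obtains K where "K \<ge> 0" "\<And>y z. \<bar>hi D y - hi D z\<bar> \<le> K * norm (y - z)"
    "\<And>y z. \<bar>lo D y - lo D z\<bar> \<le> K * norm (y - z)" "\<And>y. \<bar>hi D y\<bar> \<le> K * norm y" "\<And>y. \<bar>lo D y\<bar> \<le> K * norm y"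
proof -
  obtain K where K: "K \<ge> 0" "\<And>y z. \<bar>hi D y - hi D z\<bar> \<le> K * norm (y - z)" "\<And>y. \<bar>hi D y\<bar> \<le> K * norm y"
    using hi_lipschitz[OF D(3,4)] by metis
  have "\<bar>lo D y - lo D z\<bar> \<le> K * norm (y - z)" "\<bar>lo D y\<bar> \<le> K * norm y" for y z
    using K(2)[of "- y" "- z"] K(3)[of "- y"] by (simp_all add: lo_eq norm_minus_commute)
  with K show ?thesis using that by blast
qed

text \<open>The functions hi and lo are Lipschitz and positively homogeneous; a negative factor s
  interchanges them.\<close>

lemma hi_lo_line:
  obtains K where "K \<ge> 0"
    "\<And>s. s \<ge> 0 \<Longrightarrow> \<bar>hi D (x0 + s *\<^sub>R y) - s * hi D y\<bar> \<le> K"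
    "\<And>s. s \<ge> 0 \<Longrightarrow> \<bar>lo D (x0 + s *\<^sub>R y) - s * lo D y\<bar> \<le> K"
    "\<And>s. s \<le> 0 \<Longrightarrow> \<bar>hi D (x0 + s *\<^sub>R y) - s * lo D y\<bar> \<le> K"
    "\<And>s. s \<le> 0 \<Longrightarrow> \<bar>lo D (x0 + s *\<^sub>R y) - s * hi D y\<bar> \<le> K"
proof -
  obtain K where K: "K \<ge> 0" "\<And>y z. \<bar>hi D y - hi D z\<bar> \<le> K * norm (y - z)"
    "\<And>y z. \<bar>lo D y - lo D z\<bar> \<le> K * norm (y - z)" using support_lipschitz by metis
  have pos: "hi D (s *\<^sub>R z) = s * hi D z" "lo D (s *\<^sub>R z) = s * lo D z" if "s \<ge> 0" for s z
    using that hi_scale[OF D(3,4)] lo_scale[OF D(3,4)] by auto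
  have neg: "hi D (s *\<^sub>R y) = s * lo D y" "lo D (s *\<^sub>R y) = s * hi D y" if "s \<le> 0" for s
    using that pos[of "- s" "- y"] by (simp_all add: lo_eq)
  have "\<bar>hi D (x0 + s *\<^sub>R y) - hi D (s *\<^sub>R y)\<bar> \<le> K * norm x0" "\<bar>lo D (x0 + s *\<^sub>R y) - lo D (s *\<^sub>R y)\<bar> \<le> K * norm x0" for s
    using K(2)[of "x0 + s *\<^sub>R y" "s *\<^sub>R y"] K(3)[of "x0 + s *\<^sub>R y" "s *\<^sub>R y"] by simp_all
  then show ?thesis using that[of "K * norm x0"] K(1) pos[of _ y] neg by (metis mult_nonneg_nonneg norm_ge_zero)
qed

text \<open>Comparing the slopes at both ends of the line, where \<open>lo\<close> and \<open>hi\<close> change roles, shows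
  that the two exponents agree.\<close>

lemma line_sums:
  assumes nz: "\<And>s. x0 + s *\<^sub>R y \<noteq> 0" and y: "y \<noteq> 0"
  shows "lo D (x0 + s *\<^sub>R y) + hi D (x0 + s *\<^sub>R y) = lo D x0 + hi D x0 + s * (lo D y + hi D y)"
    and "\<exists>p1. \<forall>s. (lo D (x0 + s *\<^sub>R y))\<^sup>2 + (hi D (x0 + s *\<^sub>R y))\<^sup>2 =
      (lo D x0)\<^sup>2 + (hi D x0)\<^sup>2 + p1 * s + ((lo D y)\<^sup>2 + (hi D y)\<^sup>2) * s\<^sup>2"
proof -
  let ?a = "\<lambda>s. lo D (x0 + s *\<^sub>R y)" and ?b = "\<lambda>s. hi D (x0 + s *\<^sub>R y)"
  let ?l = "lo D y" and ?h = "hi D y"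
  obtain i j E P where ij: "i + j \<ge> 1" and E: "\<And>s. poly E s = real i * ?a s + real j * ?b s"
    and P: "\<And>s. poly P s = real i * (?a s)\<^sup>2 + real j * (?b s)\<^sup>2"
    using line_constant[OF nz] by blast
  obtain K where K: "K \<ge> 0"
    and hp: "\<And>s. s \<ge> 0 \<Longrightarrow> \<bar>?b s - s * ?h\<bar> \<le> K" and lp: "\<And>s. s \<ge> 0 \<Longrightarrow> \<bar>?a s - s * ?l\<bar> \<le> K"
    and hn: "\<And>s. s \<le> 0 \<Longrightarrow> \<bar>?b s - s * ?l\<bar> \<le> K" and ln: "\<And>s. s \<le> 0 \<Longrightarrow> \<bar>?a s - s * ?h\<bar> \<le> K"
    using hi_lo_line[of x0 y] by blast
  have comb: "\<bar>real i * u + real j * v\<bar> \<le> real i * K + real j * K" if "\<bar>u\<bar> \<le> K" "\<bar>v\<bar> \<le> K" for u v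
  proof -
    have "\<bar>real i * u + real j * v\<bar> \<le> real i * \<bar>u\<bar> + real j * \<bar>v\<bar>"
      by (rule order_trans[OF abs_triangle_ineq]) (simp add: abs_mult)
    also have "\<dots> \<le> real i * K + real j * K" using that by (intro add_mono mult_left_mono) auto
    finally show ?thesis .
  qed
  \<comment> \<open>The slopes of E at plus infinity and at minus infinity.\<close>
  let ?kp = "real i * ?l + real j * ?h" and ?kn = "real i * ?h + real j * ?l"
  have "poly (E - [:0, ?kp:]) t = poly (E - [:0, ?kp:]) 0" for t
  proof (rule bounded_poly_const)
    fix s :: real assume "s \<ge> 1"
    then have "\<bar>real i * (?a s - s * ?l) + real j * (?b s - s * ?h)\<bar> \<le> real i * K + real j * K"
      by (intro comb lp hp) auto
    moreover have "poly (E - [:0, ?kp:]) s = real i * (?a s - s * ?l) + real j * (?b s - s * ?h)"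
      by (simp add: E algebra_simps)
    ultimately show "\<bar>poly (E - [:0, ?kp:]) s\<bar> \<le> real i * K + real j * K" by simp
  qed
  \<comment> \<open>A polynomial bounded on a half line is constant, so E is affine with slope
    \<open>?kp\<close>.\<close>
  then have Ep: "poly E t = poly E 0 + t * ?kp" for t
    by (metis (no_types, lifting) add_diff_cancel_right' diff_add_cancel mult_zero_left mult_zero_right poly_0 poly_diff poly_pCons add_0 add.right_neutral)
  have "poly (pcompose E [:0, -1:] + [:0, ?kn:]) t = poly (pcompose E [:0, -1:] + [:0, ?kn:]) 0" for t
  proof (rule bounded_poly_const)
    fix s :: real assume "s \<ge> 1"
    then have "\<bar>real i * (?a (- s) - (- s) * ?h) + real j * (?b (- s) - (- s) * ?l)\<bar> \<le> real i * K + real j * K"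
      by (intro comb ln hn) auto
    moreover have "poly (pcompose E [:0, -1:] + [:0, ?kn:]) s =
        real i * (?a (- s) - (- s) * ?h) + real j * (?b (- s) - (- s) * ?l)"
      by (simp add: poly_pcompose E algebra_simps)
    ultimately show "\<bar>poly (pcompose E [:0, -1:] + [:0, ?kn:]) s\<bar> \<le> real i * K + real j * K" by simp
  qed
  from this[of 1] have "poly E (- 1) + ?kn = poly E 0" by (simp add: poly_pcompose)
  then have "?kn = ?kp" using Ep[of "- 1"] by simp
  then have "(real i - real j) * (?l - ?h) = 0" by (simp add: algebra_simps)
  then have "i = j" using lo_less_hi[OF y] by simp
  then have i: "real i > 0" using ij by simp
  have x0: "?a 0 = lo D x0" "?b 0 = hi D x0" by simp_all
  show "?a s + ?b s = lo D x0 + hi D x0 + s * (?l + ?h)" for s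
  proof -
    have "real i * (?a s + ?b s) = real i * (lo D x0 + hi D x0 + s * (?l + ?h))"
      using Ep[of s] unfolding E x0 \<open>i = j\<close>[symmetric] by (simp add: algebra_simps)
    then show ?thesis using i by simp
  qed
  let ?c = "?l\<^sup>2 + ?h\<^sup>2"
  \<comment> \<open>P without its quadratic growth at plus infinity; the remainder is O(s), hence of
    degree at most 1.\<close>
  define R where "R = P - Polynomial.smult (real i * ?c) (monom 1 2)"
  have R: "poly R s = real i * ((?a s)\<^sup>2 + (?b s)\<^sup>2 - ?c * s\<^sup>2)" for s
    by (simp add: R_def P \<open>i = j\<close>[symmetric] poly_monom algebra_simps)
  have sq: "\<bar>u\<^sup>2 - (s * v)\<^sup>2\<bar> \<le> K * (K + 2 * \<bar>v\<bar>) * (1 + s)" if "\<bar>u - s * v\<bar> \<le> K" "s \<ge> 1" for u v s :: real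
  proof -
    have "u\<^sup>2 - (s * v)\<^sup>2 = (u - s * v) * ((u - s * v) + 2 * s * v)"
      by (simp add: power2_eq_square algebra_simps)
    then have "\<bar>u\<^sup>2 - (s * v)\<^sup>2\<bar> = \<bar>u - s * v\<bar> * \<bar>(u - s * v) + 2 * s * v\<bar>" by (simp add: abs_mult)
    also have "\<dots> \<le> K * (K + 2 * s * \<bar>v\<bar>)"
    proof (intro mult_mono that)
      have "\<bar>(u - s * v) + 2 * s * v\<bar> \<le> \<bar>u - s * v\<bar> + \<bar>2 * s * v\<bar>" by (rule abs_triangle_ineq)
      then show "\<bar>(u - s * v) + 2 * s * v\<bar> \<le> K + 2 * s * \<bar>v\<bar>" using that by (simp add: abs_mult)
    qed (use K in auto)
    also have "\<dots> \<le> K * ((K + 2 * \<bar>v\<bar>) * (1 + s))"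
      using K that(2) by (intro mult_left_mono) (auto simp: algebra_simps)
    finally show ?thesis by (simp add: mult.assoc)
  qed
  have "degree R \<le> 1"
  proof (rule real_degree_le_of_growth)
    fix s :: real assume s: "s \<ge> 1"
    have "\<bar>(?a s)\<^sup>2 + (?b s)\<^sup>2 - ?c * s\<^sup>2\<bar> \<le> \<bar>(?a s)\<^sup>2 - (s * ?l)\<^sup>2\<bar> + \<bar>(?b s)\<^sup>2 - (s * ?h)\<^sup>2\<bar>"
      by (simp add: power_mult_distrib algebra_simps)
    also have "\<dots> \<le> K * (K + 2 * \<bar>?l\<bar>) * (1 + s) + K * (K + 2 * \<bar>?h\<bar>) * (1 + s)"
      using s by (intro add_mono sq lp hp) auto
    finally have "real i * \<bar>(?a s)\<^sup>2 + (?b s)\<^sup>2 - ?c * s\<^sup>2\<bar> \<le>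
        real i * (K * (K + 2 * \<bar>?l\<bar>) * (1 + s) + K * (K + 2 * \<bar>?h\<bar>) * (1 + s))"
      using i by (intro mult_left_mono) auto
    then show "\<bar>poly R s\<bar> \<le> real i * (K * (K + 2 * \<bar>?l\<bar>) + K * (K + 2 * \<bar>?h\<bar>)) * (1 + s) ^ 1"
      by (simp add: R abs_mult distrib_right mult.assoc)
  qed
  then have "R = [:coeff R 0, coeff R 1:]"
    by (auto intro!: poly_eqI simp: coeff_pCons coeff_eq_0 split: nat.splits)
  then obtain r0 r1 where r: "R = [:r0, r1:]" by blast
  have "(?a s)\<^sup>2 + (?b s)\<^sup>2 = (lo D x0)\<^sup>2 + (hi D x0)\<^sup>2 + (r1 / real i) * s + ?c * s\<^sup>2" for s
  proof -
    have "r0 + r1 * s = real i * ((?a s)\<^sup>2 + (?b s)\<^sup>2 - ?c * s\<^sup>2)" using R[of s] by (simp add: r mult.commute)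
    moreover have "r0 = real i * ((lo D x0)\<^sup>2 + (hi D x0)\<^sup>2)" using R[of 0] by (simp add: r)
    ultimately have "real i * ((?a s)\<^sup>2 + (?b s)\<^sup>2) = real i * ((lo D x0)\<^sup>2 + (hi D x0)\<^sup>2 + (r1 / real i) * s + ?c * s\<^sup>2)"
      using i by (simp add: algebra_simps)
    then show ?thesis using i by simp
  qed
  then show "\<exists>p1. \<forall>s. (?a s)\<^sup>2 + (?b s)\<^sup>2 = (lo D x0)\<^sup>2 + (hi D x0)\<^sup>2 + p1 * s + ?c * s\<^sup>2" by blast
qed

section \<open>Centre and half width of the support interval as functions on lines\<close>

definition mid :: "'a \<Rightarrow> real" where "mid y = (hi D y + lo D y) / 2"

text \<open>The half width is squared because its square, not the half width itself, is a polynomial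
  along lines.\<close>

definition wid :: "'a \<Rightarrow> real" where "wid y = ((hi D y - lo D y) / 2)\<^sup>2"

lemma mid_wid_scale: "mid (c *\<^sub>R y) = c * mid y" "wid (c *\<^sub>R y) = c\<^sup>2 * wid y"
proof -
  have "hi D (c *\<^sub>R y) = (if c \<ge> 0 then c * hi D y else c * lo D y) \<and>
      lo D (c *\<^sub>R y) = (if c \<ge> 0 then c * lo D y else c * hi D y)"
    using hi_scale[OF D(3,4), of c y] lo_scale[OF D(3,4), of c y]
      hi_scale[OF D(3,4), of "- c" "- y"] lo_scale[OF D(3,4), of "- c" "- y"] by (simp add: lo_eq)
  then show "mid (c *\<^sub>R y) = c * mid y" "wid (c *\<^sub>R y) = c\<^sup>2 * wid y"
    by (auto simp: mid_def wid_def power2_eq_square field_simps)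
qed

lemma mid_wid_line:
  "mid (x + s *\<^sub>R y) = mid x + s * mid y" "\<exists>p1. \<forall>s. wid (x + s *\<^sub>R y) = wid x + p1 * s + wid y * s\<^sup>2"
proof -
  have "(\<forall>s. mid (x + s *\<^sub>R y) = mid x + s * mid y) \<and> (\<exists>p1. \<forall>s. wid (x + s *\<^sub>R y) = wid x + p1 * s + wid y * s\<^sup>2)"
  \<comment> \<open>Lines through 0 are outside the scope of \<open>line_sums\<close>; homogeneity
    settles them.\<close>
  proof (cases "y = 0 \<or> (\<exists>s. x + s *\<^sub>R y = 0)")
    case True
    show ?thesis
    proof (cases "y = 0")
      case y0: True
      have "mid 0 = 0" "wid 0 = 0" using mid_wid_scale[of 0 0] by simp_all
      then show ?thesis using y0 by (auto intro: exI[of _ 0])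
    next
      case False
      with True obtain s0 where "x + s0 *\<^sub>R y = 0" by blast
      then have x: "x = (- s0) *\<^sub>R y" by (simp add: eq_neg_iff_add_eq_0)
      have "mid (x + s *\<^sub>R y) = mid x + s * mid y" for s
        using mid_wid_scale(1)[of "- s0 + s" y] mid_wid_scale(1)[of "- s0" y]
        unfolding x scaleR_add_left[symmetric] by (simp add: algebra_simps)
      moreover have "wid (x + s *\<^sub>R y) = wid x + (- 2 * s0 * wid y) * s + wid y * s\<^sup>2" for s
        using mid_wid_scale(2)[of "- s0 + s" y] mid_wid_scale(2)[of "- s0" y]
        unfolding x scaleR_add_left[symmetric] by (simp add: power2_eq_square algebra_simps)
      ultimately show ?thesis by blast
    qed
  next
    case False
    then have nz: "\<And>s. x + s *\<^sub>R y \<noteq> 0" and y: "y \<noteq> 0" by auto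
    have m: "mid (x + s *\<^sub>R y) = mid x + s * mid y" for s
      using line_sums(1)[OF nz y, of s] by (simp add: mid_def field_simps)
    obtain p1 where p1: "\<And>s. (lo D (x + s *\<^sub>R y))\<^sup>2 + (hi D (x + s *\<^sub>R y))\<^sup>2 =
      (lo D x)\<^sup>2 + (hi D x)\<^sup>2 + p1 * s + ((lo D y)\<^sup>2 + (hi D y)\<^sup>2) * s\<^sup>2"
      using line_sums(2)[OF nz y] by blast
    have w: "wid z = ((lo D z)\<^sup>2 + (hi D z)\<^sup>2) / 2 - (mid z)\<^sup>2" for z
      by (simp add: wid_def mid_def power2_eq_square field_simps)
    have "wid (x + s *\<^sub>R y) = wid x + (p1 / 2 - 2 * mid x * mid y) * s + wid y * s\<^sup>2" for s
      unfolding w p1 m by (simp add: power2_eq_square field_simps)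
    with m show ?thesis by blast
  qed
  then show "mid (x + s *\<^sub>R y) = mid x + s * mid y" "\<exists>p1. \<forall>s. wid (x + s *\<^sub>R y) = wid x + p1 * s + wid y * s\<^sup>2"
    by blast+
qed

lemma wid_pos: "y \<noteq> 0 \<Longrightarrow> wid y > 0"
  using lo_less_hi[of y] by (simp add: wid_def)

lemma hi_eq: "hi D y = mid y + sqrt (wid y)"
proof (cases "y = 0")
  case True
  have "mid 0 = 0" "wid 0 = 0" using mid_wid_scale[of 0 0] by simp_all
  moreover have "hi D 0 = 0" using hi_scale[OF D(3,4), of 0 0] by simp
  ultimately show ?thesis using True by simp
next
  case False
  have "sqrt (wid y) = (hi D y - lo D y) / 2" using lo_less_hi[OF False] by (simp add: wid_def)
  then show ?thesis by (simp add: mid_def field_simps)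
qed

end

section \<open>Positive definite quadratic forms\<close>

text \<open>Positive definite quadratic forms described by their restrictions to lines; the bilinear
  form is recovered by polarization.\<close>

locale quadratic_on_lines =
  fixes B :: "'a::euclidean_space \<Rightarrow> real"
  assumes B_scale: "B (c *\<^sub>R y) = c\<^sup>2 * B y"
    and B_line: "\<exists>p. \<forall>s. B (x + s *\<^sub>R y) = B x + p * s + B y * s\<^sup>2"
    and B_pos: "y \<noteq> 0 \<Longrightarrow> B y > 0"
begin

definition \<beta> :: "'a \<Rightarrow> 'a \<Rightarrow> real" where "\<beta> x y = (B (x + y) - B (x - y)) / 4"

lemma B_expand: "B (x + s *\<^sub>R y) = B x + 2 * \<beta> x y * s + B y * s\<^sup>2"
proof -
  obtain p where p: "\<And>s. B (x + s *\<^sub>R y) = B x + p * s + B y * s\<^sup>2" using B_line by blast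
  have "p = 2 * \<beta> x y" using p[of 1] p[of "-1"] by (simp add: \<beta>_def)
  then show ?thesis using p by simp
qed

lemma beta_commute: "\<beta> x y = \<beta> y x"
proof -
  have "B (x - y) = B (y - x)" using B_scale[of "-1" "y - x"] by simp
  then show ?thesis by (simp add: \<beta>_def add.commute)
qed

lemma beta_self: "\<beta> x x = B x"
  using B_scale[of 2 x] B_scale[of 0 x] by (simp add: \<beta>_def scaleR_2)

lemma beta_scale_right: "\<beta> x (s *\<^sub>R y) = s * \<beta> x y"
proof -
  have "\<beta> x (s *\<^sub>R y) = (B (x + s *\<^sub>R y) - B (x + (- s) *\<^sub>R y)) / 4"
    by (simp add: \<beta>_def)
  also have "\<dots> = s * \<beta> x y"
    by (simp only: B_expand[of x s y] B_expand[of x "- s" y]) simp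
  finally show ?thesis .
qed

lemma beta_scale_left: "\<beta> (s *\<^sub>R y) x = s * \<beta> y x"
  by (simp only: beta_commute[of _ x] beta_scale_right)

lemmas beta_scale = beta_scale_right beta_scale_left

text \<open>\<open>\<beta> _ z\<close> is affine on every line, with slope k. Evaluating it at x + s
  y = s (y + x/s) in both ways and comparing s = 1 with s = 2 shows that k x y is
  \<open>\<beta> y z\<close>.\<close>

lemma beta_add_left: "\<beta> (x + y) z = \<beta> x z + \<beta> y z"
proof -
  define k where "k x y = (\<beta> (x + z) y - \<beta> (x - z) y) / 2" for x y
  have k: "\<beta> (u + s *\<^sub>R w) z = \<beta> u z + s * k u w" for u w s
  proof -
    have "u + s *\<^sub>R w + z = (u + z) + s *\<^sub>R w" "u + s *\<^sub>R w - z = (u - z) + s *\<^sub>R w"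
      by (simp_all add: algebra_simps)
    note eqs = this
    have "4 * \<beta> (u + s *\<^sub>R w) z = B (u + s *\<^sub>R w + z) - B (u + s *\<^sub>R w - z)"
      by (simp add: \<beta>_def)
    also have "\<dots> = B ((u + z) + s *\<^sub>R w) - B ((u - z) + s *\<^sub>R w)"
      by (simp only: eqs)
    also have "\<dots> = 4 * \<beta> u z + 4 * (s * k u w)"
      by (simp only: B_expand[of "u + z" s w] B_expand[of "u - z" s w])
        (simp add: \<beta>_def[of u z] k_def right_diff_distrib)
    finally show ?thesis by simp
  qed
  have *: "\<beta> x z + s * k x y = s * \<beta> y z + k y x" if "s \<noteq> 0" for s
  proof -
    have "x + s *\<^sub>R y = s *\<^sub>R (y + (1 / s) *\<^sub>R x)"
      using that by (simp add: scaleR_add_right)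
    then have "\<beta> (x + s *\<^sub>R y) z = s * \<beta> (y + (1 / s) *\<^sub>R x) z"
      by (simp only: beta_scale_left)
    also have "\<dots> = s * (\<beta> y z + (1 / s) * k y x)" by (simp only: k[of y "1 / s" x])
    also have "\<dots> = s * \<beta> y z + k y x" using that by (simp add: distrib_left)
    finally show ?thesis by (simp only: k[of x s y])
  qed
  have "k x y = \<beta> y z" using *[of 1] *[of 2] by simp
  then show ?thesis using k[of x 1 y] by simp
qed

lemma beta_add_right: "\<beta> z (x + y) = \<beta> z x + \<beta> z y"
  by (simp only: beta_commute[of z] beta_add_left)

lemmas beta_add = beta_add_left beta_add_right

lemma beta_zero[simp]: "\<beta> 0 x = 0" "\<beta> x 0 = 0"
  using beta_scale_right[of x 0 0] beta_scale_left[of 0 0 x] by simp_all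

lemma beta_sum: "finite A \<Longrightarrow> \<beta> (\<Sum>i\<in>A. f i) x = (\<Sum>i\<in>A. \<beta> (f i) x)"
  "finite A \<Longrightarrow> \<beta> x (\<Sum>i\<in>A. f i) = (\<Sum>i\<in>A. \<beta> x (f i))"
  by (induction rule: finite_induct) (simp_all add: beta_add)

lemma beta_diff: "\<beta> (x - y) z = \<beta> x z - \<beta> y z"
  using beta_add_left[of "x - y" y z] by simp

lemma gram_schmidt_beta:
  assumes "finite F" "F \<subseteq> (Basis :: 'a set)"
  shows "\<exists>e. (\<forall>i\<in>F. e i \<in> span F) \<and> (\<forall>i\<in>F. \<forall>j\<in>F. \<beta> (e i) (e j) = (if i = j then 1 else 0))"
  using assms
proof (induction F rule: finite_induct)
  case empty
  then show ?case by simp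
next
  case (insert b F)
  have "F \<subseteq> Basis" using insert.prems by simp
  from insert.IH[OF this] obtain e where e': "\<forall>i\<in>F. e i \<in> span F"
    and on': "\<forall>i\<in>F. \<forall>j\<in>F. \<beta> (e i) (e j) = (if i = j then 1 else 0)" by (elim exE conjE)
  have e: "e i \<in> span F" if "i \<in> F" for i using e' that by (rule bspec)
  have on: "\<beta> (e i) (e j) = (if i = j then 1 else 0)" if "i \<in> F" "j \<in> F" for i j
    using bspec[OF bspec[OF on' that(1)] that(2)] .
  define w where "w = b - (\<Sum>i\<in>F. \<beta> b (e i) *\<^sub>R e i)"
  have sF: "(\<Sum>i\<in>F. \<beta> b (e i) *\<^sub>R e i) \<in> span F"
    by (intro span_sum span_scale e)
  have "b \<notin> span F"
  proof -
    have "span F \<subseteq> span (Basis - {b})" using insert by (intro span_mono) auto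
    moreover have "b \<notin> span (Basis - {b})" using independent_Basis insert.prems by (auto simp: dependent_def)
    ultimately show ?thesis by blast
  qed
  then have "w \<noteq> 0" using sF by (auto simp: w_def)
  then have Bw: "B w > 0" by (rule B_pos)
  have worth: "\<beta> w (e j) = 0" if "j \<in> F" for j
  proof -
    have "\<beta> w (e j) = \<beta> b (e j) - (\<Sum>i\<in>F. \<beta> b (e i) * \<beta> (e i) (e j))"
      by (simp add: w_def beta_diff beta_sum insert beta_scale)
    also have "(\<Sum>i\<in>F. \<beta> b (e i) * \<beta> (e i) (e j)) = (\<Sum>i\<in>F. if i = j then \<beta> b (e i) else 0)"
      using on that by (intro sum.cong) auto
    finally show ?thesis using that insert by simp
  qed
  define e' where "e' = e(b := (1 / sqrt (B w)) *\<^sub>R w)"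
  have bF: "b \<notin> F" by fact
  have "e' i \<in> span (insert b F)" if "i \<in> insert b F" for i
  proof (cases "i = b")
    case True
    have "w \<in> span (insert b F)" unfolding w_def
      using subsetD[OF span_mono[of F "insert b F"] sF] by (intro span_diff) (auto intro: span_base)
    then show ?thesis using True by (simp add: e'_def span_scale)
  next
    case False
    then show ?thesis using that e span_mono[of F "insert b F"] by (auto simp: e'_def)
  qed
  moreover have "\<beta> (e' i) (e' j) = (if i = j then 1 else 0)" if "i \<in> insert b F" "j \<in> insert b F" for i j
  proof -
    have "\<beta> (e' b) (e' b) = 1"
      using Bw by (simp add: e'_def beta_self B_scale power_divide)
    moreover have "\<beta> (e' b) (e' j) = 0" "\<beta> (e' j) (e' b) = 0" if "j \<in> F" for j
      using worth[OF that] that bF by (auto simp: e'_def beta_scale beta_commute[of "e j"])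
    moreover have "\<beta> (e' i) (e' j) = (if i = j then 1 else 0)" if "i \<in> F" "j \<in> F" for i j
      using on[OF that] that bF by (auto simp: e'_def)
    ultimately show ?thesis using that bF by (cases "i = b"; cases "j = b") auto
  qed
  ultimately show ?case by (intro exI[of _ e'] conjI ballI)
qed

lemma orthonormalization:
  obtains g :: "'a \<Rightarrow> 'a" where "linear g" "bij g" "\<And>x. B (g x) = (norm x)\<^sup>2"
proof -
  obtain e :: "'a \<Rightarrow> 'a" where e: "\<forall>i\<in>Basis. \<forall>j\<in>Basis. \<beta> (e i) (e j) = (if i = j then 1 else 0)"
    using gram_schmidt_beta[OF finite_Basis subset_refl] by (elim exE conjE) (rule that)
  have on: "\<beta> (e i) (e j) = (if i = j then 1 else 0)" if "i \<in> Basis" "j \<in> Basis" for i j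
    using bspec[OF bspec[OF e that(1)] that(2)] .
  define g where "g x = (\<Sum>i\<in>Basis. (x \<bullet> i) *\<^sub>R e i)" for x :: 'a
  have lin: "linear g"
    unfolding g_def
    by (intro linearI) (simp_all add: inner_add_left scaleR_add_left sum.distrib scaleR_sum_right)
  have Bg: "B (g x) = (norm x)\<^sup>2" for x
  proof -
    have "B (g x) = (\<Sum>i\<in>Basis. \<Sum>j\<in>Basis. (x \<bullet> i) * ((x \<bullet> j) * \<beta> (e j) (e i)))"
      by (subst beta_self[symmetric]) (simp add: g_def beta_sum beta_scale sum_distrib_left)
    also have "\<dots> = (\<Sum>i\<in>Basis. \<Sum>j\<in>Basis. if i = j then (x \<bullet> i) * (x \<bullet> i) else 0)"
      by (intro sum.cong refl) (simp add: on)
    also have "\<dots> = x \<bullet> x" by (simp add: euclidean_inner[of x x])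
    finally show ?thesis by (simp add: dot_square_norm)
  qed
  have B0: "B 0 = 0" using B_scale[of 0 0] by simp
  have "x = 0" if "g x = 0" for x using Bg[of x] B0 that by simp
  then have "inj g" by (simp add: linear_injective_0[OF lin])
  then have "bij g" using linear_injective_imp_surjective[OF lin] by (simp add: bij_def)
  from that[OF lin this Bg] show ?thesis .
qed

end

text \<open>The linear function \<open>mid\<close> is the inner product with some v, and g brings
  the quadratic form \<open>wid\<close> to standard shape. The result is the support function of the
  ellipsoid with centre v and linear part inverse to \<open>adjoint g\<close>.\<close>

lemma (in volume_poly_domain) support_function_normal_form:
  obtains v and g :: "'a \<Rightarrow> 'a" where "linear g" "bij g" "\<And>y. hi D (g y) = v \<bullet> g y + norm y"
proof -
  interpret quadratic_on_lines wid
    by unfold_locales (use mid_wid_scale(2) mid_wid_line(2) wid_pos in auto)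
  obtain g :: "'a \<Rightarrow> 'a" where g: "linear g" "bij g" "\<And>x. wid (g x) = (norm x)\<^sup>2" by (rule orthonormalization, rule that)
  have "linear mid"
  proof (rule linearI)
    show "mid (x + y) = mid x + mid y" for x y using mid_wid_line(1)[of x 1 y] by simp
    show "mid (c *\<^sub>R y) = c *\<^sub>R mid y" for c y by (simp add: mid_wid_scale)
  qed
  define v where "v = (\<Sum>b\<in>Basis. mid b *\<^sub>R b)"
  have "mid y = v \<bullet> y" for y
  proof -
    have "mid y = mid (\<Sum>b\<in>Basis. (y \<bullet> b) *\<^sub>R b)" by (simp add: euclidean_representation)
    also have "\<dots> = (\<Sum>b\<in>Basis. (y \<bullet> b) * mid b)"
      using \<open>linear mid\<close> by (simp add: linear_sum linear_scale)
    also have "\<dots> = v \<bullet> y" by (simp add: v_def inner_sum_left inner_commute[of y] mult.commute)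
    finally show ?thesis .
  qed
  then have "hi D (g y) = v \<bullet> g y + norm y" for y by (simp add: hi_eq g(3))
  from that[OF g(1,2) this] show ?thesis .
qed

section \<open>Volumes of ellipsoids\<close>

lemma nn_integral_lborel_shift:
  fixes a :: "'a::euclidean_space"
  assumes "g \<in> borel_measurable borel"
  shows "(\<integral>\<^sup>+x. g (x + a) \<partial>lborel) = (\<integral>\<^sup>+x. g x \<partial>lborel)"
proof -
  have "(\<integral>\<^sup>+x. g x \<partial>lborel) = (\<integral>\<^sup>+x. g x \<partial>distr lborel borel ((+) a))"
    by (simp only: lborel_distr_plus)
  also have "\<dots> = (\<integral>\<^sup>+x. g (a + x) \<partial>lborel)"
    by (rule nn_integral_distr) (use assms in simp_all)
  finally show ?thesis by (simp only: add.commute)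
qed

lemma emeasure_lborel_reflect:
  fixes a :: "'a::euclidean_space"
  assumes [measurable]: "A \<in> sets borel"
  shows "emeasure lborel {y. a - y \<in> A} = emeasure lborel A"
proof -
  have "emeasure lborel A = emeasure (distr lborel borel (\<lambda>y. a + (-1) *\<^sub>R y)) A"
    using lborel_affine[of "-1" a] by (simp add: density_1)
  also have "\<dots> = emeasure lborel ((\<lambda>y. a + (-1) *\<^sub>R y) -` A)"
    by (subst emeasure_distr) auto
  finally show ?thesis by (simp add: vimage_def)
qed

text \<open>Uniqueness of Haar measure for the pullback of the Lebesgue measure. The library's
  determinant formula for linear images needs a well-ordered index type.\<close>

lemma emeasure_linear_vimage_mult:
  fixes f :: "'a::euclidean_space \<Rightarrow> 'a"
  assumes "linear f" "bij f" and [measurable]: "A \<in> sets borel" "B \<in> sets borel"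
  shows "emeasure lborel (f -` A) * emeasure lborel B = emeasure lborel A * emeasure lborel (f -` B)"
proof -
  have [measurable]: "f \<in> borel_measurable borel"
    by (intro borel_measurable_continuous_onI linear_continuous_on linear_conv_bounded_linear[THEN iffD1] assms(1))
  obtain h where h: "\<And>y. f (h y) = y" using assms(2) by (metis bij_inv_eq_iff)
  have vm: "f -` C \<in> sets borel" if "C \<in> sets borel" for C
    using measurable_sets[of f borel borel C] that by simp
  define F where "F x y = indicator A (f x) * (indicator B (y + f x) :: ennreal)" for x y
  have "emeasure lborel (f -` A) * emeasure lborel B
      = (\<integral>\<^sup>+x. indicator A (f x) * emeasure lborel B \<partial>lborel)"
    using vm[OF assms(3)] by (subst nn_integral_multc) (simp_all add: indicator_vimage[symmetric] comp_def flip: nn_integral_indicator)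
  also have "\<dots> = (\<integral>\<^sup>+x. (\<integral>\<^sup>+y. F x y \<partial>lborel) \<partial>lborel)"
  proof (rule nn_integral_cong)
    fix x
    have "(\<integral>\<^sup>+y. F x y \<partial>lborel) = indicator A (f x) * (\<integral>\<^sup>+y. indicator B (y + f x) \<partial>lborel)"
      unfolding F_def by (rule nn_integral_cmult) measurable
    also have "(\<integral>\<^sup>+y. indicator B (y + f x) \<partial>lborel) = emeasure lborel B"
      by (subst nn_integral_lborel_shift) simp_all
    finally show "indicator A (f x) * emeasure lborel B = (\<integral>\<^sup>+y. F x y \<partial>lborel)" by simp
  qed
  also have "\<dots> = (\<integral>\<^sup>+y. (\<integral>\<^sup>+x. F x y \<partial>lborel) \<partial>lborel)"
    by (rule lborel_pair.Fubini'[symmetric]) (simp add: F_def)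
  also have "\<dots> = (\<integral>\<^sup>+y. (\<integral>\<^sup>+x. indicator A (f x - y) * indicator B (f x) \<partial>lborel) \<partial>lborel)"
  proof (rule nn_integral_cong)
    fix y
    have "(\<integral>\<^sup>+x. F x y \<partial>lborel) = (\<integral>\<^sup>+x. F (x + - h y) y \<partial>lborel)"
      by (rule nn_integral_lborel_shift[symmetric]) (simp add: F_def)
    also have "\<dots> = (\<integral>\<^sup>+x. indicator A (f x - y) * indicator B (f x) \<partial>lborel)"
      by (simp add: F_def linear_diff[OF assms(1)] h)
    finally show "(\<integral>\<^sup>+x. F x y \<partial>lborel) = (\<integral>\<^sup>+x. indicator A (f x - y) * indicator B (f x) \<partial>lborel)" .
  qed
  also have "\<dots> = (\<integral>\<^sup>+x. (\<integral>\<^sup>+y. indicator A (f x - y) * indicator B (f x) \<partial>lborel) \<partial>lborel)"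
    by (rule lborel_pair.Fubini') simp
  also have "\<dots> = (\<integral>\<^sup>+x. emeasure lborel A * indicator B (f x) \<partial>lborel)"
  proof (rule nn_integral_cong)
    fix x
    have "(\<integral>\<^sup>+y. indicator A (f x - y) * indicator B (f x) \<partial>lborel)
        = (\<integral>\<^sup>+y. indicator A (f x - y) \<partial>lborel) * indicator B (f x)"
      by (rule nn_integral_multc) measurable
    also have "(\<integral>\<^sup>+y. indicator A (f x - y) \<partial>lborel) = (\<integral>\<^sup>+y. indicator {y. f x - y \<in> A} y \<partial>lborel)"
      by (intro nn_integral_cong) (simp add: indicator_def)
    also have "\<dots> = emeasure lborel {y. f x - y \<in> A}" by (rule nn_integral_indicator) measurable
    finally show "(\<integral>\<^sup>+y. indicator A (f x - y) * indicator B (f x) \<partial>lborel)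
        = emeasure lborel A * indicator B (f x)"
      by (simp add: emeasure_lborel_reflect)
  qed
  also have "\<dots> = emeasure lborel A * emeasure lborel (f -` B)"
    using vm[OF assms(4)] by (subst nn_integral_cmult) (simp_all add: indicator_vimage[symmetric] comp_def flip: nn_integral_indicator)
  finally show ?thesis .
qed

text \<open>\<open>\<kappa>\<close> is the absolute value of the determinant of f, obtained here as
  the quotient of volumes for the unit ball.\<close>

lemma measure_linear_vimage:
  fixes f :: "'a::euclidean_space \<Rightarrow> 'a"
  assumes "linear f" "bij f"
  obtains \<kappa> where "\<kappa> > 0"
    "\<And>A. A \<in> sets borel \<Longrightarrow> bounded A \<Longrightarrow> measure lborel A = \<kappa> * measure lborel (f -` A)"
proof -
  have blf: "bounded_linear f" using assms(1) by (simp add: linear_conv_bounded_linear)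
  have inj: "inj f" using assms(2) by (simp add: bij_def)
  have bv: "bounded (f -` A)" if bA: "bounded A" for A
  proof -
    obtain h where h: "linear h" "h \<circ> f = id" using linear_injective_left_inverse[OF assms(1) inj] by blast
    have "f -` A \<subseteq> h ` A" using h(2) by (auto simp: image_iff fun_eq_iff) metis
    moreover have "bounded (h ` A)"
      using bA h(1) by (simp add: bounded_linear_image linear_conv_bounded_linear)
    ultimately show ?thesis using bounded_subset by blast
  qed
  let ?B = "ball (0::'a) 1"
  have op: "open (f -` ?B)"
    using blf by (intro open_vimage) (auto intro: linear_continuous_on)
  have "0 \<in> f -` ?B" using linear_0[OF assms(1)] by simp
  then have pos: "measure lborel (f -` ?B) > 0" "measure lborel ?B > 0"
    using bv[OF bounded_ball] op by (auto intro!: measure_open_pos)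
  show ?thesis
  proof (rule that[of "measure lborel ?B / measure lborel (f -` ?B)"])
    show "measure lborel ?B / measure lborel (f -` ?B) > 0" using pos by simp
    fix A :: "'a set" assume A: "A \<in> sets borel" "bounded A"
    have "emeasure lborel (f -` A) * emeasure lborel ?B = emeasure lborel A * emeasure lborel (f -` ?B)"
      by (rule emeasure_linear_vimage_mult) (use assms A in auto)
    from arg_cong[OF this, of enn2real]
    have "measure lborel (f -` A) * measure lborel ?B = measure lborel A * measure lborel (f -` ?B)"
      by (simp add: enn2real_mult measure_def)
    then show "measure lborel A = measure lborel ?B / measure lborel (f -` ?B) * measure lborel (f -` A)"
      using pos by (simp add: field_simps)
  qed
qed

lemma adjoint_nonzero:
  fixes f :: "'a::euclidean_space \<Rightarrow> 'a"
  assumes f: "linear f" "bij f" and y: "y \<noteq> 0"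
  shows "adjoint f y \<noteq> 0"
proof
  assume a: "adjoint f y = 0"
  obtain z where z: "f z = y" using surjD[OF bij_is_surj[OF f(2)], of y] by auto
  have "y \<bullet> y = adjoint f y \<bullet> z" using adjoint_works[OF f(1)] z by (simp add: inner_commute)
  then show False using y a by simp
qed

text \<open>Pulling back by f turns a section of the ellipsoid into a section of the unit ball with
  normal \<open>adjoint f y\<close>, whose length is the half width of the ellipsoid in direction
  y.\<close>

lemma ellipsoid_cut_vol:
  fixes f :: "'a::euclidean_space \<Rightarrow> 'a"
  assumes f: "linear f" "bij f" and odd: "odd DIM('a)"
  obtains q where "\<And>y t. y \<noteq> 0 \<Longrightarrow> \<bar>t - y \<bullet> b\<bar> \<le> norm (adjoint f y) \<Longrightarrow>
    cut_vol ((\<lambda>x. f x + b) ` ball 0 1) y t = poly q ((t - y \<bullet> b) / norm (adjoint f y))"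
proof -
  obtain \<kappa> where "\<kappa> > 0" and \<kappa>: "\<And>A. A \<in> sets borel \<Longrightarrow> bounded A \<Longrightarrow> measure lborel A = \<kappa> * measure lborel (f -` A)"
    by (rule measure_linear_vimage[OF f], rule that)
  obtain q where "degree q \<le> DIM('a)" and q: "\<And>(y::'a) t. y \<noteq> 0 \<Longrightarrow> \<bar>t\<bar> \<le> 1 * norm y \<Longrightarrow>
      measure lborel {x\<in>ball 0 1. y \<bullet> x \<le> t} = poly q (t / norm y)"
    by (rule ball_section_poly'[OF odd, of 1]) (simp, rule that)
  have blf: "bounded_linear f" using f by (simp add: linear_conv_bounded_linear)
  let ?F = "f ` ball 0 1"
  have op: "open ?F"
    using f by (intro open_surjective_linear_image) (auto simp: bij_def)
  have bd: "bounded ?F" by (intro bounded_linear_image[OF bounded_ball blf])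
  show ?thesis
  proof (rule that[of "Polynomial.smult \<kappa> q"])
    fix y :: 'a and t assume y: "y \<noteq> 0" and t: "\<bar>t - y \<bullet> b\<bar> \<le> norm (adjoint f y)"
    have adj: "adjoint f y \<bullet> z = y \<bullet> f z" for z using adjoint_works[OF f(1)] by (simp add: inner_commute)
    have ay: "adjoint f y \<noteq> 0" by (rule adjoint_nonzero[OF f y])
    have img: "(\<lambda>x. f x + b) ` ball 0 1 = (\<lambda>x. x - (- b)) ` ?F" by (simp add: image_image)
    have vim: "f -` {x\<in>?F. y \<bullet> x \<le> t - y \<bullet> b} = {z\<in>ball 0 1. adjoint f y \<bullet> z \<le> t - y \<bullet> b}"
      using inj_image_mem_iff[of f _ "ball 0 1"] f(2) by (auto simp: adj bij_def)
    have "{x\<in>?F. y \<bullet> x \<le> t - y \<bullet> b} = ?F \<inter> {x. y \<bullet> x \<le> t - y \<bullet> b}" by auto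
    also have "\<dots> \<in> sets borel"
      using op by (intro sets.Int borel_closed closed_halfspace_le borel_open op)
    finally have bo: "{x\<in>?F. y \<bullet> x \<le> t - y \<bullet> b} \<in> sets borel" .
    have "cut_vol ((\<lambda>x. f x + b) ` ball 0 1) y t = measure lborel {x\<in>?F. y \<bullet> x \<le> t - y \<bullet> b}"
      unfolding img using op by (subst cut_vol_translate) (simp_all add: cut_vol_def)
    also have "\<dots> = \<kappa> * measure lborel {z\<in>ball 0 1. adjoint f y \<bullet> z \<le> t - y \<bullet> b}"
      unfolding vim[symmetric] by (intro \<kappa>[OF bo] bounded_subset[OF bd]) auto
    also have "\<dots> = \<kappa> * poly q ((t - y \<bullet> b) / norm (adjoint f y))"
      using q[OF ay, of "t - y \<bullet> b"] t by simp
    finally show "cut_vol ((\<lambda>x. f x + b) ` ball 0 1) y t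
        = poly (Polynomial.smult \<kappa> q) ((t - y \<bullet> b) / norm (adjoint f y))" by simp
  qed
qed

lemma csphere_lift:
  fixes g :: "real^'n::finite \<Rightarrow> complex"
  assumes "continuous_on (sphere 0 1) g"
  obtains a :: "'n csphere" where "\<And>\<xi>. \<xi> \<in> sphere 0 1 \<Longrightarrow> csphere_apply a \<xi> = g \<xi>"
proof -
  let ?h = "\<lambda>x. if x \<in> sphere 0 1 then g x else 0"
  have "continuous_on (sphere 0 1) ?h" by (rule continuous_on_eq[OF assms]) simp
  then have "csphere_apply (Abs_csphere ?h) = ?h" by (subst Abs_csphere_inverse) auto
  then show ?thesis using that[of "Abs_csphere ?h"] by simp
qed

lemma eval_z_pCons: "eval_z (pCons a p) \<xi> z = csphere_apply a \<xi> + z * eval_z p \<xi> z"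
proof -
  have "map_poly (\<lambda>a. csphere_apply a \<xi>) (pCons a p) = pCons (csphere_apply a \<xi>) (map_poly (\<lambda>a. csphere_apply a \<xi>) p)"
    by (rule Polynomial.map_poly_pCons) simp
  then show ?thesis by (simp add: eval_z_def)
qed

lemma deriv_w_monic_linear: "deriv_w [:p, 1:] = 1"
proof (rule poly_eqI)
  show "coeff (deriv_w [:p, 1:]) i = coeff 1 i" for i
    unfolding coeff_deriv_w by (cases i) (auto simp: coeff_pCons split: nat.split)
qed

lemma ellipsoid_imp_integrable:
  fixes E :: "(real^'n::finite) set"
  assumes odd: "odd CARD('n)" and E: "ellipsoid E"
  shows "algebraically_t_integrable E" "free_of_real_singularities E"
proof -
  obtain f :: "real^'n \<Rightarrow> real^'n" and b where f: "linear f" "bij f" and Eb: "E = (\<lambda>x. f x + b) ` ball 0 1"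
    using E unfolding ellipsoid_def by (elim exE conjE)
  have odd': "odd DIM(real^'n)" using odd by simp
  obtain q where q: "\<And>(y::real^'n) t. y \<noteq> 0 \<Longrightarrow> \<bar>t - y \<bullet> b\<bar> \<le> norm (adjoint f y) \<Longrightarrow>
    cut_vol E y t = poly q ((t - y \<bullet> b) / norm (adjoint f y))"
    by (rule ellipsoid_cut_vol[OF f odd', where b = b, folded Eb]) blast
  have "open (f ` ball 0 1)"
    using f by (intro open_surjective_linear_image) (auto simp: bij_def)
  then have "open ((+) b ` f ` ball 0 1)" by (rule open_translation)
  then have op: "open E" unfolding Eb by (simp add: image_image add.commute)
  have adj: "adjoint f y \<bullet> z = y \<bullet> f z" for y z using adjoint_works[OF f(1)] by (simp add: inner_commute)
  have a0: "adjoint f y \<noteq> 0" if "y \<noteq> 0" for y by (rule adjoint_nonzero[OF f that])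
  have cadj: "continuous_on S (adjoint f)" for S
    using adjoint_linear[OF f(1)] by (simp add: linear_continuous_on linear_conv_bounded_linear)
  have s0: "\<xi> \<noteq> 0" if "\<xi> \<in> sphere 0 1" for \<xi> :: "real^'n" using that by auto
  \<comment> \<open>A + B t will be the height normalized to [-1, 1]; both coefficients are
    continuous because \<open>adjoint f\<close> has no zeros on the sphere.\<close>
  obtain A :: "'n csphere" where A: "\<And>\<xi>. \<xi> \<in> sphere 0 1 \<Longrightarrow> csphere_apply A \<xi> = of_real (- (\<xi> \<bullet> b) / norm (adjoint f \<xi>))"
    by (rule csphere_lift[of "\<lambda>\<xi>. of_real (- (\<xi> \<bullet> b) / norm (adjoint f \<xi>))"])
      (auto intro!: continuous_intros cadj simp: a0 s0)
  obtain B :: "'n csphere" where B: "\<And>\<xi>. \<xi> \<in> sphere 0 1 \<Longrightarrow> csphere_apply B \<xi> = of_real (1 / norm (adjoint f \<xi>))"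
    by (rule csphere_lift[of "\<lambda>\<xi>. of_real (1 / norm (adjoint f \<xi>))"])
      (auto intro!: continuous_intros cadj simp: a0 s0)
  have "\<exists>c :: nat \<Rightarrow> 'n csphere. \<forall>k. \<forall>\<xi> \<in> sphere 0 1. csphere_apply (c k) \<xi> = of_real (coeff q k)"
  proof (intro choice allI)
    fix k
    obtain a :: "'n csphere" where "\<And>\<xi>. \<xi> \<in> sphere 0 1 \<Longrightarrow> csphere_apply a \<xi> = of_real (coeff q k)"
      by (rule csphere_lift[OF continuous_on_const], rule that)
    then show "\<exists>a :: 'n csphere. \<forall>\<xi> \<in> sphere 0 1. csphere_apply a \<xi> = of_real (coeff q k)"
      by (intro exI[of _ a]) simp
  qed
  then obtain c :: "nat \<Rightarrow> 'n csphere" where c: "\<forall>k. \<forall>\<xi> \<in> sphere 0 1. csphere_apply (c k) \<xi> = of_real (coeff q k)" ..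
  define p where "p = (\<Sum>k\<le>degree q. [:c k:] * [:A, B:] ^ k)"
  have p: "eval_z p \<xi> (of_real t) = of_real (poly q ((t - \<xi> \<bullet> b) / norm (adjoint f \<xi>)))"
    if \<xi>: "\<xi> \<in> sphere 0 1" for \<xi> t
  proof -
    interpret h: comm_ring_hom "\<lambda>q. eval_z q \<xi> (of_real t)" by (rule eval_z_comm_ring_hom[OF \<xi>])
    have 1: "eval_z [:c k:] \<xi> (of_real t) = of_real (coeff q k)" for k
      using c \<xi> by (simp add: eval_z_pCons)
    have "eval_z [:A, B:] \<xi> (of_real t) = csphere_apply A \<xi> + of_real t * csphere_apply B \<xi>"
      by (simp add: eval_z_pCons)
    also have "\<dots> = of_real ((t - \<xi> \<bullet> b) / norm (adjoint f \<xi>))"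
      by (simp add: A[OF \<xi>] B[OF \<xi>] diff_divide_distrib)
    finally have 2: "eval_z [:A, B:] \<xi> (of_real t) = of_real ((t - \<xi> \<bullet> b) / norm (adjoint f \<xi>))" .
    show ?thesis unfolding p_def
      by (simp only: h.hom_sum h.hom_mult h.hom_power 1 2 poly_altdef of_real_sum of_real_mult of_real_power)
  qed
  define Q where "Q = [:- p, 1:]"
  have Q0: "Q \<noteq> 0" "degree Q \<ge> 1" by (simp_all add: Q_def)
  have "Res Q = 1" unfolding Res_def Q_def deriv_w_monic_linear
    by (rule resultant_1)
  moreover have ann: "annihilates_vol Q E"
    unfolding annihilates_vol_def vol_domain_def
  proof clarify
    fix \<xi> x :: "real^'n" assume \<xi>: "\<xi> \<in> sphere 0 1" and x: "x \<in> E"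
    interpret h: comm_ring_hom "\<lambda>q. eval_z q \<xi> (of_real (\<xi> \<bullet> x))" by (rule eval_z_comm_ring_hom[OF \<xi>])
    obtain z where z: "x = f z + b" "norm z < 1" using x by (auto simp: Eb)
    have "\<bar>adjoint f \<xi> \<bullet> z\<bar> \<le> norm (adjoint f \<xi>) * norm z" by (rule Cauchy_Schwarz_ineq2)
    also have "\<dots> \<le> norm (adjoint f \<xi>) * 1" using z(2) by (intro mult_left_mono) auto
    finally have "\<bar>\<xi> \<bullet> x - \<xi> \<bullet> b\<bar> \<le> norm (adjoint f \<xi>)" by (simp add: z(1) inner_add_right adj)
    then have "vol_fun E \<xi> (\<xi> \<bullet> x) = poly q ((\<xi> \<bullet> x - \<xi> \<bullet> b) / norm (adjoint f \<xi>))"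
      using op q[OF s0[OF \<xi>]] by (simp add: vol_fun_eq_cut_vol)
    then show "eval_zw Q \<xi> (of_real (\<xi> \<bullet> x)) (of_real (vol_fun E \<xi> (\<xi> \<bullet> x))) = 0"
      by (simp add: eval_zw_def Q_def Polynomial.map_poly_pCons h.hom_uminus p[OF \<xi>])
  qed
  moreover have "csphere_apply (1 :: 'n csphere) \<xi> \<noteq> 0" "eval_z 1 \<xi> (of_real t) \<noteq> 0"
    if "\<xi> \<in> sphere 0 1" for \<xi> t
  proof -
    interpret c: comm_ring_hom "\<lambda>a. csphere_apply a \<xi>" by (rule csphere_apply_comm_ring_hom[OF that])
    interpret h: comm_ring_hom "\<lambda>q. eval_z q \<xi> (of_real t)" by (rule eval_z_comm_ring_hom[OF that])
    show "csphere_apply (1 :: 'n csphere) \<xi> \<noteq> 0" "eval_z 1 \<xi> (of_real t) \<noteq> 0" by simp_all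
  qed
  ultimately show "free_of_real_singularities E"
    unfolding free_of_real_singularities_def using Q0 by (intro exI[of _ Q]) simp
  show "algebraically_t_integrable E"
    unfolding algebraically_t_integrable_def using Q0(1) ann by blast
qed

section \<open>Domains touching their enclosing ball\<close>

text \<open>The first order content of \<open>smooth_boundary\<close>, with the derivative F as an
  explicit witness so that it can be carried through affine maps.\<close>

definition C1_boundary_at :: "'a::euclidean_space set \<Rightarrow> 'a \<Rightarrow> bool" where
  "C1_boundary_at D p \<longleftrightarrow> (\<exists>U \<rho> F. open U \<and> p \<in> U \<and>
     (\<forall>x\<in>U. (\<rho> has_derivative F x) (at x) \<and> (\<exists>w. F x w \<noteq> 0)) \<and>
     (\<forall>w. continuous_on U (\<lambda>x. F x w)) \<and> D \<inter> U = {x\<in>U. \<rho> x < (0::real)})"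

lemma smooth_boundary_C1:
  assumes "smooth_boundary D" "p \<in> frontier D"
  shows "C1_boundary_at D p"
proof -
  obtain U and \<rho> :: "'a \<Rightarrow> real" where U: "open U" "p \<in> U" "Cinfinity_on \<rho> U"
    "\<forall>x\<in>U. frechet_derivative \<rho> (at x) \<noteq> (\<lambda>_. 0)" "D \<inter> U = {x \<in> U. \<rho> x < 0}"
    using bspec[OF assms(1)[unfolded smooth_boundary_def] assms(2)] by (elim exE conjE)
  have "Ck_on (Suc 0) \<rho> U" using U(3) unfolding Cinfinity_on_def by (rule spec)
  then have d: "\<forall>x\<in>U. \<rho> differentiable (at x)" "\<forall>w. continuous_on U (\<lambda>x. frechet_derivative \<rho> (at x) w)"
    by simp_all
  show ?thesis unfolding C1_boundary_at_def
  proof (intro exI[of _ U] exI[of _ \<rho>] exI[of _ "\<lambda>x. frechet_derivative \<rho> (at x)"] conjI ballI)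
    fix x assume x: "x \<in> U"
    show "(\<rho> has_derivative frechet_derivative \<rho> (at x)) (at x)"
      using d(1) x by (simp add: frechet_derivative_works)
    show "\<exists>w. frechet_derivative \<rho> (at x) w \<noteq> 0" using bspec[OF U(4) x] by (simp add: fun_eq_iff)
  qed (use U d in simp_all)
qed

lemma C1_boundary_at_affine:
  fixes f :: "'a::euclidean_space \<Rightarrow> 'a"
  assumes f: "linear f" "bij f" and C: "C1_boundary_at ((\<lambda>x. f x + b) ` D) (f p + b)"
  shows "C1_boundary_at D p"
proof -
  let ?\<phi> = "\<lambda>x. f x + b"
  obtain U F and \<rho> :: "'a \<Rightarrow> real" where U: "open U" "f p + b \<in> U"
    "\<forall>x\<in>U. (\<rho> has_derivative F x) (at x) \<and> (\<exists>w. F x w \<noteq> 0)"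
    "\<forall>w. continuous_on U (\<lambda>x. F x w)" "?\<phi> ` D \<inter> U = {x\<in>U. \<rho> x < 0}"
    using C unfolding C1_boundary_at_def by (elim exE conjE)
  have blf: "bounded_linear f" using f by (simp add: linear_conv_bounded_linear)
  have cont: "continuous_on S ?\<phi>" for S
    by (intro continuous_intros linear_continuous_on blf)
  have inj: "?\<phi> x \<in> ?\<phi> ` D \<longleftrightarrow> x \<in> D" for x
  proof (rule inj_image_mem_iff, rule injI)
    fix x y assume "f x + b = f y + b"
    then show "x = y" using injD[OF bij_is_inj[OF f(2)], of x y] by simp
  qed
  show ?thesis unfolding C1_boundary_at_def
  proof (intro exI[of _ "?\<phi> -` U"] exI[of _ "\<rho> \<circ> ?\<phi>"] exI[of _ "\<lambda>x w. F (?\<phi> x) (f w)"] conjI ballI allI)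
    show "open (?\<phi> -` U)" using U(1) cont[of UNIV] by (rule open_vimage)
    show "p \<in> ?\<phi> -` U" using U(2) by simp
    fix x assume x: "x \<in> ?\<phi> -` U"
    have "(?\<phi> has_derivative f) (at x)"
      by (intro has_derivative_add_const bounded_linear_imp_has_derivative[OF blf])
    moreover have "(\<rho> has_derivative F (?\<phi> x)) (at (?\<phi> x))" using U(3) x by simp
    ultimately have "(\<rho> \<circ> ?\<phi> has_derivative F (?\<phi> x) \<circ> f) (at x)" by (rule diff_chain_at)
    then show "(\<rho> \<circ> ?\<phi> has_derivative (\<lambda>w. F (?\<phi> x) (f w))) (at x)" by (simp only: comp_def)
    have "\<exists>w. F (?\<phi> x) w \<noteq> 0" using U(3) x by simp
    then obtain w where w: "F (?\<phi> x) w \<noteq> 0" ..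
    obtain w' where "f w' = w" using surjD[OF bij_is_surj[OF f(2)], of w] by auto
    then show "\<exists>w. F (?\<phi> x) (f w) \<noteq> 0" using w by (intro exI[of _ w']) simp
  next
    fix w
    show "continuous_on (?\<phi> -` U) (\<lambda>x. F (?\<phi> x) (f w))"
      by (rule continuous_on_compose2[OF spec[OF U(4)] cont]) auto
  next
    show "D \<inter> ?\<phi> -` U = {x \<in> ?\<phi> -` U. (\<rho> \<circ> ?\<phi>) x < 0}"
    proof (rule Set.set_eqI)
      fix x
      have "?\<phi> x \<in> ?\<phi> ` D \<inter> U \<longleftrightarrow> ?\<phi> x \<in> {x\<in>U. \<rho> x < 0}" by (simp only: U(5))
      then show "x \<in> D \<inter> ?\<phi> -` U \<longleftrightarrow> x \<in> {x \<in> ?\<phi> -` U. (\<rho> \<circ> ?\<phi>) x < 0}"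
        using inj[of x] by simp
    qed
  qed
qed

lemma has_derivative_line:
  fixes \<rho> :: "'a::euclidean_space \<Rightarrow> real"
  assumes "(\<rho> has_derivative F) (at (p + s *\<^sub>R w))"
  shows "((\<lambda>s. \<rho> (p + s *\<^sub>R w)) has_real_derivative F w) (at s)"
proof -
  have "((\<lambda>s. p + s *\<^sub>R w) has_derivative (\<lambda>h. h *\<^sub>R w)) (at s)"
    by (auto intro!: derivative_eq_intros)
  from diff_chain_at[OF this assms]
  have "(\<rho> \<circ> (\<lambda>s. p + s *\<^sub>R w) has_derivative F \<circ> (\<lambda>h. h *\<^sub>R w)) (at s)" .
  moreover have "F \<circ> (\<lambda>h. h *\<^sub>R w) = (*) (F w)"
    using has_derivative_linear[OF assms] by (auto simp: fun_eq_iff linear_scale mult.commute)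
  ultimately show ?thesis by (simp add: has_field_derivative_def comp_def)
qed

text \<open>On the sphere the defining function vanishes, so its derivative at \<open>p\<close> is a positive
  multiple of the outward normal; moving from a nearby point of the ball to the sphere in this
  direction increases the function to \<open>0\<close>.\<close>

lemma C1_boundary_at_sphere:
  fixes D :: "'a::euclidean_space set"
  assumes "C1_boundary_at D p" and D: "D \<subseteq> ball 0 1" "sphere 0 1 \<subseteq> closure D" and p: "norm p = 1"
  shows "\<exists>e>0. ball p e \<inter> ball 0 1 \<subseteq> D"
proof -
  obtain U F and \<rho> :: "'a \<Rightarrow> real" where U: "open U" "p \<in> U"
    "\<forall>x\<in>U. (\<rho> has_derivative F x) (at x) \<and> (\<exists>w. F x w \<noteq> 0)"
    "\<forall>w. continuous_on U (\<lambda>x. F x w)" "D \<inter> U = {x\<in>U. \<rho> x < 0}"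
    using assms(1) unfolding C1_boundary_at_def by (elim exE conjE)
  have d: "(\<rho> has_derivative F x) (at x)" if "x \<in> U" for x using U(3) that by simp
  have neg: "\<rho> x < 0 \<longleftrightarrow> x \<in> D" if "x \<in> U" for x
  proof -
    have "x \<in> D \<inter> U \<longleftrightarrow> x \<in> {x\<in>U. \<rho> x < 0}" by (simp only: U(5))
    then show ?thesis using that by simp
  qed
  have nonneg: "\<rho> x \<ge> 0" if "x \<in> U" "norm x \<ge> 1" for x
  proof (rule ccontr)
    assume "\<not> \<rho> x \<ge> 0"
    then have "x \<in> D" using neg[OF that(1)] by simp
    then have "x \<in> ball 0 1" by (rule subsetD[OF D(1)])
    then show False using that(2) by simp
  qed
  have cont: "continuous_on U \<rho>"
    by (intro continuous_at_imp_continuous_on ballI has_derivative_continuous) (rule d)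
  \<comment> \<open>A positive value would persist near x, but points of D, where
    \<open>\<rho>\<close> is negative, accumulate at x.\<close>
  have zero: "\<rho> x = 0" if x: "x \<in> U" "norm x = 1" for x
  proof (rule ccontr)
    assume "\<rho> x \<noteq> 0"
    then have "\<rho> x > 0" using nonneg[of x] x by simp
    define V where "V = U \<inter> \<rho> -` {0<..}"
    have "open V" unfolding V_def by (rule continuous_open_preimage[OF cont U(1) open_greaterThan])
    moreover have "x \<in> V" using x \<open>\<rho> x > 0\<close> by (simp add: V_def)
    moreover have "x \<in> closure D" using D(2) x(2) by auto
    ultimately have "D \<inter> V \<noteq> {}" using open_Int_closure_eq_empty[of V D] by (auto simp: Int_commute)
    then obtain z where "z \<in> D" "z \<in> V" by auto
    then show False using neg[of z] by (simp add: V_def)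
  qed
  \<comment> \<open>A direction w with p \<bullet> w \<ge> 0 does not enter the open ball, and
    outside of it \<open>\<rho>\<close> is nonnegative, while it is 0 at p.\<close>
  have mono: "F p w \<ge> 0" if w: "p \<bullet> w \<ge> 0" for w
  proof (rule ccontr)
    assume "\<not> F p w \<ge> 0"
    then have "F p w < 0" by simp
    moreover have "((\<lambda>s. \<rho> (p + s *\<^sub>R w)) has_real_derivative F p w) (at 0)"
      by (rule has_derivative_line) (use d[OF U(2)] in simp)
    ultimately obtain \<delta> where \<delta>: "\<delta> > 0" "\<forall>h>0. h < \<delta> \<longrightarrow> \<rho> (p + (0 + h) *\<^sub>R w) < \<rho> (p + 0 *\<^sub>R w)"
      using DERIV_neg_dec_right[of "\<lambda>s. \<rho> (p + s *\<^sub>R w)" "F p w" 0] by auto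
    have "continuous_on UNIV (\<lambda>s. p + s *\<^sub>R w)" by (intro continuous_intros)
    then have "open ((\<lambda>s::real. p + s *\<^sub>R w) -` U)" using U(1) by (intro open_vimage)
    moreover have "0 \<in> (\<lambda>s::real. p + s *\<^sub>R w) -` U" using U(2) by simp
    ultimately obtain e where e: "e > 0" "ball 0 e \<subseteq> (\<lambda>s::real. p + s *\<^sub>R w) -` U"
      by (rule openE)
    define h where "h = min \<delta> e / 2"
    have h: "h > 0" "h < \<delta>" "h < e" using \<delta>(1) e(1) by (auto simp: h_def)
    have "h \<in> ball 0 e" using h by simp
    then have hU: "p + h *\<^sub>R w \<in> U" using e(2) by blast
    have "1 \<le> 1 + 2 * (h * (p \<bullet> w)) + h\<^sup>2 * (w \<bullet> w)" using h(1) w by simp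
    also have "\<dots> = (norm (p + h *\<^sub>R w))\<^sup>2"
      unfolding power2_norm_eq_inner using p
      by (simp add: inner_add_left inner_add_right power2_eq_square inner_commute[of w p] algebra_simps norm_eq_1)
    finally have "norm (p + h *\<^sub>R w) \<ge> 1" by (intro power2_le_imp_le[of 1]) simp_all
    then have "\<rho> (p + h *\<^sub>R w) \<ge> 0" by (rule nonneg[OF hU])
    moreover have "\<rho> p = 0" using zero[OF U(2) p] .
    ultimately show False using \<delta>(2) h by force
  qed
  have lin: "linear (F p)" using d[OF U(2)] by (rule has_derivative_linear)
  have pp: "p \<bullet> p = 1" using p by (simp add: norm_eq_1)
  \<comment> \<open>Otherwise \<open>F p\<close> vanishes on p and, by \<open>mono\<close> for u and
    -u, on the orthogonal complement of p, that is everywhere.\<close>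
  have Fpp: "F p p > 0"
  proof (rule ccontr)
    assume "\<not> F p p > 0"
    then have 0: "F p p = 0" using mono[of p] pp by simp
    obtain w where w: "F p w \<noteq> 0" using U(2,3) by auto
    define u where "u = w - (p \<bullet> w) *\<^sub>R p"
    have "p \<bullet> u = 0" using pp by (simp add: u_def inner_diff_right)
    then have "F p u \<ge> 0" "F p (- u) \<ge> 0" using mono[of u] mono[of "- u"] by simp_all
    then have "F p u = 0" using linear_neg[OF lin, of u] by simp
    then show False using w 0 by (simp add: u_def linear_diff[OF lin] linear_scale[OF lin])
  qed
  define V where "V = U \<inter> (\<lambda>x. F x p) -` {0<..}"
  have "open V" unfolding V_def by (rule continuous_open_preimage[OF spec[OF U(4)] U(1) open_greaterThan])
  moreover have "p \<in> V" using U(2) Fpp by (simp add: V_def)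
  ultimately obtain e where e: "e > 0" "ball p e \<subseteq> V" by (rule openE)
  show ?thesis
  \<comment> \<open>Half of e, so that z + s p stays in \<open>ball p e\<close> for s up to e/2, by
    which time it has left the open unit ball.\<close>
  proof (intro exI[of _ "e / 2"] conjI subsetI)
    show "e / 2 > 0" using e(1) by simp
    fix z assume z: "z \<in> ball p (e / 2) \<inter> ball 0 1"
    have inV: "z + s *\<^sub>R p \<in> V" if "0 \<le> s" "s \<le> e / 2" for s
    proof -
      have "dist p (z + s *\<^sub>R p) \<le> dist p z + s"
        using norm_triangle_ineq4[of "p - z" "s *\<^sub>R p"] that p by (simp add: dist_norm algebra_simps)
      then have "z + s *\<^sub>R p \<in> ball p e" using z that by simp
      then show ?thesis using e(2) by blast
    qed
    have "1 \<le> p \<bullet> (z + (e / 2) *\<^sub>R p)"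
    proof -
      have "p \<bullet> (p - z) \<le> norm p * norm (p - z)" by (rule norm_cauchy_schwarz)
      also have "\<dots> \<le> e / 2" using z p by (simp add: dist_norm)
      finally show ?thesis using pp by (simp add: inner_diff_right inner_add_right)
    qed
    also have "\<dots> \<le> norm p * norm (z + (e / 2) *\<^sub>R p)" by (rule norm_cauchy_schwarz)
    finally have "1 \<le> norm (z + (e / 2) *\<^sub>R p)" using p by simp
    moreover have "norm (z + 0 *\<^sub>R p) \<le> 1" using z by simp
    moreover have "continuous_on {0..e / 2} (\<lambda>s. norm (z + s *\<^sub>R p))" by (intro continuous_intros)
    ultimately obtain s where s: "0 \<le> s" "s \<le> e / 2" "norm (z + s *\<^sub>R p) = 1"
      using IVT'[of "\<lambda>s. norm (z + s *\<^sub>R p)" 0 1 "e / 2"] e(1) by auto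
    have "s \<noteq> 0" using s(3) z by auto
    then have "0 < s" using s(1) by simp
    then have "\<rho> (z + 0 *\<^sub>R p) < \<rho> (z + s *\<^sub>R p)"
    proof (rule DERIV_pos_imp_increasing)
      fix t assume t: "0 \<le> t" "t \<le> s"
      have "z + t *\<^sub>R p \<in> V" using inV[of t] t s(2) by simp
      then have "z + t *\<^sub>R p \<in> U" "F (z + t *\<^sub>R p) p > 0" by (simp_all add: V_def)
      then show "\<exists>y. ((\<lambda>s. \<rho> (z + s *\<^sub>R p)) has_real_derivative y) (at t) \<and> y > 0"
        by (intro exI[of _ "F (z + t *\<^sub>R p) p"] conjI has_derivative_line d)
    qed
    moreover have "z + s *\<^sub>R p \<in> U" "z \<in> U" using inV[OF s(1,2)] inV[of 0] e(1) by (simp_all add: V_def)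
    ultimately show "z \<in> D" using zero[of "z + s *\<^sub>R p"] s(3) neg[of z] by simp
  qed
qed

text \<open>The supremum hi is not attained on an open set, so D lies in the open unit ball. For x
  there, |x - p|^2 < 2 - 2 (p \<bullet> x), so points with p \<bullet> x close to 1 are close to
  p.\<close>

lemma support_function_norm:
  fixes D :: "'a::euclidean_space set"
  assumes D: "open D" "bounded D" "D \<noteq> {}" and hi: "\<And>y. hi D y = norm y"
  shows "D \<subseteq> ball 0 1" "sphere 0 1 \<subseteq> closure D"
proof -
  show sub: "D \<subseteq> ball 0 1"
  proof
    fix x assume x: "x \<in> D"
    show "x \<in> ball 0 1"
    proof (cases "x = 0")
      case False
      have "x \<bullet> x < norm x" using lo_less_inner_less_hi(2)[OF D(1,2) False x] hi by simp
      then have "norm x * norm x < norm x * 1" by (simp add: dot_square_norm power2_eq_square)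
      then show ?thesis using False by (simp del: mult_1_right)
    qed simp
  qed
  show "sphere 0 1 \<subseteq> closure D"
  proof
    fix p :: 'a assume "p \<in> sphere 0 1"
    then have p: "norm p = 1" by simp
    show "p \<in> closure D" unfolding closure_approachable
    proof (intro allI impI)
      fix e :: real assume e: "e > 0"
      \<comment> \<open>Above this height |x - p|^2 < 2 - 2 (1 - e^2/2) = e^2.\<close>
      have "\<exists>x\<in>D. p \<bullet> x > 1 - e\<^sup>2 / 2"
      proof (rule ccontr)
        assume "\<not> (\<exists>x\<in>D. p \<bullet> x > 1 - e\<^sup>2 / 2)"
        then have "hi D p \<le> 1 - e\<^sup>2 / 2" using D(3) by (intro hi_least) (auto simp: not_less)
        then show False using e p hi by simp
      qed
      then obtain x where x: "x \<in> D" "p \<bullet> x > 1 - e\<^sup>2 / 2" by blast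
      have "norm x < 1" using subsetD[OF sub x(1)] by simp
      then have "x \<bullet> x < 1" by (simp add: dot_square_norm power_less_one_iff)
      then have "(norm (x - p))\<^sup>2 < e\<^sup>2"
        using x(2) p by (simp add: power2_norm_eq_inner inner_diff_left inner_diff_right inner_commute[of x p] norm_eq_1)
      then have "dist x p < e" using e by (simp add: dist_norm power2_less_imp_less)
      then show "\<exists>y\<in>D. dist y p < e" using x(1) by blast
    qed
  qed
qed

text \<open>By the same estimate the cap of the unit ball above height 1 - e^2/2 is contained in
  \<open>ball p e\<close>.\<close>

lemma cap_subset:
  fixes D :: "'a::euclidean_space set"
  assumes "norm p = 1" "e > 0" "ball p e \<inter> ball 0 1 \<subseteq> D"
  shows "\<exists>r<1. \<forall>x\<in>ball 0 1 - D. p \<bullet> x \<le> r"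
proof (intro exI[of _ "1 - e\<^sup>2 / 2"] conjI ballI)
  fix x assume x: "x \<in> ball 0 1 - D"
  show "p \<bullet> x \<le> 1 - e\<^sup>2 / 2"
  proof (rule ccontr)
    assume "\<not> p \<bullet> x \<le> 1 - e\<^sup>2 / 2"
    moreover have "norm x < 1" using x by simp
    then have "x \<bullet> x < 1" by (simp add: dot_square_norm power_less_one_iff)
    ultimately have "(norm (p - x))\<^sup>2 < e\<^sup>2"
      using assms(1) by (simp add: power2_norm_eq_inner inner_diff_left inner_diff_right inner_commute[of x p] norm_eq_1)
    then have "x \<in> ball p e" using assms(2) by (simp add: dist_norm power2_less_imp_less)
    then show False using assms(3) x by blast
  qed
qed (use assms in simp)

lemma bij_adjoint:
  fixes f :: "'a::euclidean_space \<Rightarrow> 'a"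
  assumes "linear f" "bij f"
  shows "bij (adjoint f)"
proof -
  have "inj (adjoint f)"
    unfolding linear_injective_0[OF adjoint_linear[OF assms(1)]]
    using adjoint_nonzero[OF assms] by blast
  then show ?thesis
    using linear_injective_imp_surjective[OF adjoint_linear[OF assms(1)]] by (simp add: bij_def)
qed

text \<open>A null set contains no nonempty open set, so E lies in the closure of D. At a point of E
  on the frontier of D the function \<open>\<rho>\<close> becomes positive in some direction, and
  the points of E with positive \<open>\<rho>\<close> form an open set outside D. Slits and
  punctures are thereby excluded.\<close>

lemma null_difference_imp_eq:
  fixes D :: "'a::euclidean_space set"
  assumes D: "open D" "bounded D" and E: "open E" "bounded E" "D \<subseteq> E"
    and bd: "\<And>p. p \<in> frontier D \<Longrightarrow> C1_boundary_at D p"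
    and null: "measure lborel (E - D) = 0"
  shows "D = E"
proof -
  have no_open: "V = {}" if "open V" "V \<subseteq> E - D" for V
  proof (rule ccontr)
    assume "V \<noteq> {}"
    then have "measure lborel V > 0"
      using that bounded_subset[OF E(2)] by (intro measure_open_pos) auto
    moreover have "measure lborel V \<le> measure lborel (E - D)"
    proof (rule measure_mono_fmeasurable[OF that(2)])
      have "emeasure lborel (E - D) < \<infinity>" using bounded_subset[OF E(2)] by (intro emeasure_bounded_finite) auto
      then show "E - D \<in> fmeasurable lborel" using D(1) E(1) by (intro fmeasurableI) auto
    qed (use that in simp)
    ultimately show False using null by simp
  qed
  have "x \<in> D" if x: "x \<in> E" for x
  proof (rule ccontr)
    assume xD: "x \<notin> D"
    have "E - closure D = {}"
      using E(1) closure_subset[of D] by (intro no_open) auto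
    then have "x \<in> closure D" using x by blast
    then have "C1_boundary_at D x" using xD D(1) by (intro bd) (simp add: frontier_def interior_open)
    then obtain U F and \<rho> :: "'a \<Rightarrow> real" where U: "open U" "x \<in> U"
      "\<forall>x\<in>U. (\<rho> has_derivative F x) (at x) \<and> (\<exists>w. F x w \<noteq> 0)" "D \<inter> U = {x\<in>U. \<rho> x < 0}"
      unfolding C1_boundary_at_def by (elim exE conjE)
    have d: "(\<rho> has_derivative F x) (at x)" if "x \<in> U" for x using U(3) that by simp
    have lin: "linear (F x)" using d[OF U(2)] by (rule has_derivative_linear)
    have "\<exists>w. F x w \<noteq> 0" using U(2,3) by simp
    then obtain w where w: "F x w > 0"
      using linear_neg[OF lin] by (metis neg_0_less_iff_less linorder_neqE_linordered_idom)
    have neg: "\<rho> z < 0 \<longleftrightarrow> z \<in> D" if "z \<in> U" for z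
    proof -
      have "z \<in> D \<inter> U \<longleftrightarrow> z \<in> {x\<in>U. \<rho> x < 0}" by (simp only: U(4))
      then show ?thesis using that by simp
    qed
    have cont: "continuous_on U \<rho>"
      by (intro continuous_at_imp_continuous_on ballI has_derivative_continuous) (rule d)
    have "E \<inter> (U \<inter> \<rho> -` {0<..}) = {}"
    proof (rule no_open)
      show "open (E \<inter> (U \<inter> \<rho> -` {0<..}))"
        by (intro open_Int E(1) continuous_open_preimage[OF cont U(1) open_greaterThan])
      show "E \<inter> (U \<inter> \<rho> -` {0<..}) \<subseteq> E - D" using neg by fastforce
    qed
    moreover have "\<exists>z. z \<in> E \<inter> (U \<inter> \<rho> -` {0<..})"
    proof -
      have "((\<lambda>s. \<rho> (x + s *\<^sub>R w)) has_real_derivative F x w) (at 0)"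
        by (rule has_derivative_line) (use d[OF U(2)] in simp)
      then obtain \<delta> where \<delta>: "\<delta> > 0" "\<forall>h>0. h < \<delta> \<longrightarrow> \<rho> (x + 0 *\<^sub>R w) < \<rho> (x + (0 + h) *\<^sub>R w)"
        using DERIV_pos_inc_right[of "\<lambda>s. \<rho> (x + s *\<^sub>R w)" "F x w" 0] w by auto
      have "continuous_on UNIV (\<lambda>s. x + s *\<^sub>R w)" by (intro continuous_intros)
      then have "open ((\<lambda>s::real. x + s *\<^sub>R w) -` (U \<inter> E))" using U(1) E(1) by (intro open_vimage open_Int)
      moreover have "0 \<in> (\<lambda>s::real. x + s *\<^sub>R w) -` (U \<inter> E)" using U(2) x by simp
      ultimately obtain e where e: "e > 0" "ball 0 e \<subseteq> (\<lambda>s::real. x + s *\<^sub>R w) -` (U \<inter> E)"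
        by (rule openE)
      define h where "h = min \<delta> e / 2"
      have h: "h > 0" "h < \<delta>" "h < e" using \<delta>(1) e(1) by (auto simp: h_def)
      have "h \<in> ball 0 e" using h by simp
      then have "x + h *\<^sub>R w \<in> U \<inter> E" using e(2) by blast
      moreover have "\<rho> (x + h *\<^sub>R w) > 0"
        using \<delta>(2) h neg[OF U(2)] xD by force
      ultimately show ?thesis by (intro exI[of _ "x + h *\<^sub>R w"]) simp
    qed
    ultimately show False by simp
  qed
  then show ?thesis using E(3) by blast
qed

text \<open>Near the two poles of the enclosing ellipsoid \<open>E\<close> the complement of \<open>D\<close> in \<open>E\<close> is not
  seen, and both volume functions are polynomials in \<open>t\<close>, so they coincide.\<close>

theorem (in volume_poly_domain) smooth_imp_ellipsoid:
  assumes odd: "odd DIM('a)" and smooth: "smooth_boundary D"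
  shows "ellipsoid D"
proof -
  obtain v and g :: "'a \<Rightarrow> 'a" where g: "linear g" "bij g" and hiD: "\<And>y. hi D (g y) = v \<bullet> g y + norm y"
    by (rule support_function_normal_form, rule that)
  define h where "h = adjoint g"
  have h: "linear h" "bij h" unfolding h_def by (rule adjoint_linear[OF g(1)], rule bij_adjoint[OF g])
  have hg: "y \<bullet> h x = g y \<bullet> x" for x y
    using adjoint_works[OF g(1)] by (simp add: h_def inner_commute)
  define f where "f = inv_into UNIV h"
  have fh: "f (h x) = x" "h (f x) = x" for x
    unfolding f_def
    by (rule inv_f_f[OF bij_is_inj[OF h(2)]], rule surj_f_inv_f[OF bij_is_surj[OF h(2)]])
  have f: "bij f" "linear f"
    unfolding f_def by (rule bij_imp_bij_inv[OF h(2)], rule inj_linear_imp_inv_linear[OF h(1) bij_is_inj[OF h(2)]])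
  have fg: "g y \<bullet> f x = y \<bullet> x" for x y using hg[of y "f x"] fh by simp
  have adjf: "adjoint f (g y) = y" for y
  proof -
    have "adjoint f (g y) \<bullet> z = y \<bullet> z" for z
      using adjoint_works[OF f(2), of z "g y"] fg[of y z] by (simp only: inner_commute[of z] inner_commute[of "f z"])
    then show ?thesis by (rule vector_eq_rdot[THEN iffD1, OF allI])
  qed
  have blf: "bounded_linear f" and blh: "bounded_linear h"
    using f(2) h(1) by (simp_all add: linear_conv_bounded_linear)
  let ?\<phi> = "\<lambda>x. f x + v"
  \<comment> \<open>D in the coordinates in which its support function is the norm.\<close>
  define D' where "D' = h ` (\<lambda>x. x - v) ` D"
  define E where "E = ?\<phi> ` ball 0 1"
  have D\<phi>: "D = ?\<phi> ` D'" by (simp add: D'_def image_image fh)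
  have "open ((\<lambda>x. x - v) ` D)" using open_translation[OF D(1), of "- v"] by simp
  then have oD': "open D'" unfolding D'_def
    using open_surjective_linear_image[OF _ h(1) bij_is_surj[OF h(2)]] by simp
  have bD': "bounded D'" unfolding D'_def
    using bounded_translation_minus[OF D(3)] by (intro bounded_linear_image[OF _ blh])
  have nD': "D' \<noteq> {}" using D(4) by (simp add: D'_def)
  have hiD': "hi D' y = norm y" for y
  proof (rule antisym)
    show "hi D' y \<le> norm y"
    proof (rule hi_least[OF nD'])
      fix x assume "x \<in> D'"
      then obtain z where z: "z \<in> D" "x = h (z - v)" by (auto simp: D'_def)
      show "y \<bullet> x \<le> norm y"
        using hi_upper[OF D(3) z(1), of "g y"] hiD[of y] by (simp add: z(2) hg inner_diff_right inner_commute)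
    qed
    have "hi D (g y) \<le> hi D' y + v \<bullet> g y"
    proof (rule hi_least[OF D(4)])
      fix z assume "z \<in> D"
      then have "h (z - v) \<in> D'" by (simp add: D'_def)
      from hi_upper[OF bD' this, of y] show "g y \<bullet> z \<le> hi D' y + v \<bullet> g y"
        by (simp add: hg inner_diff_right inner_commute)
    qed
    then show "norm y \<le> hi D' y" using hiD[of y] by simp
  qed
  note touch = support_function_norm[OF oD' bD' nD' hiD']
  have cont: "continuous_on S ?\<phi>" for S
    by (intro continuous_intros linear_continuous_on blf)
  have inj: "inj ?\<phi>"
  proof (rule injI)
    fix x y assume "f x + v = f y + v"
    then show "x = y" using injD[OF bij_is_inj[OF f(1)], of x y] by simp
  qed
  have cap: "\<exists>r<1. \<forall>x\<in>ball 0 1 - D'. p \<bullet> x \<le> r" if p: "norm p = 1" for p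
  proof -
    have "p \<in> closure D'" using touch(2) p by auto
    then have "?\<phi> p \<in> closure D"
      using image_closure_subset[OF cont closed_closure closure_subset, of D'] D\<phi> by blast
    moreover have "p \<notin> D'" using subsetD[OF touch(1), of p] p by auto
    then have "?\<phi> p \<notin> D" using inj_image_mem_iff[OF inj, of p D'] D\<phi> by simp
    ultimately have "?\<phi> p \<in> frontier D" using D(1) by (simp add: frontier_def interior_open)
    then have "C1_boundary_at D (?\<phi> p)" by (rule smooth_boundary_C1[OF smooth])
    then have "C1_boundary_at D' p"
      by (intro C1_boundary_at_affine[OF f(2,1), of v D']) (simp flip: D\<phi>)
    from C1_boundary_at_sphere[OF this touch p] obtain e where "e > 0" "ball p e \<inter> ball 0 1 \<subseteq> D'"
      by (elim exE conjE)
    then show ?thesis by (rule cap_subset[OF p])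
  qed
  obtain p0 :: 'a where p0: "norm p0 = 1" using norm_Basis nonempty_Basis by blast
  obtain r1 where r1: "r1 < 1" "\<forall>x\<in>ball 0 1 - D'. p0 \<bullet> x \<le> r1" using cap[OF p0] by blast
  obtain r2 where r2: "r2 < 1" "\<forall>x\<in>ball 0 1 - D'. - p0 \<bullet> x \<le> r2" using cap[of "- p0"] p0 by auto
  \<comment> \<open>The unit ball minus \<open>D'\<close> lies between the heights -r and r in
    direction p0; taking the maximum with 0 serves the bounds on |t| below.\<close>
  define r where "r = max 0 (max r1 r2)"
  have r: "0 \<le> r" "r < 1" using r1(1) r2(1) by (auto simp: r_def)
  have band: "- r \<le> p0 \<bullet> x" "p0 \<bullet> x \<le> r" if "x \<in> ball 0 1 - D'" for x
    using bspec[OF r1(2) that] bspec[OF r2(2) that] by (auto simp: r_def)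
  define y where "y = g p0"
  have y0: "y \<noteq> 0"
  proof
    assume "y = 0"
    then have "p0 = 0" using adjf[of p0] linear_0[OF adjoint_linear[OF f(2)]] by (simp add: y_def)
    then show False using p0 by simp
  qed
  have hi_y: "hi D y = y \<bullet> v + 1" using hiD[of p0] p0 by (simp add: y_def inner_commute)
  have lo_y: "lo D y = y \<bullet> v - 1"
    using hiD[of "- p0"] p0 by (simp add: lo_eq y_def linear_neg[OF g(1)] inner_commute)
  have y\<phi>: "y \<bullet> ?\<phi> x = y \<bullet> v + p0 \<bullet> x" for x by (simp add: inner_add_right y_def fg)
  obtain q1 where q1: "\<And>y t. y \<noteq> 0 \<Longrightarrow> \<bar>t - y \<bullet> v\<bar> \<le> norm (adjoint f y) \<Longrightarrow>
    cut_vol E y t = poly q1 ((t - y \<bullet> v) / norm (adjoint f y))"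
    by (rule ellipsoid_cut_vol[OF f(2,1) odd, where b = v, folded E_def]) blast
  have VE: "cut_vol E y (y \<bullet> v + t) = poly q1 t" if "\<bar>t\<bar> < 1" for t
    using q1[OF y0, of "y \<bullet> v + t"] that p0 by (simp add: y_def adjf)
  obtain q2 where q2: "\<forall>x\<in>D. cut_vol D y (y \<bullet> x) = poly q2 (y \<bullet> x)"
    using vp y0 unfolding volume_polynomial_def by blast
  have VD: "cut_vol D y (y \<bullet> v + t) = poly (pcompose q2 [:y \<bullet> v, 1:]) t" if t: "\<bar>t\<bar> < 1" for t
  proof -
    have "\<exists>x\<in>D. y \<bullet> x = y \<bullet> v + t"
      by (rule inner_value_attained[OF D(2,4,3)]) (use t hi_y lo_y in auto)
    then obtain x where "x \<in> D" "y \<bullet> x = y \<bullet> v + t" by blast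
    with q2 show ?thesis by (simp add: poly_pcompose) metis
  qed
  have KD: "x \<in> E - D \<Longrightarrow> - r \<le> y \<bullet> x - y \<bullet> v \<and> y \<bullet> x - y \<bullet> v \<le> r" for x
  proof -
    assume x: "x \<in> E - D"
    then obtain z where z: "x = ?\<phi> z" "z \<in> ball 0 1" by (auto simp: E_def)
    have "z \<notin> D'" using x z(1) D\<phi> by blast
    then show ?thesis using band[of z] z(2) by (simp add: z(1) y\<phi>)
  qed
  have DE: "D \<subseteq> E" unfolding E_def D\<phi> by (rule image_mono[OF touch(1)])
  have "open (f ` ball 0 1)" by (rule open_surjective_linear_image[OF open_ball f(2) bij_is_surj[OF f(1)]])
  then have "open ((+) v ` f ` ball 0 1)" by (rule open_translation)
  then have oE: "open E" unfolding E_def by (simp add: image_image add.commute)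
  have "bounded ((+) v ` f ` ball 0 1)"
    by (intro bounded_translation bounded_linear_image[OF bounded_ball blf])
  then have bE: "bounded E" unfolding E_def by (simp add: image_image add.commute)
  have "infinite {-1<..<-r}" using r by simp
  \<comment> \<open>Between the heights -1 and -r the sections of D and E coincide, and two
    polynomials that agree on an interval are equal.\<close>
  have "q1 = pcompose q2 [:y \<bullet> v, 1:]"
  proof (rule ccontr)
    assume "q1 \<noteq> pcompose q2 [:y \<bullet> v, 1:]"
    then have "finite {t. poly (q1 - pcompose q2 [:y \<bullet> v, 1:]) t = 0}" by (intro poly_roots_finite) simp
    moreover have "{-1<..<-r} \<subseteq> {t. poly (q1 - pcompose q2 [:y \<bullet> v, 1:]) t = 0}"
    proof
      fix t assume t: "t \<in> {-1<..<-r}"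
      then have t1: "\<bar>t\<bar> < 1" using r by auto
      have "{x\<in>E. y \<bullet> x \<le> y \<bullet> v + t} = {x\<in>D. y \<bullet> x \<le> y \<bullet> v + t}"
        using DE KD t by fastforce
      then have "cut_vol E y (y \<bullet> v + t) = cut_vol D y (y \<bullet> v + t)" by (simp add: cut_vol_def)
      then show "t \<in> {t. poly (q1 - pcompose q2 [:y \<bullet> v, 1:]) t = 0}" using VE[OF t1] VD[OF t1] by simp
    qed
    ultimately show False using \<open>infinite {-1<..<-r}\<close> finite_subset by blast
  qed
  \<comment> \<open>A height above the band, so the section of E there contains all of E -
    D.\<close>
  define t where "t = (1 + r) / 2"
  have t: "r < t" "\<bar>t\<bar> < 1" using r by (auto simp: t_def)
  have eq: "cut_vol E y (y \<bullet> v + t) = cut_vol D y (y \<bullet> v + t)"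
    using VE[OF t(2)] VD[OF t(2)] \<open>q1 = _\<close> by simp
  have split: "{x\<in>E. y \<bullet> x \<le> y \<bullet> v + t} = {x\<in>D. y \<bullet> x \<le> y \<bullet> v + t} \<union> (E - D)"
    using DE KD t(1) by fastforce
  have "measure lborel ({x\<in>D. y \<bullet> x \<le> y \<bullet> v + t} \<union> (E - D)) =
      measure lborel {x\<in>D. y \<bullet> x \<le> y \<bullet> v + t} + measure lborel (E - D)"
  proof (rule measure_Union)
    have "{x\<in>D. y \<bullet> x \<le> y \<bullet> v + t} = D \<inter> {x. y \<bullet> x \<le> y \<bullet> v + t}" by auto
    also have "\<dots> \<in> sets borel"
      using D(1) by (intro sets.Int borel_closed closed_halfspace_le borel_open)
    finally show "{x\<in>D. y \<bullet> x \<le> y \<bullet> v + t} \<in> sets lborel" by simp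
    show "E - D \<in> sets lborel" using oE D(1) by simp
    have "bounded {x\<in>D. y \<bullet> x \<le> y \<bullet> v + t}" "bounded (E - D)"
      by (rule bounded_subset[OF D(3)], auto, rule bounded_subset[OF bE], auto)
    from emeasure_bounded_finite[OF this(1)] emeasure_bounded_finite[OF this(2)]
    show "emeasure lborel {x\<in>D. y \<bullet> x \<le> y \<bullet> v + t} \<noteq> \<infinity>" "emeasure lborel (E - D) \<noteq> \<infinity>" by simp_all
  qed auto
  then have "measure lborel (E - D) = 0" using eq split by (simp add: cut_vol_def)
  then have "D = E"
    by (intro null_difference_imp_eq[OF D(1,3) oE bE DE] smooth_boundary_C1[OF smooth])
  then show ?thesis unfolding ellipsoid_def E_def using f by (intro exI[of _ f] exI[of _ v]) simp
qed

theorem theorem1p5: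
  fixes D :: "(real^'n::finite) set"
  assumes "CARD('n) \<ge> 3" and "odd CARD('n)"
    and "open D" and "connected D" and "D \<noteq> {}" and "bounded D"
    and "smooth_boundary D"
  shows "(algebraically_t_integrable D \<and> free_of_real_singularities D) \<longleftrightarrow> ellipsoid D"
proof
  assume "algebraically_t_integrable D \<and> free_of_real_singularities D"
  then have "\<exists>M. volume_polynomial D M"
    using free_imp_volume_polynomial[OF assms(2,3,4,6,5)] by simp
  then obtain M where "volume_polynomial D M" ..
  then interpret volume_poly_domain D M by unfold_locales (use assms(3-6) in simp_all)
  show "ellipsoid D" by (rule smooth_imp_ellipsoid) (use assms(2,7) in simp_all)
next
  assume "ellipsoid D"
  then show "algebraically_t_integrable D \<and> free_of_real_singularities D"
    using ellipsoid_imp_integrable[OF assms(2)] by simp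
qed

end
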